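(* Let $\alpha,\beta\ge 0$ with $\alpha\neq\beta$. Let $X$ and $Y$ be independent random matrices with values in $\Omega_+$, each having a density (with respect to Lebesgue measure on $\Omega$) which is strictly positive and twice differentiable on $\Omega_+$. Let $(U,V)=\phi^{(\alpha,\beta)}(X,Y)$, where $\phi^{(\alpha,\beta)}:\Omega_+^2\to\Omega_+^2$ is $$\phi^{(\alpha,\beta)}(x,y)=\left(y(I+\alpha xy)^{-1}(I+\beta xy),\; x(I+\beta yx)^{-1}(I+\alpha yx)\right).$$ If $U$ and $V$ are independent, then there exist $\lambda\in\mathbb R$ and $a,b\in\Omega_+$ such that $$(X,Y)\sim \mathrm{MGIG}(\lambda,\alpha a,b)\otimes \mathrm{MGIG}(\lambda,\beta b,a)\quad\text{and}\quad (U,V)\sim \mathrm{MGIG}(\lambda,\alpha b,a)\otimes \mathrm{MGIG}(\lambda,\beta a,b).$$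
   Context: Fix an integer $r\ge1$. $\Omega$ denotes the space of real symmetric $r\times r$ matrices with inner product $\langle x,y\rangle=\mathrm{tr}(xy)$, and $\Omega_+\subset\Omega$ the open cone of positive definite matrices; $I$ is the identity matrix. For $\lambda\in\mathbb R$ and symmetric positive semidefinite $a,b$ (such that the function below is integrable), $\mathrm{MGIG}(\lambda,a,b)$ is the probability distribution on $\Omega_+$ with density proportional to $(\det x)^{\lambda-\frac{r+1}{2}}\exp\left(-\langle a,x\rangle-\langle b,x^{-1}\rangle\right)\mathbf 1_{\Omega_+}(x)$. The map $\phi^{(\alpha,\beta)}$ sends $\Omega_+^2$ into $\Omega_+^2$. $\mu\otimes\nu$ denotes the product (independent) law. *)

theory Defs
  imports "HOL-Analysis.Analysis" "HOL-Probability.Probability"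
begin

text \<open>Symmetric r x r matrices are modelled inside real^'n^'n (r = CARD('n)).
  A linear order on the index type is used to single out the upper-triangular
  coordinates.\<close>

definition sym_mats :: "(real^'n^'n) set" where
  "sym_mats = {A. transpose A = A}"

definition pd_mats :: "(real^'n^'n) set" where
  "pd_mats = {A. transpose A = A \<and> (\<forall>v. v \<noteq> 0 \<longrightarrow> v \<bullet> (A *v v) > 0)}"

definition inner_tr :: "real^'n^'n \<Rightarrow> real^'n^'n \<Rightarrow> real" where
  "inner_tr x y = trace (x ** y)"

definition sym_of_fun :: "('n \<times> 'n \<Rightarrow> real) \<Rightarrow> ((real, 'n::{finite,linorder}) vec, 'n) vec" where
  "sym_of_fun c = (\<chi> i j. if i \<le> j then c (i, j) else c (j, i))"

definition sym_of_vec :: "(real, 'n \<times> 'n) vec \<Rightarrow> ((real, 'n::{finite,linorder}) vec, 'n) vec" where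
  "sym_of_vec v = sym_of_fun (\<lambda>p. v $ p)"

text \<open>Lebesgue measure on Omega (normalised via the upper-triangular coordinates;
  it is a positive constant multiple of the Lebesgue measure induced by the trace inner
  product, which is irrelevant for all statements below).\<close>
definition leb_sym :: "(((real, 'n::{finite,linorder}) vec, 'n) vec) measure" where
  "leb_sym = distr (Pi\<^sub>M {p. fst p \<le> snd p} (\<lambda>_. lborel)) borel sym_of_fun"

definition twice_differentiable_on :: "('a::euclidean_space \<Rightarrow> real) \<Rightarrow> 'a set \<Rightarrow> bool" where
  "twice_differentiable_on f S \<longleftrightarrow>
     (\<exists>f' :: 'a \<Rightarrow> ('a \<Rightarrow>\<^sub>L real).
        (\<forall>x\<in>S. (f has_derivative blinfun_apply (f' x)) (at x)) \<and>
        (\<forall>x\<in>S. f' differentiable (at x)))"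

definition twice_differentiable_on_pd :: "(((real, 'n::{finite,linorder}) vec, 'n) vec \<Rightarrow> real) \<Rightarrow> bool" where
  "twice_differentiable_on_pd f \<longleftrightarrow>
     twice_differentiable_on (f \<circ> sym_of_vec) {v. sym_of_vec v \<in> pd_mats}"

definition mgig_dens :: "real \<Rightarrow> real^'n^'n \<Rightarrow> real^'n^'n \<Rightarrow> real^'n^'n \<Rightarrow> real" where
  "mgig_dens lam a b x =
     indicator pd_mats x * det x powr (lam - (real CARD('n) + 1) / 2)
       * exp (- inner_tr a x - inner_tr b (matrix_inv x))"

definition MGIG :: "real \<Rightarrow> ((real, 'n::{finite,linorder}) vec, 'n) vec \<Rightarrow> ((real, 'n) vec, 'n) vec \<Rightarrow> (((real, 'n) vec, 'n) vec) measure" where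
  "MGIG lam a b =
     density leb_sym (\<lambda>x. ennreal (mgig_dens lam a b x) /
                          (\<integral>\<^sup>+ y. ennreal (mgig_dens lam a b y) \<partial>leb_sym))"

definition phi :: "real \<Rightarrow> real \<Rightarrow> real^'n^'n \<Rightarrow> real^'n^'n \<Rightarrow> (real^'n^'n) \<times> (real^'n^'n)" where
  "phi \<alpha> \<beta> x y =
     (y ** matrix_inv (mat 1 + \<alpha> *\<^sub>R (x ** y)) ** (mat 1 + \<beta> *\<^sub>R (x ** y)),
      x ** matrix_inv (mat 1 + \<beta> *\<^sub>R (y ** x)) ** (mat 1 + \<alpha> *\<^sub>R (y ** x)))"

end

theory Submission
  imports Defs
begin

text \<open>
  Since \<open>\<phi>\<close> is an involution of \<open>\<Omega>\<^sub>+\<^sup>2\<close> preserving Lebesgue measure, the density of \<open>(U, V)\<close> is the density of \<open>(X, Y)\<close>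
  composed with \<open>\<phi>\<close>. Independence of \<open>U\<close> and \<open>V\<close> and continuity of the densities then give a functional equation
  \<open>A(x) + B(y) = C(u) + D(v)\<close> on \<open>\<Omega>\<^sub>+\<^sup>2\<close>, where \<open>A\<close> and \<open>B\<close> are the log densities of \<open>X\<close> and \<open>Y\<close>. Simultaneous diagonalization of
  \<open>x\<close> and \<open>y\<^sup>-\<^sup>1\<close> makes \<open>\<phi>\<close> act coordinatewise, and in each coordinate a scalar version of the equation forces
  \<open>A' = \<kappa>/m - \<alpha> a + b/m\<^sup>2\<close>. Comparing different frames shows that the linear coefficients are the values of trace forms and that
  the logarithmic part is a multiple of \<open>ln det\<close>. Finally, a nonpositive eigenvalue of \<open>a\<close> or of \<open>b\<close> would make the mass of the
  densities infinite for \<open>\<lambda> \<ge> 0\<close> and also for \<open>\<lambda> \<le> 0\<close>, so both parameters are positive definite.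
\<close>

section \<open>Matrices and the spectral theorem\<close>

text \<open>When x and y^-1 are diagonal in one frame, with entries m and n, then u^-1 and v are
  diagonal in the same frame, with entries n k and m k, where k = (n + \<alpha> m) / (n + \<beta>
  m). The algebraic properties of \<open>phi\<close> are read off from this. Its invariance of
  Lebesgue measure is not a scalar fact, since frames vary with the point: up to a swap
  \<open>phi\<close> is the map with parameters (\<alpha>, 0) followed by the one with (\<beta>, 0),
  and each of these consists of two translations of inverses whose derivatives are congruences. The
  obstacle in the functional equation is that the scalar result gives coefficients for each frame
  separately. Linear parts are glued by additivity on the cone; the logarithmic part is not linear
  in x, and is glued by differentiating a reflection identity at the identity matrix. One of
  \<alpha>, \<beta> may vanish, and then coefficients multiplied by it are invisible. Exchanging the
  two variables reduces this to \<alpha> > 0, and C is used wherever B shows only \<beta> b. The law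
  of (U, V) then follows from three quantities conserved by \<open>phi\<close>.\<close>

lemma matrix_inv_both:
  fixes A :: "real^'n^'n"
  assumes "invertible A"
  shows "A ** matrix_inv A = mat 1" "matrix_inv A ** A = mat 1"
  using assms unfolding invertible_def matrix_inv_def
  by (metis (mono_tags, lifting) someI_ex)+

lemma matrix_inv_eqI:
  fixes A B :: "real^'n^'n"
  assumes "A ** B = mat 1"
  shows "matrix_inv A = B" "invertible A"
proof -
  show inv: "invertible A" using assms invertible_right_inverse by blast
  have "matrix_inv A = matrix_inv A ** (A ** B)" using assms by simp
  also have "\<dots> = B" by (simp add: matrix_mul_assoc matrix_inv_both inv)
  finally show "matrix_inv A = B" .
qed

lemma invertible_matrix_inv: "invertible (A::real^'n^'n) \<Longrightarrow> invertible (matrix_inv A)"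
  using matrix_inv_both invertible_def by blast

lemma matrix_inv_matrix_inv: "invertible (A::real^'n^'n) \<Longrightarrow> matrix_inv (matrix_inv A) = A"
  by (rule matrix_inv_eqI) (simp add: matrix_inv_both)

lemma matrix_inv_mult:
  fixes A B :: "real^'n^'n"
  assumes "invertible A" "invertible B"
  shows "matrix_inv (A ** B) = matrix_inv B ** matrix_inv A"
proof (rule matrix_inv_eqI)
  have "A ** B ** (matrix_inv B ** matrix_inv A) = A ** (B ** matrix_inv B) ** matrix_inv A"
    by (simp add: matrix_mul_assoc)
  then show "A ** B ** (matrix_inv B ** matrix_inv A) = mat 1"
    using assms by (simp add: matrix_inv_both)
qed

lemma matrix_inv_transpose:
  "invertible (A::real^'n^'n) \<Longrightarrow> matrix_inv (transpose A) = transpose (matrix_inv A)"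
  by (rule matrix_inv_eqI)
     (simp add: matrix_inv_both flip: matrix_transpose_mul)

lemma transpose_add: "transpose (A + B) = transpose A + transpose B"
  by (simp add: transpose_def vec_eq_iff)

lemma matrix_add_mult_distrib: "((B + C) ** A) = (B ** A) + (C ** (A::real^'n^'m))"
  by (simp add: matrix_matrix_mult_def vec_eq_iff sum.distrib algebra_simps)

lemma matrix_scaleR_left: "(c *\<^sub>R A) ** B = c *\<^sub>R (A ** (B::real^'n^'m))"
  by (simp add: scalar_matrix_assoc)

lemma matrix_scaleR_right: "A ** (c *\<^sub>R B) = c *\<^sub>R (A ** (B::real^'n^'m))"
  by (metis matrix_scalar_ac scalar_matrix_assoc)

definition diagm :: "('n \<Rightarrow> real) \<Rightarrow> real^'n^'n" where
  "diagm d = (\<chi> i j. if i = j then d i else 0)"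

lemma diagm_mult: "diagm a ** diagm b = diagm (\<lambda>i. a i * b i)"
  by (simp add: diagm_def matrix_matrix_mult_def vec_eq_iff if_distrib cong: if_cong)
     (auto simp: if_distrib sum.delta if_distribR cong: if_cong)

lemma diagm_one: "diagm (\<lambda>_. 1) = mat 1"
  by (simp add: diagm_def mat_def)

lemma diagm_add: "diagm a + diagm b = diagm (\<lambda>i. a i + b i)"
  by (simp add: diagm_def vec_eq_iff)

lemma diagm_scaleR: "c *\<^sub>R diagm a = diagm (\<lambda>i. c * a i)"
  by (simp add: diagm_def vec_eq_iff)

lemma transpose_diagm: "transpose (diagm d) = diagm d"
  by (auto simp: diagm_def transpose_def vec_eq_iff)

lemma det_diagm: "det (diagm d) = (\<Prod>i\<in>UNIV. d i)"
  by (subst det_diagonal) (auto simp: diagm_def)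

lemma diagm_inv:
  assumes "\<And>i. d i \<noteq> 0"
  shows "matrix_inv (diagm d) = diagm (\<lambda>i. 1 / d i)" "invertible (diagm d)"
proof -
  have "diagm d ** diagm (\<lambda>i. 1 / d i) = mat 1"
    by (simp add: diagm_mult assms diagm_one)
  then show "matrix_inv (diagm d) = diagm (\<lambda>i. 1 / d i)" "invertible (diagm d)"
    using matrix_inv_eqI by blast+
qed

lemma diagm_vec: "diagm d *v v = (\<chi> i. d i * v $ i)"
  by (simp add: diagm_def matrix_vector_mult_def vec_eq_iff if_distrib[of "\<lambda>x. x * _"] cong: if_cong)

lemma diagm_pd:
  assumes "\<And>i. d i > 0"
  shows "diagm d \<in> pd_mats"
proof -
  have "v \<bullet> (diagm d *v v) > 0" if "v \<noteq> 0" for v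
  proof -
    obtain k where k: "v $ k \<noteq> 0" using \<open>v \<noteq> 0\<close> by (metis vec_eq_iff zero_index)
    have "v \<bullet> (diagm d *v v) = (\<Sum>i\<in>UNIV. d i * (v $ i)\<^sup>2)"
      by (simp add: diagm_vec inner_vec_def power2_eq_square algebra_simps)
    also have "\<dots> > 0"
      by (rule sum_pos2[where i = k]) (use assms k in \<open>auto simp: less_imp_le\<close>)
    finally show ?thesis .
  qed
  then show ?thesis by (simp add: pd_mats_def transpose_diagm)
qed

lemma symmetric_inner:
  fixes A :: "real^'n^'n"
  assumes "transpose A = A"
  shows "v \<bullet> (A *v w) = (A *v v) \<bullet> w"
  using dot_lmul_matrix[of v A w] transpose_matrix_vector[of A v] assms by simp

text \<open>A minimiser of the Rayleigh quotient on the unit sphere of an invariant subspace is an eigenvector; split it off and recurse.\<close>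

lemma self_adjoint_orthonormal_eigenbasis:
  fixes f :: "'a::euclidean_space \<Rightarrow> 'a"
  assumes lin: "linear f" and adj: "\<And>v w. v \<bullet> f w = f v \<bullet> w"
    and "subspace S" "f ` S \<subseteq> S"
  shows "\<exists>B. B \<subseteq> S \<and> span B = S \<and> pairwise orthogonal B
           \<and> (\<forall>b\<in>B. norm b = 1 \<and> (\<exists>\<mu>. f b = \<mu> *\<^sub>R b))"
  using assms(3,4)
proof (induction "dim S" arbitrary: S rule: less_induct)
  case less
  show ?case
  proof (cases "S \<subseteq> {0}")
    case True
    then have "S = {0}" using less.prems(1) subspace_0 by blast
    then show ?thesis by (intro exI[of _ "{}"]) auto
  next
    case False
    then obtain z where z: "z \<in> S" "z \<noteq> 0" by auto
    define K where "K = S \<inter> sphere 0 1"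
    have comp: "compact K"
      unfolding K_def using closed_subspace[OF less.prems(1)] by (simp add: closed_Int_compact)
    have "(1 / norm z) *\<^sub>R z \<in> K"
      using z less.prems(1) by (simp add: K_def subspace_scale)
    then have ne: "K \<noteq> {}" by blast
    have cont: "continuous_on K (\<lambda>v. v \<bullet> f v)"
      using linear_continuous_on[OF lin[unfolded linear_conv_bounded_linear]]
      by (intro continuous_intros) auto
    obtain e where e: "e \<in> K" and min: "\<And>v. v \<in> K \<Longrightarrow> e \<bullet> f e \<le> v \<bullet> f v"
      using continuous_attains_inf[OF comp ne cont] by blast
    define \<mu> where "\<mu> = e \<bullet> f e"
    have eS: "e \<in> S" and en: "norm e = 1" using e by (auto simp: K_def)
    have ray: "\<mu> * (v \<bullet> v) \<le> v \<bullet> f v" if "v \<in> S" for v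
    proof (cases "v = 0")
      case True then show ?thesis by (simp add: linear_0[OF lin])
    next
      case False
      have "(1 / norm v) *\<^sub>R v \<in> K"
        using that False less.prems(1) by (simp add: K_def subspace_scale)
      from min[OF this] have "\<mu> \<le> (1 / norm v)^2 * (v \<bullet> f v)"
        by (simp add: \<mu>_def linear_scale[OF lin] power2_eq_square)
      then have "\<mu> * (norm v)^2 \<le> v \<bullet> f v"
        using False by (simp add: field_simps)
      then show ?thesis by (simp add: power2_norm_eq_inner)
    qed
    have orth: "w \<bullet> (f e - \<mu> *\<^sub>R e) = 0" if w: "w \<in> S" for w
    proof (rule ccontr)
      define p where "p = w \<bullet> (f e - \<mu> *\<^sub>R e)"
      define q where "q = w \<bullet> f w - \<mu> * (w \<bullet> w)"
      assume "w \<bullet> (f e - \<mu> *\<^sub>R e) \<noteq> 0"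
      then have p: "p \<noteq> 0" by (simp add: p_def)
      \<comment> \<open>The form v . f v - \<mu> v . v is nonnegative on S and vanishes at e. Along
        e + t w it is a quadratic in t without constant term, so its linear coefficient must
        vanish.\<close>
      have key: "0 \<le> 2 * t * p + t\<^sup>2 * q" for t
      proof -
        have "e + t *\<^sub>R w \<in> S" using eS w less.prems(1) by (simp add: subspace_add subspace_scale)
        from ray[OF this] have "\<mu> * ((e + t *\<^sub>R w) \<bullet> (e + t *\<^sub>R w)) \<le> (e + t *\<^sub>R w) \<bullet> f (e + t *\<^sub>R w)" .
        moreover have "f (e + t *\<^sub>R w) = f e + t *\<^sub>R f w"
          by (simp add: linear_add[OF lin] linear_scale[OF lin])
        moreover have "e \<bullet> e = 1" using en by (simp add: dot_square_norm)
        moreover have "e \<bullet> f w = w \<bullet> f e" using adj[of e w] by (simp add: inner_commute)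
        ultimately show ?thesis
          by (simp add: p_def q_def inner_add inner_diff algebra_simps \<mu>_def power2_eq_square inner_commute)
      qed
      have "0 \<le> q" using key[of 1] key[of "-1"] by simp
      show False
      proof (cases "q = 0")
        case True then show False using key[of "-p"] p by (auto simp: mult_le_0_iff)
      next
        case False
        then have "q > 0" using \<open>0 \<le> q\<close> by simp
        have "2 * (-p/q) * p + (-p/q)\<^sup>2 * q = - (p\<^sup>2 / q)"
          using \<open>q > 0\<close> by (simp add: field_simps power2_eq_square)
        moreover have "p\<^sup>2 / q > 0" using p \<open>q > 0\<close> by simp
        ultimately show False using key[of "-p/q"] by linarith
      qed
    qed
    have "f e - \<mu> *\<^sub>R e \<in> S"
      using eS less.prems by (simp add: subspace_diff subspace_scale image_subset_iff)
    from orth[OF this] have fe: "f e = \<mu> *\<^sub>R e" by simp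
    define S' where "S' = {x \<in> S. x \<bullet> e = 0}"
    have sub': "subspace S'"
      using less.prems(1) unfolding S'_def subspace_def by (auto simp: inner_add)
    have "f ` S' \<subseteq> S'"
      using less.prems(2) adj fe unfolding S'_def by (auto simp flip: adj)
    have eS': "e \<notin> S'" using en by (auto simp: S'_def)
    have "S' \<subseteq> S" by (auto simp: S'_def)
    then have "S' \<subset> S" using eS eS' by blast
    then have "dim S' < dim S"
      by (metis dim_psubset less.prems(1) span_eq_iff sub')
    from less.hyps[OF this sub' \<open>f ` S' \<subseteq> S'\<close>]
    obtain B where B: "B \<subseteq> S'" "span B = S'" "pairwise orthogonal B"
      "\<forall>b\<in>B. norm b = 1 \<and> (\<exists>\<mu>. f b = \<mu> *\<^sub>R b)" by blast
    have "span (insert e B) = S"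
    proof
      show "span (insert e B) \<subseteq> S"
        using B(1) eS less.prems(1) by (intro span_minimal) (auto simp: S'_def)
      show "S \<subseteq> span (insert e B)"
      proof
        fix x assume x: "x \<in> S"
        have "x - (x \<bullet> e) *\<^sub>R e \<in> S'"
          using x eS en less.prems(1)
          by (simp add: S'_def subspace_diff subspace_scale inner_diff dot_square_norm)
        then have "x - (x \<bullet> e) *\<^sub>R e \<in> span B" using B(2) by simp
        then have "x - (x \<bullet> e) *\<^sub>R e \<in> span (insert e B)" by (meson span_mono subset_insertI subsetD)
        moreover have "(x \<bullet> e) *\<^sub>R e \<in> span (insert e B)" by (simp add: span_base span_scale)
        ultimately show "x \<in> span (insert e B)" by (metis diff_add_cancel span_add)
      qed
    qed
    moreover have "pairwise orthogonal (insert e B)"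
      using B(1,3) by (intro pairwise_orthogonal_insert)
        (auto simp: S'_def orthogonal_def inner_commute)
    ultimately show ?thesis
      using B eS en fe by (intro exI[of _ "insert e B"]) (auto simp: S'_def)
  qed
qed

theorem spectral_decomposition:
  fixes A :: "real^'n^'n"
  assumes sym: "transpose A = A"
  obtains Q d where "orthogonal_matrix Q" "A = Q ** diagm d ** transpose Q"
proof -
  have "linear ((*v) A)" by simp
  from self_adjoint_orthonormal_eigenbasis[OF this symmetric_inner[OF sym], of UNIV]
  obtain B where B: "span B = UNIV" "pairwise orthogonal B"
    "\<And>b. b \<in> B \<Longrightarrow> norm b = 1" "\<And>b. b \<in> B \<Longrightarrow> \<exists>\<mu>. A *v b = \<mu> *\<^sub>R b"
    by (auto simp: subspace_UNIV)
  have "0 \<notin> B" using B(3) by fastforce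
  then have ind: "independent B" using B(2) pairwise_orthogonal_independent by blast
  then have "finite B" by (rule independent_imp_finite)
  have "card B = CARD('n)"
    using dim_eq_card[of B UNIV] ind B(1) by simp
  then obtain h where h: "bij_betw h (UNIV::'n set) B"
    using \<open>finite B\<close> by (metis bij_betw_iff_card finite)
  define Q where "Q = (\<chi> i j. h j $ i)"
  have col: "column j Q = h j" for j by (simp add: column_def Q_def vec_eq_iff)
  have orth: "orthogonal_matrix Q"
    unfolding orthogonal_matrix_orthonormal_columns
  proof (intro conjI allI impI)
    show "norm (column i Q) = 1" for i
      using h B(3) by (simp add: col bij_betw_apply)
    show "orthogonal (column i Q) (column j Q)" if "i \<noteq> j" for i j
      using h B(2) that unfolding col pairwise_def
      by (metis bij_betw_apply bij_betw_imp_inj_on inj_onD iso_tuple_UNIV_I)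
  qed
  have "\<forall>j. \<exists>\<mu>. A *v h j = \<mu> *\<^sub>R h j" using h B(4) by (simp add: bij_betw_apply)
  then obtain d where d: "\<And>j. A *v h j = d j *\<^sub>R h j" by metis
  have "A ** Q = Q ** diagm d"
  proof -
    have "(A ** Q) $ i $ j = (A *v h j) $ i" for i j
      by (simp add: matrix_matrix_mult_def matrix_vector_mult_def Q_def)
    moreover have "(Q ** diagm d) $ i $ j = d j * h j $ i" for i j
      by (simp add: matrix_matrix_mult_def Q_def diagm_def if_distrib cong: if_cong)
    ultimately show ?thesis by (simp add: vec_eq_iff d)
  qed
  then have "A ** Q ** transpose Q = Q ** diagm d ** transpose Q" by simp
  then have "A = Q ** diagm d ** transpose Q"
    using orth unfolding orthogonal_matrix_def by (simp flip: matrix_mul_assoc)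
  with orth that show thesis by blast
qed


section \<open>Positive definite matrices, congruences and frames\<close>

lemma pd_sym: "x \<in> pd_mats \<Longrightarrow> transpose x = x"
  by (simp add: pd_mats_def)

lemma pd_pos: "x \<in> pd_mats \<Longrightarrow> v \<noteq> 0 \<Longrightarrow> v \<bullet> (x *v v) > 0"
  by (simp add: pd_mats_def)

lemma pd_invertible: "x \<in> pd_mats \<Longrightarrow> invertible (x::real^'n^'n)"
  unfolding invertible_left_inverse matrix_left_invertible_ker
  by (metis inner_zero_right less_irrefl pd_pos)

lemma pd_add: "x \<in> pd_mats \<Longrightarrow> y \<in> pd_mats \<Longrightarrow> x + y \<in> pd_mats"
  by (simp add: pd_mats_def transpose_add matrix_vector_mult_add_rdistrib inner_add_right add_pos_pos)

lemma pd_scaleR: "x \<in> pd_mats \<Longrightarrow> c > 0 \<Longrightarrow> c *\<^sub>R x \<in> pd_mats"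
  by (simp add: pd_mats_def transpose_scalar flip: scaleR_matrix_vector_assoc)

lemma inner_congruence:
  fixes g x :: "real^'n^'n"
  shows "v \<bullet> ((g ** x ** transpose g) *v v) = (transpose g *v v) \<bullet> (x *v (transpose g *v v))"
proof -
  have "(g ** x ** transpose g) *v v = g *v (x *v (transpose g *v v))"
    by (simp only: matrix_vector_mul_assoc matrix_mul_assoc)
  then show ?thesis by (simp add: dot_lmul_matrix)
qed

lemma transpose_congruence:
  "transpose x = x \<Longrightarrow> transpose (g ** x ** transpose g) = g ** x ** transpose (g::real^'n^'n)"
  by (simp add: matrix_transpose_mul matrix_mul_assoc)

lemma pd_congruence:
  fixes g :: "real^'n^'n"
  assumes "invertible g" "x \<in> pd_mats"
  shows "g ** x ** transpose g \<in> pd_mats"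
proof -
  have "transpose g *v v \<noteq> 0" if "v \<noteq> 0" for v
    using transpose_invertible[OF assms(1)] that
    by (metis invertible_left_inverse matrix_left_invertible_ker)
  then show ?thesis
    using assms(2) by (simp add: pd_mats_def transpose_congruence inner_congruence del: transpose_matrix_vector)
qed

lemma pd_inv:
  fixes x :: "real^'n^'n"
  assumes "x \<in> pd_mats"
  shows "matrix_inv x \<in> pd_mats"
proof -
  have i: "invertible x" using assms by (rule pd_invertible)
  have t: "transpose (matrix_inv x) = matrix_inv x"
    using matrix_inv_transpose[OF i] pd_sym[OF assms] by simp
  have "matrix_inv x ** x ** transpose (matrix_inv x) \<in> pd_mats"
    using pd_congruence[OF invertible_matrix_inv[OF i] assms] .
  then show ?thesis by (simp add: t matrix_inv_both i)
qed

lemma one_pd: "mat 1 \<in> pd_mats"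
  using diagm_pd[of "\<lambda>_. 1"] by (simp add: diagm_one)

text \<open>A frame is an invertible matrix \<open>g\<close>; \<open>fr g m\<close> is the positive definite matrix with coordinates \<open>m\<close> in it. By simultaneous
  diagonalization any two positive definite matrices share a frame, so pointwise identities about pairs reduce to
  scalar identities between coordinates.\<close>

definition fr :: "real^'n^'n \<Rightarrow> ('n \<Rightarrow> real) \<Rightarrow> real^'n^'n" where
  "fr g m = g ** diagm m ** transpose g"

lemma fr_pd: "invertible g \<Longrightarrow> (\<And>i. m i > 0) \<Longrightarrow> fr g m \<in> pd_mats"
  unfolding fr_def by (intro pd_congruence diagm_pd)

lemma fr_add: "fr g m + fr g n = fr g (\<lambda>i. m i + n i)"
  by (simp add: fr_def matrix_add_ldistrib matrix_add_mult_distrib flip: diagm_add)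

lemma fr_scaleR: "c *\<^sub>R fr g m = fr g (\<lambda>i. c * m i)"
  by (simp add: fr_def matrix_scaleR_left matrix_scaleR_right flip: diagm_scaleR)

lemma fr_inv:
  assumes "invertible g" "\<And>i. m i \<noteq> 0"
  shows "matrix_inv (fr g m) = fr (transpose (matrix_inv g)) (\<lambda>i. 1 / m i)"
  unfolding fr_def using assms
  by (simp add: matrix_inv_mult invertible_mult diagm_inv transpose_invertible matrix_inv_transpose
      matrix_mul_assoc)

lemma invertible_orthogonal: "orthogonal_matrix Q \<Longrightarrow> invertible (Q::real^'n^'n)"
  unfolding orthogonal_matrix_def invertible_def by blast

lemma fr_orthogonal_one: "orthogonal_matrix Q \<Longrightarrow> fr Q (\<lambda>_. 1) = mat 1"
  by (simp add: fr_def diagm_one orthogonal_matrix_def)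

lemma det_fr: "det (fr g m) = (det g)\<^sup>2 * (\<Prod>i\<in>UNIV. m i)"
  by (simp add: fr_def det_mul det_diagm power2_eq_square)

lemma pd_spectral:
  fixes x :: "real^'n^'n"
  assumes "x \<in> pd_mats"
  obtains Q d where "orthogonal_matrix Q" "\<forall>i. d i > 0" "x = fr Q d"
proof -
  obtain Q d where Q: "orthogonal_matrix Q" and x: "x = Q ** diagm d ** transpose Q"
    using spectral_decomposition[OF pd_sym[OF assms]] by blast
  have QQ: "transpose Q ** Q = mat 1" using Q by (simp add: orthogonal_matrix_def)
  have "transpose Q ** x ** transpose (transpose Q) \<in> pd_mats"
    using Q assms by (intro pd_congruence invertible_orthogonal) auto
  moreover have "transpose Q ** x ** transpose (transpose Q) = (transpose Q ** Q) ** diagm d ** (transpose Q ** Q)"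
    by (simp add: x matrix_mul_assoc)
  ultimately have pd: "diagm d \<in> pd_mats" by (simp add: QQ)
  have "d i > 0" for i
  proof -
    have "axis i 1 \<bullet> (diagm d *v axis i 1) > 0" using pd_pos[OF pd] by (simp add: axis_eq_0_iff)
    then show ?thesis by (simp add: diagm_vec inner_axis axis_def inner_vec_def if_distrib cong: if_cong)
  qed
  then show thesis by (intro that[OF Q]) (auto simp: fr_def x)
qed

lemma det_pd_pos: "x \<in> pd_mats \<Longrightarrow> det (x::real^'n^'n) > 0"
proof (elim pd_spectral)
  fix Q d assume Q: "orthogonal_matrix Q" and d: "\<forall>i. d i > 0" and x: "x = fr Q d"
  have "det Q \<noteq> 0" using Q invertible_orthogonal invertible_det_nz by blast
  then show "det x > 0" by (simp add: x det_fr d prod_pos)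
qed

text \<open>Write x = s s^T. Congruence by s^-1 sends x to the identity and y to some z; an
  orthogonal P that diagonalizes z leaves the identity alone, so g = s P serves both
  matrices.\<close>

lemma simultaneous_diagonalization:
  fixes x y :: "real^'n^'n"
  assumes x: "x \<in> pd_mats" and y: "y \<in> pd_mats"
  obtains g m where "invertible g" "\<forall>i. m i > 0" "x = fr g (\<lambda>_. 1)" "y = fr g m"
proof -
  obtain Q d where Q: "orthogonal_matrix Q" and d: "\<And>i. d i > 0" and xQ: "x = fr Q d"
    using pd_spectral[OF x] by blast
  define s where "s = Q ** diagm (\<lambda>i. sqrt (d i))"
  have di: "invertible (diagm (\<lambda>i. sqrt (d i)))" using d by (intro diagm_inv) (metis less_irrefl real_sqrt_eq_zero_cancel_iff)
  have s: "invertible s" unfolding s_def using di invertible_orthogonal[OF Q] by (rule invertible_mult[rotated])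
  have "s ** transpose s = Q ** (diagm (\<lambda>i. sqrt (d i)) ** diagm (\<lambda>i. sqrt (d i))) ** transpose Q"
    by (simp add: s_def matrix_transpose_mul transpose_diagm matrix_mul_assoc)
  also have "diagm (\<lambda>i. sqrt (d i)) ** diagm (\<lambda>i. sqrt (d i)) = diagm d"
    using d by (simp add: diagm_mult less_imp_le)
  finally have ss: "s ** transpose s = x" by (simp add: xQ fr_def)
  define z where "z = matrix_inv s ** y ** transpose (matrix_inv s)"
  have z: "z \<in> pd_mats" unfolding z_def using s y by (intro pd_congruence invertible_matrix_inv)
  obtain P e where P: "orthogonal_matrix P" and e: "\<forall>i. e i > 0" and zP: "z = fr P e"
    using pd_spectral[OF z] by blast
  define g where "g = s ** P"
  have gi: "invertible g" unfolding g_def using s invertible_orthogonal[OF P] by (rule invertible_mult)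
  have "fr g (\<lambda>_. 1) = s ** (P ** transpose P) ** transpose s"
    by (simp add: fr_def g_def diagm_one matrix_transpose_mul matrix_mul_assoc)
  also have "\<dots> = x" using P by (simp add: orthogonal_matrix_def ss)
  finally have 1: "x = fr g (\<lambda>_. 1)" by simp
  have "fr g e = s ** fr P e ** transpose s"
    by (simp add: fr_def g_def matrix_transpose_mul matrix_mul_assoc)
  also have "\<dots> = (s ** matrix_inv s) ** y ** transpose (s ** matrix_inv s)"
    by (simp add: zP[symmetric] z_def matrix_transpose_mul matrix_mul_assoc)
  also have "\<dots> = y" by (simp add: matrix_inv_both s)
  finally have "y = fr g e" by simp
  with gi e 1 show thesis by (rule that)
qed

text \<open>By cyclicity of the trace, a trace form restricted to a frame is linear in the
  coordinates. This is how coefficients found in a frame are compared with matrices.\<close>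

lemma inner_tr_fr:
  fixes a g :: "real^'a^'a"
  shows "inner_tr a (fr g m) = (\<Sum>i\<in>UNIV. m i * (transpose g ** a ** g) $ i $ i)"
proof -
  have "inner_tr a (fr g m) = trace (a ** g ** diagm m ** transpose g)"
    by (simp add: inner_tr_def fr_def matrix_mul_assoc)
  also have "\<dots> = trace (transpose g ** (a ** g ** diagm m))" by (rule trace_mul_sym)
  also have "\<dots> = trace (transpose g ** a ** g ** diagm m)" by (simp add: matrix_mul_assoc)
  also have "\<dots> = (\<Sum>i\<in>UNIV. m i * (transpose g ** a ** g) $ i $ i)"
  proof -
    have "(c ** diagm m) $ i $ i = m i * c $ i $ i" for c :: "real^'a^'a" and i
      by (simp add: matrix_matrix_mult_def diagm_def if_distrib[of "(*) _"] cong: if_cong)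
    then show ?thesis by (simp add: trace_def)
  qed
  finally show ?thesis .
qed

text \<open>The frame diagonalizes x and y^-1, not x and y, so that x y = g diag(m / n) g^-1. All
  factors in \<open>phi\<close> are then functions of one diagonal matrix up to conjugation, and
  both components acquire the same multiplier k.\<close>

lemma phi_fr:
  fixes g :: "real^'n^'n"
  assumes g: "invertible g" and m: "\<And>i. m i > 0" and n: "\<And>i. n i > 0" and "\<alpha> \<ge> 0" "\<beta> \<ge> 0"
  defines "k \<equiv> \<lambda>i. (n i + \<alpha> * m i) / (n i + \<beta> * m i)"
  shows "phi \<alpha> \<beta> (fr g m) (matrix_inv (fr g n))
       = (matrix_inv (fr g (\<lambda>i. n i * k i)), fr g (\<lambda>i. m i * k i))"
proof -
  define gi where "gi = matrix_inv g"
  have G: "g ** gi = mat 1" "gi ** g = mat 1" using g by (simp_all add: gi_def matrix_inv_both)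
  then have Gt: "transpose gi ** transpose g = mat 1" "transpose g ** transpose gi = mat 1"
    by (metis matrix_transpose_mul transpose_mat)+
  have c1: "gi ** (g ** X) = X" "transpose g ** (transpose gi ** X) = X" for X :: "real^'n^'n"
    by (simp_all add: matrix_mul_assoc G Gt)
  have c2: "diagm a ** (diagm b ** X) = diagm (\<lambda>i. a i * b i) ** X" for a b and X :: "real^'n^'n"
    by (simp add: matrix_mul_assoc diagm_mult)
  have inv: "matrix_inv (fr g d) = transpose gi ** diagm (\<lambda>i. 1 / d i) ** gi" if "\<And>i. d i > 0" for d
    using fr_inv[OF g, of d] that by (simp add: fr_def gi_def less_imp_neq[symmetric])
  have lin: "mat 1 + c *\<^sub>R (a ** diagm d ** b) = a ** diagm (\<lambda>i. 1 + c * d i) ** b"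
    if "a ** b = mat 1" for a b :: "real^'n^'n" and c d
  proof -
    have "a ** diagm (\<lambda>i. 1 + c * d i) ** b = a ** (mat 1 + c *\<^sub>R diagm d) ** b"
      by (simp add: diagm_scaleR diagm_add flip: diagm_one)
    also have "\<dots> = mat 1 + c *\<^sub>R (a ** diagm d ** b)"
      by (simp add: matrix_add_ldistrib matrix_add_mult_distrib that matrix_scaleR_left matrix_scaleR_right)
    finally show ?thesis by simp
  qed
  have inv': "matrix_inv (a ** diagm d ** b) = a ** diagm (\<lambda>i. 1 / d i) ** b"
    if ab: "a ** b = mat 1" "b ** a = mat 1" and d: "\<And>i. d i > 0" for a b :: "real^'n^'n" and d
  proof (rule matrix_inv_eqI)
    have "b ** (a ** X) = X" for X :: "real^'n^'n" by (simp add: matrix_mul_assoc ab)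
    moreover have "diagm d ** (diagm (\<lambda>i. 1 / d i) ** b) = b"
      using d by (simp add: c2 less_imp_neq[symmetric] diagm_one)
    ultimately show "a ** diagm d ** b ** (a ** diagm (\<lambda>i. 1 / d i) ** b) = mat 1"
      by (simp add: ab flip: matrix_mul_assoc)
  qed
  define x where "x = fr g m"
  define y where "y = matrix_inv (fr g n)"
  have x: "x = g ** diagm m ** transpose g" by (simp add: x_def fr_def)
  have y: "y = transpose gi ** diagm (\<lambda>i. 1 / n i) ** gi" using n by (simp add: y_def inv)
  have xy: "x ** y = g ** diagm (\<lambda>i. m i / n i) ** gi"
    by (simp add: x y c1 c2 flip: matrix_mul_assoc)
  have yx: "y ** x = transpose gi ** diagm (\<lambda>i. m i / n i) ** transpose g"
    by (simp add: x y c1 c2 flip: matrix_mul_assoc)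
  have pos: "1 + c * (m i / n i) > 0" if "c \<ge> 0" for c i
  proof -
    have "c * (m i / n i) \<ge> 0" using that m[of i] n[of i] by (intro mult_nonneg_nonneg) auto
    then show ?thesis by linarith
  qed
  have e: "1 + c * (m i / n i) = (n i + c * m i) / n i" for c i
    using n[of i] by (simp add: field_simps)
  have k: "(1 + \<beta> * (m i / n i)) / (1 + \<alpha> * (m i / n i)) = 1 / k i" for i
    using n[of i] unfolding k_def e by simp
  have kpos: "k i > 0" for i
    unfolding k_def using m n \<open>\<alpha> \<ge> 0\<close> \<open>\<beta> \<ge> 0\<close> by (intro divide_pos_pos add_pos_nonneg mult_nonneg_nonneg) (auto simp: less_imp_le)
  have nk: "n i * k i > 0" for i using n kpos by simp
  have "y ** matrix_inv (mat 1 + \<alpha> *\<^sub>R (x ** y)) ** (mat 1 + \<beta> *\<^sub>R (x ** y))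
      = transpose gi ** diagm (\<lambda>i. 1 / n i * (1 / (1 + \<alpha> * (m i / n i)) * (1 + \<beta> * (m i / n i)))) ** gi"
    unfolding xy unfolding lin[OF G(1)] inv'[OF G pos[OF \<open>\<alpha> \<ge> 0\<close>]] unfolding y
    by (simp add: c1 c2 mult.assoc flip: matrix_mul_assoc)
  also have "(\<lambda>i. 1 / n i * (1 / (1 + \<alpha> * (m i / n i)) * (1 + \<beta> * (m i / n i)))) = (\<lambda>i. 1 / (n i * k i))"
    using k by (simp add: fun_eq_iff)
  finally have 1: "y ** matrix_inv (mat 1 + \<alpha> *\<^sub>R (x ** y)) ** (mat 1 + \<beta> *\<^sub>R (x ** y))
     = matrix_inv (fr g (\<lambda>i. n i * k i))"
    using inv[OF nk] by simp
  have k': "(1 + \<alpha> * (m i / n i)) / (1 + \<beta> * (m i / n i)) = k i" for i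
    using n[of i] unfolding k_def e by simp
  have "x ** matrix_inv (mat 1 + \<beta> *\<^sub>R (y ** x)) ** (mat 1 + \<alpha> *\<^sub>R (y ** x))
      = g ** diagm (\<lambda>i. m i * (1 / (1 + \<beta> * (m i / n i)) * (1 + \<alpha> * (m i / n i)))) ** transpose g"
    unfolding yx unfolding lin[OF Gt(1)] inv'[OF Gt pos[OF \<open>\<beta> \<ge> 0\<close>]] unfolding x
    by (simp add: c1 c2 mult.assoc flip: matrix_mul_assoc)
  also have "\<dots> = fr g (\<lambda>i. m i * k i)" using k' by (simp add: fr_def)
  finally show ?thesis unfolding phi_def x_def[symmetric] y_def[symmetric] using 1 by simp
qed

section \<open>The scalar functional equation\<close>

text \<open>The values at 1, ..., 5 already determine a polynomial of degree four.\<close>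

lemma quartic_coeffs_zero:
  fixes c0 :: real
  assumes "\<And>m. m > 0 \<Longrightarrow> c0 + c1 * m + c2 * m^2 + c3 * m^3 + c4 * m^4 = 0"
  shows "c0 = 0 \<and> c1 = 0 \<and> c2 = 0 \<and> c3 = 0 \<and> c4 = 0"
proof -
  have "c0 + c1 + c2 + c3 + c4 = 0" using assms[of 1] by simp
  moreover have "c0 + c1 * 2 + c2 * 4 + c3 * 8 + c4 * 16 = 0" using assms[of 2] by simp
  moreover have "c0 + c1 * 3 + c2 * 9 + c3 * 27 + c4 * 81 = 0" using assms[of 3] by simp
  moreover have "c0 + c1 * 4 + c2 * 16 + c3 * 64 + c4 * 256 = 0" using assms[of 4] by simp
  moreover have "c0 + c1 * 5 + c2 * 25 + c3 * 125 + c4 * 625 = 0" using assms[of 5] by simp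
  ultimately show ?thesis by linarith
qed

text \<open>The variables \<open>P\<close> and \<open>Q\<close> are the arguments of \<open>D\<close> and \<open>C\<close>; the map from \<open>(m, n)\<close> to \<open>(P, Q)\<close> preserves the ratio
  \<open>n / m\<close>, which makes it explicitly invertible.\<close>

lemma scalar_functional_equation_C_deriv:
  fixes A B C D A1 B1 :: "real \<Rightarrow> real" and \<alpha> \<beta> P Q :: real
  assumes ab: "\<alpha> > 0" "\<beta> \<ge> 0"
    and A1: "\<And>m. m > 0 \<Longrightarrow> (A has_real_derivative A1 m) (at m)"
    and B1: "\<And>n. n > 0 \<Longrightarrow> (B has_real_derivative B1 n) (at n)"
    and eq: "\<And>m n. m > 0 \<Longrightarrow> n > 0 \<Longrightarrow>
      A m + B n = C (n * ((n + \<alpha> * m) / (n + \<beta> * m))) + D (m * ((n + \<alpha> * m) / (n + \<beta> * m)))"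
    and PQ: "P > 0" "Q > 0"
  shows "(C has_real_derivative
      A1 (P * (Q + \<beta> * P) / (Q + \<alpha> * P)) * ((\<alpha> - \<beta>) * P^2 / (Q + \<alpha> * P)^2)
    + B1 (Q * (Q + \<beta> * P) / (Q + \<alpha> * P)) * ((Q^2 + 2 * \<alpha> * P * Q + \<alpha> * \<beta> * P^2) / (Q + \<alpha> * P)^2)) (at Q)"
proof -
  let ?m = "\<lambda>Q. P * (Q + \<beta> * P) / (Q + \<alpha> * P)" and ?n = "\<lambda>Q. Q * (Q + \<beta> * P) / (Q + \<alpha> * P)"
  have V: "q + \<alpha> * P > 0" "q + \<beta> * P > 0" if "q > 0" for q
    using that ab PQ by (simp_all add: add_pos_nonneg)
  have mn: "?m q > 0" "?n q > 0" if "q > 0" for q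
    using that V[OF that] PQ by simp_all
  have eq': "C q = A (?m q) + B (?n q) - D P" if q: "q > 0" for q
  proof -
    \<comment> \<open>The factor in front of q + c P does not depend on c, so it cancels in the
      quotient of the cases c = \<alpha> and c = \<beta>.\<close>
    have "?n q + c * ?m q = (q + \<beta> * P) / (q + \<alpha> * P) * (q + c * P)" for c
      by (simp add: algebra_simps add_divide_distrib)
    note w = this
    have k: "(?n q + \<alpha> * ?m q) / (?n q + \<beta> * ?m q) = (q + \<alpha> * P) / (q + \<beta> * P)"
      unfolding w using V[OF q] by simp
    have "A (?m q) + B (?n q) = C (?n q * ((q + \<alpha> * P) / (q + \<beta> * P))) + D (?m q * ((q + \<alpha> * P) / (q + \<beta> * P)))"
      using eq[OF mn[OF q]] unfolding k .
    then show ?thesis using V[OF q] by simp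
  qed
  have dm: "(?m has_real_derivative ((\<alpha> - \<beta>) * P^2 / (Q + \<alpha> * P)^2)) (at Q)"
    using V[OF PQ(2)]
    by (auto intro!: derivative_eq_intros simp: field_simps power2_eq_square)
  have dn: "(?n has_real_derivative ((Q^2 + 2 * \<alpha> * P * Q + \<alpha> * \<beta> * P^2) / (Q + \<alpha> * P)^2)) (at Q)"
    using V[OF PQ(2)]
    by (auto intro!: derivative_eq_intros simp: field_simps power2_eq_square)
  have "((\<lambda>q. A (?m q) + B (?n q) - D P) has_real_derivative
      A1 (?m Q) * ((\<alpha> - \<beta>) * P^2 / (Q + \<alpha> * P)^2)
      + B1 (?n Q) * ((Q^2 + 2 * \<alpha> * P * Q + \<alpha> * \<beta> * P^2) / (Q + \<alpha> * P)^2) - 0) (at Q)"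
    by (intro derivative_intros DERIV_chain2[OF A1 dm] DERIV_chain2[OF B1 dn] mn PQ)
  then show ?thesis
    unfolding diff_0_right
    by (rule has_field_derivative_transform_within_open[where S = "{0<..}"]) (use eq' PQ in auto)
qed

text \<open>This is the vanishing of the mixed derivative of \<open>A + B\<close> in the variables \<open>P\<close> and \<open>Q\<close>.\<close>

lemma scalar_functional_equation_pde:
  fixes A B C D A1 B1 A2 B2 :: "real \<Rightarrow> real" and \<alpha> \<beta> m n :: real
  assumes ab: "\<alpha> > 0" "\<beta> \<ge> 0" "\<alpha> \<noteq> \<beta>"
    and A1: "\<And>m. m > 0 \<Longrightarrow> (A has_real_derivative A1 m) (at m)"
    and A2: "\<And>m. m > 0 \<Longrightarrow> (A1 has_real_derivative A2 m) (at m)"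
    and B1: "\<And>n. n > 0 \<Longrightarrow> (B has_real_derivative B1 n) (at n)"
    and B2: "\<And>n. n > 0 \<Longrightarrow> (B1 has_real_derivative B2 n) (at n)"
    and eq: "\<And>m n. m > 0 \<Longrightarrow> n > 0 \<Longrightarrow>
      A m + B n = C (n * ((n + \<alpha> * m) / (n + \<beta> * m))) + D (m * ((n + \<alpha> * m) / (n + \<beta> * m)))"
    and mn: "m > 0" "n > 0"
  shows "A2 m * m^2 * (n^2 + 2 * \<beta> * m * n + \<alpha> * \<beta> * m^2) + 2 * m * n * (n + \<beta> * m) * A1 m
       = B2 n * n^2 * (n^2 + 2 * \<alpha> * m * n + \<alpha> * \<beta> * m^2) + 2 * \<alpha> * m * n * (n + \<beta> * m) * B1 n"
proof -
  define k where "k = (n + \<alpha> * m) / (n + \<beta> * m)"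
  define P where "P = m * k"
  define Q where "Q = n * k"
  have ST: "n + \<alpha> * m > 0" "n + \<beta> * m > 0" using mn ab by (simp_all add: add_pos_nonneg)
  then have k: "k > 0" by (simp add: k_def)
  then have PQ: "P > 0" "Q > 0" using mn by (simp_all add: P_def Q_def)
  have V: "Q + \<alpha> * p > 0" "Q + \<beta> * p > 0" if "p > 0" for p
    using that ab PQ by (simp_all add: add_pos_nonneg)
  let ?m = "\<lambda>p. p * (Q + \<beta> * p) / (Q + \<alpha> * p)" and ?n = "\<lambda>p. Q * (Q + \<beta> * p) / (Q + \<alpha> * p)"
  let ?mq = "\<lambda>p. (\<alpha> - \<beta>) * p^2 / (Q + \<alpha> * p)^2"
  let ?nq = "\<lambda>p. (Q^2 + 2 * \<alpha> * p * Q + \<alpha> * \<beta> * p^2) / (Q + \<alpha> * p)^2"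
  have mnpos: "?m p > 0" "?n p > 0" if "p > 0" for p
    using that V[OF that] PQ by simp_all
  define E where "E = (\<lambda>p. A1 (?m p) * ?mq p + B1 (?n p) * ?nq p)"
  \<comment> \<open>C does not see P, so the formula for its derivative at Q has one value for all P
    > 0. Differentiating this in P needs no second derivative of C.\<close>
  have const: "E p = E P" if "p > 0" for p
    using scalar_functional_equation_C_deriv[OF ab(1,2) A1 B1 eq that PQ(2)]
      scalar_functional_equation_C_deriv[OF ab(1,2) A1 B1 eq PQ(1) PQ(2)]
    unfolding E_def by (rule DERIV_unique) auto
  have mp: "(?m has_real_derivative ((Q^2 + 2 * \<beta> * P * Q + \<alpha> * \<beta> * P^2) / (Q + \<alpha> * P)^2)) (at P)"
    using V[OF PQ(1)]
    by (auto intro!: derivative_eq_intros simp: field_simps power2_eq_square)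
  have np: "(?n has_real_derivative (- (\<alpha> - \<beta>) * Q^2 / (Q + \<alpha> * P)^2)) (at P)"
    using V[OF PQ(1)]
    by (auto intro!: derivative_eq_intros simp: field_simps power2_eq_square)
  define W where "W = Q + \<alpha> * P"
  have W: "W > 0" using V[OF PQ(1)] by (simp add: W_def)
  have W4: "W * c / (W^2 * W^2) = c / W^3" for c
    using W by (simp add: power2_eq_square power3_eq_cube)
  have mqp: "(?mq has_real_derivative (2 * (\<alpha> - \<beta>) * P * Q / W^3)) (at P)"
  proof -
    have "(?mq has_real_derivative
      (((\<alpha> - \<beta>) * (2 * P)) * W^2 - (\<alpha> - \<beta>) * P^2 * (2 * W * \<alpha>)) / (W^2 * W^2)) (at P)"
      using W unfolding W_def by (auto intro!: derivative_eq_intros)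
    moreover have "(((\<alpha> - \<beta>) * (2 * P)) * W^2 - (\<alpha> - \<beta>) * P^2 * (2 * W * \<alpha>))
       = W * (2 * (\<alpha> - \<beta>) * P * Q)"
      by (simp add: W_def algebra_simps power2_eq_square)
    ultimately show ?thesis by (simp only: W4)
  qed
  have nqp: "(?nq has_real_derivative (- 2 * \<alpha> * (\<alpha> - \<beta>) * P * Q / W^3)) (at P)"
  proof -
    have "(?nq has_real_derivative
      ((2 * \<alpha> * Q + \<alpha> * \<beta> * (2 * P)) * W^2 - (Q^2 + 2 * \<alpha> * P * Q + \<alpha> * \<beta> * P^2) * (2 * W * \<alpha>)) / (W^2 * W^2)) (at P)"
      using W unfolding W_def by (auto intro!: derivative_eq_intros simp: algebra_simps)
    moreover have "((2 * \<alpha> * Q + \<alpha> * \<beta> * (2 * P)) * W^2 - (Q^2 + 2 * \<alpha> * P * Q + \<alpha> * \<beta> * P^2) * (2 * W * \<alpha>))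
       = W * (- 2 * \<alpha> * (\<alpha> - \<beta>) * P * Q)"
      by (simp add: W_def algebra_simps power2_eq_square)
    ultimately show ?thesis by (simp only: W4)
  qed
  have "(E has_real_derivative
      (A2 (?m P) * ((Q^2 + 2 * \<beta> * P * Q + \<alpha> * \<beta> * P^2) / (Q + \<alpha> * P)^2)) * ?mq P
        + (2 * (\<alpha> - \<beta>) * P * Q / W^3) * A1 (?m P)
      + ((B2 (?n P) * (- (\<alpha> - \<beta>) * Q^2 / (Q + \<alpha> * P)^2)) * ?nq P
        + (- 2 * \<alpha> * (\<alpha> - \<beta>) * P * Q / W^3) * B1 (?n P))) (at P)"
    unfolding E_def
    by (intro DERIV_add DERIV_mult DERIV_chain2[OF A2 mp] DERIV_chain2[OF B2 np] mqp nqp mnpos PQ)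
  moreover have "(E has_real_derivative 0) (at P)"
    by (rule has_field_derivative_transform_within_open[OF DERIV_const[of "E P"], where S = "{0<..}"])
       (use PQ in \<open>auto intro!: const[symmetric]\<close>)
  ultimately have "0 = (A2 (?m P) * ((Q^2 + 2 * \<beta> * P * Q + \<alpha> * \<beta> * P^2) / (Q + \<alpha> * P)^2)) * ?mq P
        + (2 * (\<alpha> - \<beta>) * P * Q / W^3) * A1 (?m P)
      + ((B2 (?n P) * (- (\<alpha> - \<beta>) * Q^2 / (Q + \<alpha> * P)^2)) * ?nq P
        + (- 2 * \<alpha> * (\<alpha> - \<beta>) * P * Q / W^3) * B1 (?n P))"
    using DERIV_unique by blast
  moreover have "?m P = m"
  proof -
    have "?m P = m * k * ((n + \<beta> * m) * k) / ((n + \<alpha> * m) * k)"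
      by (simp add: P_def Q_def algebra_simps)
    also have "\<dots> = m" using ST k by (simp add: k_def)
    finally show ?thesis .
  qed
  moreover have "?n P = n"
  proof -
    have "?n P = n * k * ((n + \<beta> * m) * k) / ((n + \<alpha> * m) * k)"
      by (simp add: P_def Q_def algebra_simps)
    also have "\<dots> = n" using ST k by (simp add: k_def)
    finally show ?thesis .
  qed
  ultimately have "0 = (A2 m * ((Q^2 + 2 * \<beta> * P * Q + \<alpha> * \<beta> * P^2) / W^2)) * ((\<alpha> - \<beta>) * P^2 / W^2)
        + (2 * (\<alpha> - \<beta>) * P * Q / W^3) * A1 m
      + ((B2 n * (- (\<alpha> - \<beta>) * Q^2 / W^2)) * ((Q^2 + 2 * \<alpha> * P * Q + \<alpha> * \<beta> * P^2) / W^2)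
        + (- 2 * \<alpha> * (\<alpha> - \<beta>) * P * Q / W^3) * B1 n)"
    by (simp add: W_def)
  also have "\<dots> = (\<alpha> - \<beta>) * (A2 m * P^2 * (Q^2 + 2 * \<beta> * P * Q + \<alpha> * \<beta> * P^2)
        + 2 * P * Q * W * A1 m
        - B2 n * Q^2 * (Q^2 + 2 * \<alpha> * P * Q + \<alpha> * \<beta> * P^2) - 2 * \<alpha> * P * Q * W * B1 n) / W^4"
    using W by (simp add: field_simps power2_eq_square power3_eq_cube power4_eq_xxxx)
  finally have "0 = A2 m * P^2 * (Q^2 + 2 * \<beta> * P * Q + \<alpha> * \<beta> * P^2)
        + 2 * P * Q * W * A1 m
        - B2 n * Q^2 * (Q^2 + 2 * \<alpha> * P * Q + \<alpha> * \<beta> * P^2) - 2 * \<alpha> * P * Q * W * B1 n"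
    using W ab(3) by simp
  \<comment> \<open>Since n + \<alpha> m = k (n + \<beta> m), W carries a factor k^2, and every term
    becomes homogeneous of degree four in k.\<close>
  also have "W = k * k * (n + \<beta> * m)" using ST by (simp add: W_def P_def Q_def k_def field_simps)
  finally have "0 = k^4 * (A2 m * m^2 * (n^2 + 2 * \<beta> * m * n + \<alpha> * \<beta> * m^2) + 2 * m * n * (n + \<beta> * m) * A1 m
       - B2 n * n^2 * (n^2 + 2 * \<alpha> * m * n + \<alpha> * \<beta> * m^2) - 2 * \<alpha> * m * n * (n + \<beta> * m) * B1 n)"
    by (simp add: P_def Q_def algebra_simps power2_eq_square power4_eq_xxxx)
  then show ?thesis using k by simp
qed

text \<open>In the differential equation, one side is a quadratic polynomial in \<open>n\<close> for fixed \<open>m\<close> and the other side is one in \<open>m\<close> for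
  fixed \<open>n\<close>; hence \<open>m\<^sup>2 A1 m\<close> has a quadratic derivative, and comparing coefficients of powers of \<open>m\<close> determines everything.\<close>

theorem scalar_functional_equation:
  fixes A B C D A1 B1 A2 B2 :: "real \<Rightarrow> real" and \<alpha> \<beta> :: real
  assumes ab: "\<alpha> > 0" "\<beta> \<ge> 0" "\<alpha> \<noteq> \<beta>"
    and A1: "\<And>m. m > 0 \<Longrightarrow> (A has_real_derivative A1 m) (at m)"
    and A2: "\<And>m. m > 0 \<Longrightarrow> (A1 has_real_derivative A2 m) (at m)"
    and B1: "\<And>n. n > 0 \<Longrightarrow> (B has_real_derivative B1 n) (at n)"
    and B2: "\<And>n. n > 0 \<Longrightarrow> (B1 has_real_derivative B2 n) (at n)"
    and eq: "\<And>m n. m > 0 \<Longrightarrow> n > 0 \<Longrightarrow>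
      A m + B n = C (n * ((n + \<alpha> * m) / (n + \<beta> * m))) + D (m * ((n + \<alpha> * m) / (n + \<beta> * m)))"
  obtains \<kappa> a b where
    "\<And>m. m > 0 \<Longrightarrow> A1 m = \<kappa> / m - \<alpha> * a + b / m^2"
    "\<And>n. n > 0 \<Longrightarrow> B1 n = - \<kappa> / n - a + \<beta> * b / n^2"
    "\<And>q. q > 0 \<Longrightarrow> (C has_real_derivative (- \<kappa> / q - a + \<alpha> * b / q^2)) (at q)"
proof -
  define F where "F = (\<lambda>m. m^2 * A2 m + 2 * m * A1 m)"
  define H0 where "H0 = (\<lambda>n. n^4 * B2 n)"
  define H1 where "H1 = (\<lambda>n. 2 * \<alpha> * n^3 * B2 n + 2 * \<alpha> * n^2 * B1 n)"
  define H2 where "H2 = (\<lambda>n. \<alpha> * \<beta> * n^2 * B2 n + 2 * \<alpha> * \<beta> * n * B1 n)"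
  have pde: "n^2 * F m + n * (2 * \<beta> * m^2 * (m * A2 m + A1 m)) + \<alpha> * \<beta> * m^4 * A2 m = H0 n + m * H1 n + m^2 * H2 n"
    if "m > 0" "n > 0" for m n
    using scalar_functional_equation_pde[OF ab A1 A2 B1 B2 eq that]
    unfolding F_def H0_def H1_def H2_def
    by (simp add: algebra_simps power2_eq_square power3_eq_cube power4_eq_xxxx)
  \<comment> \<open>Half the second difference over n = 1, 2, 3 extracts the coefficient of n^2 in
    \<open>pde\<close>, which is \<open>F m\<close>. Applied to the other side it gives the
    coefficients of a quadratic in m.\<close>
  define e0 where "e0 = (H0 1 - 2 * H0 2 + H0 3) / 2"
  define e1 where "e1 = (H1 1 - 2 * H1 2 + H1 3) / 2"
  define e2 where "e2 = (H2 1 - 2 * H2 2 + H2 3) / 2"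
  have F: "F m = e0 + e1 * m + e2 * m^2" if "m > 0" for m
    using pde[OF that, of 1] pde[OF that, of 2] pde[OF that, of 3]
    unfolding e0_def e1_def e2_def by (simp add: field_simps)
  \<comment> \<open>\<open>F\<close> is the derivative of m^2 A1 m; integrating the quadratic leaves
    one constant, read off here at m = 1.\<close>
  define d where "d = A1 1 - e0 - e1 / 2 - e2 / 3"
  have m2A1: "m^2 * A1 m - e0 * m - e1 * m^2 / 2 - e2 * m^3 / 3 = d" if "m > 0" for m
  proof -
    let ?h = "\<lambda>m. m^2 * A1 m - (e0 * m + e1 * m^2 / 2 + e2 * m^3 / 3)"
    have "(?h has_real_derivative 0) (at x within {0<..})" if "x \<in> {0<..}" for x
    proof -
      have x: "x > 0" using that by simp
      have p: "((\<lambda>m. m^2) has_real_derivative 2 * x) (at x)"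
        by (auto intro!: derivative_eq_intros)
      have q: "((\<lambda>m. e0 * m + e1 * m^2 / 2 + e2 * m^3 / 3) has_real_derivative (e0 + e1 * x + e2 * x^2)) (at x)"
        by (auto intro!: derivative_eq_intros)
      have "2 * x * A1 x + A2 x * x^2 - (e0 + e1 * x + e2 * x^2) = 0"
        using F[OF x] by (simp add: F_def algebra_simps)
      with DERIV_diff[OF DERIV_mult[OF p A2[OF x]] q] show ?thesis
        by (simp add: has_field_derivative_at_within)
    qed
    then have "\<exists>c. \<forall>x\<in>{0<..}. ?h x = c"
      by (intro has_field_derivative_zero_constant convex_real_interval(3)) auto
    then obtain c where c: "\<And>x. x > 0 \<Longrightarrow> ?h x = c" by auto
    from c[of m] c[of 1] that show ?thesis by (simp add: d_def)
  qed
  have A1': "A1 m = e0 / m + e1 / 2 + e2 * m / 3 + d / m^2" if "m > 0" for m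
    using m2A1[OF that] that by (simp add: field_simps power2_eq_square power3_eq_cube)
  have m4A2: "m^4 * A2 m = - e0 * m^2 + e2 * m^4 / 3 - 2 * d * m" if "m > 0" for m
  proof -
    have "m^4 * A2 m = m^2 * F m - 2 * m * (m^2 * A1 m)"
      by (simp add: F_def algebra_simps power2_eq_square power4_eq_xxxx)
    also have "m^2 * A1 m = d + e0 * m + e1 * m^2 / 2 + e2 * m^3 / 3" using m2A1[OF that] by simp
    finally show ?thesis
      using F[OF that] by (simp add: algebra_simps power2_eq_square power3_eq_cube power4_eq_xxxx)
  qed
  have mid: "m^2 * (m * A2 m + A1 m) = e1 * m^2 / 2 + 2 * e2 * m^3 / 3 - d" if "m > 0" for m
  proof -
    have "m^2 * (m * A2 m + A1 m) = m * F m - m^2 * A1 m"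
      by (simp add: F_def algebra_simps power2_eq_square)
    then show ?thesis
      using F[OF that] m2A1[OF that] by (simp add: algebra_simps power2_eq_square power3_eq_cube)
  qed
  have coeffs: "n^2 * e0 - 2 * \<beta> * n * d - H0 n = 0 \<and> n^2 * e1 - 2 * \<alpha> * \<beta> * d - H1 n = 0
     \<and> n^2 * e2 + n * \<beta> * e1 - \<alpha> * \<beta> * e0 - H2 n = 0 \<and> 4/3 * n * \<beta> * e2 = 0 \<and> \<alpha> * \<beta> * e2 / 3 = 0"
    if n: "n > 0" for n
  proof (rule quartic_coeffs_zero)
    fix m :: real assume m: "m > 0"
    have "n^2 * (e0 + e1 * m + e2 * m^2) + n * (2 * \<beta> * (e1 * m^2 / 2 + 2 * e2 * m^3 / 3 - d))
       + \<alpha> * \<beta> * (- e0 * m^2 + e2 * m^4 / 3 - 2 * d * m) = H0 n + m * H1 n + m^2 * H2 n"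
      using pde[OF m n] unfolding F[OF m] m4A2[OF m, symmetric] mid[OF m, symmetric] by (simp add: mult.assoc)
    then show "n^2 * e0 - 2 * \<beta> * n * d - H0 n + (n^2 * e1 - 2 * \<alpha> * \<beta> * d - H1 n) * m
     + (n^2 * e2 + n * \<beta> * e1 - \<alpha> * \<beta> * e0 - H2 n) * m^2 + 4/3 * n * \<beta> * e2 * m^3 + \<alpha> * \<beta> * e2 / 3 * m^4 = 0"
      by (simp add: algebra_simps)
  qed
  \<comment> \<open>For \<beta> = 0 the coefficients of m^3 and m^4 say nothing, but then
    \<open>H2\<close> is identically zero and the coefficient of m^2 reduces to n^2 e2.\<close>
  have "e2 = 0"
  proof (cases "\<beta> = 0")
    case True then show ?thesis using coeffs[of 1] by (simp add: H2_def)
  next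
    case False then show ?thesis using coeffs[of 1] by simp
  qed
  have B1': "B1 n = - e0 / n + e1 / (2 * \<alpha>) + \<beta> * d / n^2" if n: "n > 0" for n
  proof -
    have "n^2 * e0 - 2 * \<beta> * n * d = n^4 * B2 n" using coeffs[OF n] by (simp add: H0_def)
    moreover have "n^2 * e1 - 2 * \<alpha> * \<beta> * d = 2 * \<alpha> * n^3 * B2 n + 2 * \<alpha> * n^2 * B1 n"
      using coeffs[OF n] by (simp add: H1_def)
    \<comment> \<open>Eliminates \<open>B2\<close> between the coefficients of m^0 and m^1.\<close>
    ultimately have "n * (n^2 * e1 - 2 * \<alpha> * \<beta> * d) = 2 * \<alpha> * (n^2 * e0 - 2 * \<beta> * n * d) + 2 * \<alpha> * n^3 * B1 n"
      by (simp add: algebra_simps power2_eq_square power3_eq_cube power4_eq_xxxx)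
    then have "n * (n^2 * e1 + 2 * \<alpha> * \<beta> * d - 2 * \<alpha> * n * e0 - 2 * \<alpha> * n^2 * B1 n) = 0"
      by (simp add: algebra_simps power2_eq_square power3_eq_cube)
    then have "n^2 * e1 + 2 * \<alpha> * \<beta> * d - 2 * \<alpha> * n * e0 - 2 * \<alpha> * n^2 * B1 n = 0"
      using n by simp
    then show ?thesis using n ab(1) by (simp add: field_simps power2_eq_square)
  qed
  define a where "a = - e1 / (2 * \<alpha>)"
  have AA: "A1 m = e0 / m - \<alpha> * a + d / m^2" if "m > 0" for m
    using A1'[OF that] \<open>e2 = 0\<close> ab(1) by (simp add: a_def)
  have BB: "B1 n = - e0 / n - a + \<beta> * d / n^2" if "n > 0" for n
    using B1'[OF that] by (simp add: a_def)
  show thesis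
  proof (rule that[OF AA BB])
    fix q :: real assume q: "q > 0"
    \<comment> \<open>The derivative of C at q may be computed with any P. Taking P = q gives m = n
      = q r.\<close>
    define r where "r = (1 + \<beta>) / (1 + \<alpha>)"
    have r: "r > 0" using ab by (simp add: r_def)
    have f: "q + \<alpha> * q = q * (1 + \<alpha>)" "q + \<beta> * q = q * (1 + \<beta>)" by (simp_all add: algebra_simps)
    have mr: "q * (q + \<beta> * q) / (q + \<alpha> * q) = q * r"
      using q by (simp add: r_def f)
    have d1: "(\<alpha> - \<beta>) * q^2 / (q + \<alpha> * q)^2 = (\<alpha> - \<beta>) / (1 + \<alpha>)^2"
      using q unfolding f by (simp add: power_mult_distrib)
    have "q^2 + 2 * \<alpha> * q * q + \<alpha> * \<beta> * q^2 = q^2 * (1 + 2 * \<alpha> + \<alpha> * \<beta>)"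
      by (simp add: algebra_simps power2_eq_square)
    then have d2: "(q^2 + 2 * \<alpha> * q * q + \<alpha> * \<beta> * q^2) / (q + \<alpha> * q)^2 = (1 + 2 * \<alpha> + \<alpha> * \<beta>) / (1 + \<alpha>)^2"
      using q unfolding f by (simp add: power_mult_distrib)
    have "(C has_real_derivative A1 (q * r) * ((\<alpha> - \<beta>) / (1 + \<alpha>)^2)
        + B1 (q * r) * ((1 + 2 * \<alpha> + \<alpha> * \<beta>) / (1 + \<alpha>)^2)) (at q)"
      using scalar_functional_equation_C_deriv[OF ab(1,2) A1 B1 eq q q] unfolding mr d1 d2 .
    moreover have "A1 (q * r) * ((\<alpha> - \<beta>) / (1 + \<alpha>)^2) + B1 (q * r) * ((1 + 2 * \<alpha> + \<alpha> * \<beta>) / (1 + \<alpha>)^2)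
       = - e0 / q - a + \<alpha> * d / q^2"
    proof -
      \<comment> \<open>X and Y are the derivatives of m and n in Q at P = Q = q. The three
        identities below treat in turn the terms with e0, a and d.\<close>
      define X where "X = (\<alpha> - \<beta>) / (1 + \<alpha>)^2"
      define Y where "Y = (1 + 2 * \<alpha> + \<alpha> * \<beta>) / (1 + \<alpha>)^2"
      have np: "1 + \<alpha> > 0" "1 + \<beta> > 0" using ab by auto
      have XY1: "X - Y = - r"
      proof -
        have "X - Y = (\<alpha> - \<beta> - (1 + 2 * \<alpha> + \<alpha> * \<beta>)) / (1 + \<alpha>)^2" unfolding X_def Y_def by (rule diff_divide_distrib[symmetric])
        also have "\<alpha> - \<beta> - (1 + 2 * \<alpha> + \<alpha> * \<beta>) = - ((1 + \<alpha>) * (1 + \<beta>))" by (simp add: algebra_simps)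
        finally show ?thesis using np by (simp add: r_def power2_eq_square)
      qed
      have XY2: "\<alpha> * X + Y = 1"
      proof -
        have "\<alpha> * X + Y = (\<alpha> * (\<alpha> - \<beta>) + (1 + 2 * \<alpha> + \<alpha> * \<beta>)) / (1 + \<alpha>)^2"
          unfolding X_def Y_def times_divide_eq_right by (rule add_divide_distrib[symmetric])
        also have "\<alpha> * (\<alpha> - \<beta>) + (1 + 2 * \<alpha> + \<alpha> * \<beta>) = (1 + \<alpha>)^2" by (simp add: algebra_simps power2_eq_square)
        finally show ?thesis using np by simp
      qed
      have XY3: "X + \<beta> * Y = \<alpha> * r^2"
      proof -
        have "X + \<beta> * Y = (\<alpha> - \<beta> + \<beta> * (1 + 2 * \<alpha> + \<alpha> * \<beta>)) / (1 + \<alpha>)^2"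
          unfolding X_def Y_def times_divide_eq_right by (rule add_divide_distrib[symmetric])
        also have "\<alpha> - \<beta> + \<beta> * (1 + 2 * \<alpha> + \<alpha> * \<beta>) = \<alpha> * (1 + \<beta>)^2" by (simp add: algebra_simps power2_eq_square)
        finally show ?thesis by (simp add: r_def power_divide)
      qed
      have qr: "q * r > 0" using q r by simp
      have "A1 (q * r) * X + B1 (q * r) * Y = e0 / (q * r) * (X - Y) - a * (\<alpha> * X + Y) + d / (q * r)^2 * (X + \<beta> * Y)"
        unfolding AA[OF qr] BB[OF qr] by (simp add: algebra_simps add_divide_distrib diff_divide_distrib)
      also have "\<dots> = - e0 / q - a + \<alpha> * d / q^2"
        unfolding XY1 XY2 XY3 using q r by (simp add: power_mult_distrib)
      finally show ?thesis by (simp add: X_def Y_def)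
    qed
    ultimately show "(C has_real_derivative (- e0 / q - a + \<alpha> * d / q^2)) (at q)" by simp
  qed
qed

section \<open>Frames\<close>

text \<open>Only restrictions to lines enter the scalar equation, so regularity is recorded along
  lines of symmetric matrices. \<open>f1\<close> and \<open>f2\<close> are fixed once per line
  because the scalar theorem asks for derivative functions.\<close>

definition twice_along :: "(real^'n^'n \<Rightarrow> real) \<Rightarrow> bool" where
  "twice_along f \<longleftrightarrow> (\<forall>x h. transpose x = x \<longrightarrow> transpose h = h \<longrightarrow> (\<exists>f1 f2. \<forall>t. x + t *\<^sub>R h \<in> pd_mats \<longrightarrow>
     ((\<lambda>s. f (x + s *\<^sub>R h)) has_real_derivative f1 t) (at t) \<and> (f1 has_real_derivative f2 t) (at t)))"

text \<open>The i-th value of m is overwritten, so this concerns the whole line through m in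
  direction i. The derivative is that of \<kappa> ln t + p t - q / t.\<close>

definition line_form :: "(('n \<Rightarrow> real) \<Rightarrow> real) \<Rightarrow> real \<Rightarrow> real \<Rightarrow> real \<Rightarrow> 'n \<Rightarrow> ('n \<Rightarrow> real) \<Rightarrow> bool" where
  "line_form F \<kappa> p q i m \<longleftrightarrow>
     (\<forall>t>0. ((\<lambda>s. F (m(i := s))) has_real_derivative (\<kappa> / t + p + q / t^2)) (at t))"

lemma line_form_unique:
  assumes "line_form F \<kappa> p q i m" "line_form F \<kappa>' p' q' i m"
  shows "\<kappa> = \<kappa>'" "p = p'" "q = q'"
proof -
  have e: "\<kappa> / t + p + q / t^2 = \<kappa>' / t + p' + q' / t^2" if "t > 0" for t
    using assms that unfolding line_form_def by (meson DERIV_unique)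
  have "\<kappa> + p + q = \<kappa>' + p' + q'" using e[of 1] by simp
  moreover have "\<kappa> / 2 + p + q / 4 = \<kappa>' / 2 + p' + q' / 4" using e[of 2] by simp
  moreover have "\<kappa> / 4 + p + q / 16 = \<kappa>' / 4 + p' + q' / 16" using e[of 4] by simp
  ultimately show "\<kappa> = \<kappa>'" "p = p'" "q = q'" by linarith+
qed

text \<open>Induction on a finite set of coordinates outside which the two points agree: one
  coordinate is changed at a time, without leaving the positive orthant.\<close>

lemma constant_if_constant_along_coordinates:
  fixes G :: "('n::finite \<Rightarrow> real) \<Rightarrow> real"
  assumes "\<And>m i s t. (\<forall>j. m j > 0) \<Longrightarrow> s > 0 \<Longrightarrow> t > 0 \<Longrightarrow> G (m(i := s)) = G (m(i := t))"
    and "\<forall>j. m j > 0" "\<forall>j. m' j > 0"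
  shows "G m = G m'"
proof -
  have "\<forall>m m'. (\<forall>j. m j > 0) \<longrightarrow> (\<forall>j. m' j > 0) \<longrightarrow> (\<forall>j. j \<notin> S \<longrightarrow> m j = m' j) \<longrightarrow> G m = G m'" if "finite S" for S
    using that
  proof (induction S)
    case empty
    then show ?case by (auto simp: fun_eq_iff[symmetric])
  next
    case (insert i S)
    show ?case
    proof (intro allI impI)
      fix m m' :: "'n \<Rightarrow> real"
      assume pos: "\<forall>j. m j > 0" "\<forall>j. m' j > 0" and eq: "\<forall>j. j \<notin> insert i S \<longrightarrow> m j = m' j"
      have "G m = G (m'(i := m i))"
        using insert.IH pos eq by (metis fun_upd_apply insertE)
      also have "\<dots> = G (m'(i := m' i))" using assms(1)[of m'] pos by blast
      finally show "G m = G m'" by simp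
    qed
  qed
  from this[OF finite[of UNIV]] assms(2,3) show ?thesis by blast
qed

text \<open>Because the coefficients in direction i do not depend on m, subtracting the explicit
  primitive leaves a function that is constant along every coordinate.\<close>

lemma separable_from_line_forms:
  fixes F :: "('n::finite \<Rightarrow> real) \<Rightarrow> real"
  assumes "\<And>m i. (\<forall>j. m j > 0) \<Longrightarrow> line_form F (K i) (p i) (q i) i m"
  obtains c where "\<And>m. (\<forall>j. m j > 0) \<Longrightarrow> F m = c + (\<Sum>i\<in>UNIV. K i * ln (m i) + p i * m i - q i / m i)"
proof -
  define \<psi> where "\<psi> = (\<lambda>m. \<Sum>i\<in>UNIV. K i * ln (m i) + p i * m i - q i / m i)"
  define G where "G m = F m - \<psi> m" for m
  have const: "G (m(i := s)) = G (m(i := t))" if m: "\<forall>j. m j > 0" and st: "s > 0" "t > 0" for m i s t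
  proof -
    have psi: "\<psi> (m(i := u)) = K i * ln u + p i * u - q i / u
        + (\<Sum>j\<in>UNIV - {i}. K j * ln (m j) + p j * m j - q j / m j)" for u
      unfolding \<psi>_def by (subst sum.remove[where x = i]) (auto intro!: sum.cong)
    have "((\<lambda>u. G (m(i := u))) has_real_derivative 0) (at u)" if "u > 0" for u
    proof -
      have "((\<lambda>u. F (m(i := u))) has_real_derivative (K i / u + p i + q i / u^2)) (at u)"
        using assms[OF m] that by (simp add: line_form_def)
      moreover have "((\<lambda>u. \<psi> (m(i := u))) has_real_derivative (K i / u + p i + q i / u^2)) (at u)"
        unfolding psi using that by (auto intro!: derivative_eq_intros simp: power2_eq_square field_simps)
      ultimately have "((\<lambda>u. G (m(i := u))) has_real_derivative
          ((K i / u + p i + q i / u^2) - (K i / u + p i + q i / u^2))) (at u)"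
        unfolding G_def by (intro derivative_intros)
      then show ?thesis by simp
    qed
    then have "\<exists>c. \<forall>u\<in>{0<..}. G (m(i := u)) = c"
      by (intro has_field_derivative_zero_constant convex_real_interval(3))
         (auto intro: has_field_derivative_at_within)
    then show ?thesis using st by auto
  qed
  show thesis
  proof (rule that)
    fix m :: "'n \<Rightarrow> real" assume m: "\<forall>j. m j > 0"
    have "G m = G (\<lambda>_. 1)"
      by (rule constant_if_constant_along_coordinates[of G, OF const m]) auto
    then show "F m = G (\<lambda>_. 1) + (\<Sum>i\<in>UNIV. K i * ln (m i) + p i * m i - q i / m i)"
      by (simp add: G_def \<psi>_def)
  qed
qed

text \<open>Coordinate lines of a frame are affine lines of symmetric matrices, which makes
  \<open>twice_along\<close> applicable to them.\<close>

lemma fr_upd: "fr g (m(i := t)) = fr g (m(i := 0)) + t *\<^sub>R fr g (\<lambda>j. if j = i then 1 else 0)"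
proof -
  have "m(i := t) = (\<lambda>j. (m(i := 0)) j + t * (if j = i then 1 else 0))" by auto
  then show ?thesis by (simp only: fr_add fr_scaleR)
qed

lemma transpose_fr: "transpose (fr g m) = fr g m"
  unfolding fr_def by (rule transpose_congruence) (rule transpose_diagm)

lemma twice_along_fr:
  assumes "twice_along f" "invertible g" "\<forall>j. m j > 0"
  obtains f1 f2 where
    "\<And>t. t > 0 \<Longrightarrow> ((\<lambda>s. f (fr g (m(i := s)))) has_real_derivative f1 t) (at t)"
    "\<And>t. t > 0 \<Longrightarrow> (f1 has_real_derivative f2 t) (at t)"
proof -
  let ?x = "fr g (m(i := 0))" and ?h = "fr g (\<lambda>j. if j = i then 1 else 0)"
  obtain f1 f2 where f: "\<And>t. ?x + t *\<^sub>R ?h \<in> pd_mats \<Longrightarrow>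
     ((\<lambda>s. f (?x + s *\<^sub>R ?h)) has_real_derivative f1 t) (at t) \<and> (f1 has_real_derivative f2 t) (at t)"
    using assms(1) transpose_fr[of g] unfolding twice_along_def by blast
  have pd: "?x + t *\<^sub>R ?h \<in> pd_mats" if "t > 0" for t
    unfolding fr_upd[symmetric] using assms that by (intro fr_pd) auto
  have e: "(\<lambda>s. f (fr g (m(i := s)))) = (\<lambda>s. f (?x + s *\<^sub>R ?h))"
    by (rule ext) (rule arg_cong[OF fr_upd])
  show thesis
    by (rule that[of f1 f2, unfolded e]) (use f[OF pd] in blast)+
qed

text \<open>The equation amounts to n^2 - (N - \<alpha> M) n - \<beta> M N = 0. Its larger root is
  positive because N > \<alpha> M, also when \<beta> = 0.\<close>

lemma ex_frame_preimage:
  fixes \<alpha> \<beta> M N :: real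
  assumes "\<alpha> > 0" "\<beta> \<ge> 0" "M > 0" "N > \<alpha> * M"
  shows "\<exists>n>0. n * ((n + \<alpha> * M) / (n + \<beta> * M)) = N"
proof -
  define p where "p = N - \<alpha> * M"
  define q where "q = \<beta> * M * N"
  define n where "n = (p + sqrt (p^2 + 4 * q)) / 2"
  have p: "p > 0" and q: "q \<ge> 0" using assms by (auto simp: p_def q_def intro!: mult_nonneg_nonneg) (smt (verit) mult_pos_pos)
  have n: "n > 0" using p q by (simp add: n_def add_pos_nonneg)
  have "2 * n - p = sqrt (p^2 + 4 * q)" by (simp add: n_def field_simps)
  then have "(2 * n - p)^2 = p^2 + 4 * q" using q by simp
  then have "n * n = p * n + q" by (simp add: power2_eq_square algebra_simps)
  then have "n * (n + \<alpha> * M) = N * (n + \<beta> * M)" by (simp add: p_def q_def algebra_simps)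
  moreover have "n + \<beta> * M > 0" using n assms by (simp add: add_pos_nonneg)
  ultimately show ?thesis using n by (intro exI[of _ n]) (simp add: field_simps)
qed

text \<open>The linear coefficients of A appear only as \<alpha> a, so \<alpha> has to be positive
  for a to be recovered. The case \<alpha> = 0 is brought to this form later by exchanging the
  variables.\<close>

locale matrix_equation =
  fixes \<alpha> \<beta> :: real and A B C D :: "real^'n^'n \<Rightarrow> real"
  assumes ab: "\<alpha> > 0" "\<beta> \<ge> 0" "\<alpha> \<noteq> \<beta>"
    and twA: "twice_along A" and twB: "twice_along B"
    and eq: "\<And>x y. x \<in> pd_mats \<Longrightarrow> y \<in> pd_mats \<Longrightarrow>
      A x + B y = C (fst (phi \<alpha> \<beta> x y)) + D (snd (phi \<alpha> \<beta> x y))"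
begin

definition k where "k m n = (\<lambda>j. (n j + \<alpha> * m j) / (n j + \<beta> * m j))" for m n :: "'n \<Rightarrow> real"

text \<open>Moving only the i-th coordinates of x and y^-1 moves only the i-th coordinates of u^-1
  and v. The matrix equation thus becomes the scalar one, with the other coordinates as parameters
  on which the coefficients may still depend.\<close>

lemma line_forms_in_frame:
  assumes g: "invertible g" and m: "\<forall>j. m j > 0" and n: "\<forall>j. n j > 0"
  shows "\<exists>\<kappa> a b. line_form (\<lambda>m. A (fr g m)) \<kappa> (- \<alpha> * a) b i m
    \<and> line_form (\<lambda>n. B (matrix_inv (fr g n))) (- \<kappa>) (- a) (\<beta> * b) i n
    \<and> line_form (\<lambda>n. C (matrix_inv (fr g n))) (- \<kappa>) (- a) (\<alpha> * b) i (\<lambda>j. n j * k m n j)"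
proof -
  obtain A1 A2 where A1: "\<And>t. t > 0 \<Longrightarrow> ((\<lambda>s. A (fr g (m(i := s)))) has_real_derivative A1 t) (at t)"
    and A2: "\<And>t. t > 0 \<Longrightarrow> (A1 has_real_derivative A2 t) (at t)"
    using twice_along_fr[OF twA g m] by metis
  define h where "h = transpose (matrix_inv g)"
  have h: "invertible h" unfolding h_def using g by (simp add: invertible_matrix_inv transpose_invertible)
  have n': "\<forall>j. 1 / n j > 0" using n by simp
  obtain f1 f2 where f1: "\<And>t. t > 0 \<Longrightarrow> ((\<lambda>s. B (fr h ((\<lambda>j. 1 / n j)(i := s)))) has_real_derivative f1 t) (at t)"
    and f2: "\<And>t. t > 0 \<Longrightarrow> (f1 has_real_derivative f2 t) (at t)"
    using twice_along_fr[OF twB h n'] by metis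
  have Binv: "B (matrix_inv (fr g (n(i := t)))) = B (fr h ((\<lambda>j. 1 / n j)(i := 1 / t)))" if "t > 0" for t
  proof -
    have "matrix_inv (fr g (n(i := t))) = fr h (\<lambda>j. 1 / (n(i := t)) j)"
      unfolding h_def by (rule fr_inv[OF g]) (use n that in \<open>auto simp: less_imp_neq[symmetric]\<close>)
    also have "(\<lambda>j. 1 / (n(i := t)) j) = (\<lambda>j. 1 / n j)(i := 1 / t)" by auto
    finally show ?thesis by (rule arg_cong)
  qed
  have r: "((\<lambda>s. 1 / s) has_real_derivative (- 1 / t^2)) (at t)" if "t > 0" for t :: real
    using that by (auto intro!: derivative_eq_intros simp: power2_eq_square)
  \<comment> \<open>B is regular along lines of y, whereas the scalar equation uses coordinates of
    y^-1: these are the chain rule terms of the substitution t to 1 / t.\<close>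
  define B1 where "B1 = (\<lambda>t. f1 (1 / t) * (- 1 / t^2))"
  define B2 where "B2 = (\<lambda>t. (f2 (1 / t) * (- 1 / t^2)) * (- 1 / t^2) + (2 / t^3) * f1 (1 / t))"
  have B1: "((\<lambda>s. B (matrix_inv (fr g (n(i := s))))) has_real_derivative B1 t) (at t)" if t: "t > 0" for t
  proof -
    have "((\<lambda>s. B (fr h ((\<lambda>j. 1 / n j)(i := 1 / s)))) has_real_derivative B1 t) (at t)"
      unfolding B1_def using DERIV_chain2[OF f1[of "1 / t"] r[OF t]] t by simp
    then show ?thesis
      by (rule has_field_derivative_transform_within_open[where S = "{0<..}"]) (use t Binv in auto)
  qed
  have B2: "(B1 has_real_derivative B2 t) (at t)" if t: "t > 0" for t
  proof -
    have "((\<lambda>s. f1 (1 / s)) has_real_derivative f2 (1 / t) * (- 1 / t^2)) (at t)"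
      using DERIV_chain2[OF f2[of "1 / t"] r[OF t]] t by simp
    moreover have "((\<lambda>s::real. - 1 / s^2) has_real_derivative 2 / t^3) (at t)"
      using t by (auto intro!: derivative_eq_intros simp: power2_eq_square power3_eq_cube field_simps)
    ultimately show ?thesis unfolding B1_def B2_def by (rule DERIV_mult)
  qed
  let ?C = "\<lambda>q. C (matrix_inv (fr g ((\<lambda>j. n j * k m n j)(i := q))))"
  let ?D = "\<lambda>q. D (fr g ((\<lambda>j. m j * k m n j)(i := q)))"
  have fe: "A (fr g (m(i := s))) + B (matrix_inv (fr g (n(i := t))))
      = ?C (t * ((t + \<alpha> * s) / (t + \<beta> * s))) + ?D (s * ((t + \<alpha> * s) / (t + \<beta> * s)))"
    if st: "s > 0" "t > 0" for s t
  proof -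
    have mp: "\<And>j. (m(i := s)) j > 0" and np: "\<And>j. (n(i := t)) j > 0" using m n st by auto
    have "(\<lambda>j. (n(i := t)) j * (((n(i := t)) j + \<alpha> * (m(i := s)) j) / ((n(i := t)) j + \<beta> * (m(i := s)) j)))
        = (\<lambda>j. n j * k m n j)(i := t * ((t + \<alpha> * s) / (t + \<beta> * s)))" by (auto simp: k_def)
    moreover have "(\<lambda>j. (m(i := s)) j * (((n(i := t)) j + \<alpha> * (m(i := s)) j) / ((n(i := t)) j + \<beta> * (m(i := s)) j)))
        = (\<lambda>j. m j * k m n j)(i := s * ((t + \<alpha> * s) / (t + \<beta> * s)))" by (auto simp: k_def)
    ultimately have "phi \<alpha> \<beta> (fr g (m(i := s))) (matrix_inv (fr g (n(i := t))))
      = (matrix_inv (fr g ((\<lambda>j. n j * k m n j)(i := t * ((t + \<alpha> * s) / (t + \<beta> * s))))),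
         fr g ((\<lambda>j. m j * k m n j)(i := s * ((t + \<alpha> * s) / (t + \<beta> * s)))))"
      using phi_fr[OF g mp np less_imp_le[OF ab(1)] ab(2)] by (simp only:)
    moreover have "fr g (m(i := s)) \<in> pd_mats" "matrix_inv (fr g (n(i := t))) \<in> pd_mats"
      using fr_pd[OF g, of "m(i := s)"] fr_pd[OF g, of "n(i := t)"] mp np by (blast intro: pd_inv)+
    ultimately show ?thesis using eq by simp
  qed
  show ?thesis
  proof (rule scalar_functional_equation[OF ab A1 A2 B1 B2 fe])
    fix \<kappa> a b
    assume 1: "\<And>m. m > 0 \<Longrightarrow> A1 m = \<kappa> / m - \<alpha> * a + b / m^2"
      and 2: "\<And>n. n > 0 \<Longrightarrow> B1 n = - \<kappa> / n - a + \<beta> * b / n^2"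
      and 3: "\<And>q. q > 0 \<Longrightarrow> (?C has_real_derivative (- \<kappa> / q - a + \<alpha> * b / q^2)) (at q)"
    have "line_form (\<lambda>m. A (fr g m)) \<kappa> (- \<alpha> * a) b i m"
      unfolding line_form_def using A1 1 by auto
    moreover have "line_form (\<lambda>n. B (matrix_inv (fr g n))) (- \<kappa>) (- a) (\<beta> * b) i n"
      unfolding line_form_def using B1 2 by auto
    moreover have "line_form (\<lambda>n. C (matrix_inv (fr g n))) (- \<kappa>) (- a) (\<alpha> * b) i (\<lambda>j. n j * k m n j)"
      unfolding line_form_def using 3 by auto
    ultimately show ?thesis by blast
  qed
qed

text \<open>The coefficients found along one coordinate do not depend on the other coordinates: \<open>A\<close>, \<open>B\<close> and \<open>C\<close> share them, although
  they are evaluated at coordinates that can be varied independently. For \<open>b\<close> the function \<open>C\<close> is needed, because \<open>\<beta>\<close> may vanish.\<close>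

lemma frame_coefficients:
  assumes g: "invertible g"
  shows "\<exists>\<kappa> a b. \<forall>m. (\<forall>j. m j > 0) \<longrightarrow> line_form (\<lambda>m. A (fr g m)) \<kappa> (- \<alpha> * a) b i m
    \<and> line_form (\<lambda>n. B (matrix_inv (fr g n))) (- \<kappa>) (- a) (\<beta> * b) i m"
proof -
  let ?A = "\<lambda>m. A (fr g m)" and ?B = "\<lambda>n. B (matrix_inv (fr g n))" and ?C = "\<lambda>n. C (matrix_inv (fr g n))"
  have one: "\<forall>j::'n. (\<lambda>_. 1::real) j > 0" by simp
  obtain \<kappa> a b where A1: "line_form ?A \<kappa> (- \<alpha> * a) b i (\<lambda>_. 1)" and B1: "line_form ?B (- \<kappa>) (- a) (\<beta> * b) i (\<lambda>_. 1)"
    using line_forms_in_frame[OF g one one] by blast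
  have fA: "line_form ?A \<kappa> (- \<alpha> * a) b i m" if m: "\<forall>j. m j > 0" for m
  proof -
    \<comment> \<open>Coordinates of u^-1 that can be reached both from m and from the constant 1,
      since they exceed \<alpha> m and \<alpha>. Both line forms of C then concern the same line and
      can be compared.\<close>
    define N where "N j = \<alpha> * m j + \<alpha> + 1" for j
    have N: "N j > \<alpha> * m j" "N j > \<alpha> * 1" for j
      using ab m by (simp_all add: N_def add_pos_pos less_imp_le add_strict_increasing)
    obtain n where n: "\<And>j. n j > 0" "\<And>j. n j * ((n j + \<alpha> * m j) / (n j + \<beta> * m j)) = N j"
      using ex_frame_preimage[OF ab(1,2) _ N(1)] m by metis
    obtain n' where n': "\<And>j. n' j > 0" "\<And>j. n' j * ((n' j + \<alpha> * 1) / (n' j + \<beta> * 1)) = N j"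
      using ex_frame_preimage[OF ab(1,2) zero_less_one N(2)] by metis
    obtain \<kappa>1 a1 b1 where 1: "line_form ?A \<kappa>1 (- \<alpha> * a1) b1 i m"
      "line_form ?C (- \<kappa>1) (- a1) (\<alpha> * b1) i (\<lambda>j. n j * k m n j)"
      using line_forms_in_frame[OF g m] n(1) by blast
    obtain \<kappa>2 a2 b2 where 2: "line_form ?A \<kappa>2 (- \<alpha> * a2) b2 i (\<lambda>_. 1)"
      "line_form ?C (- \<kappa>2) (- a2) (\<alpha> * b2) i (\<lambda>j. n' j * k (\<lambda>_. 1) n' j)"
      using line_forms_in_frame[OF g one] n'(1) by blast
    have NN: "(\<lambda>j. n j * k m n j) = N" "(\<lambda>j. n' j * k (\<lambda>_. 1) n' j) = N"
      using n(2) n'(2) by (simp_all add: k_def fun_eq_iff)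
    have "- \<kappa>1 = - \<kappa>2" "- a1 = - a2" "\<alpha> * b1 = \<alpha> * b2"
      using line_form_unique[OF 1(2)[unfolded NN] 2(2)[unfolded NN]] by blast+
    moreover have "\<kappa>2 = \<kappa>" "- \<alpha> * a2 = - \<alpha> * a" "b2 = b"
      using line_form_unique[OF 2(1) A1] by auto
    ultimately show ?thesis using 1(1) ab(1) by simp
  qed
  have fB: "line_form ?B (- \<kappa>) (- a) (\<beta> * b) i n" if n: "\<forall>j. n j > 0" for n
  proof -
    obtain \<kappa>1 a1 b1 where 1: "line_form ?A \<kappa>1 (- \<alpha> * a1) b1 i (\<lambda>_. 1)"
      "line_form ?B (- \<kappa>1) (- a1) (\<beta> * b1) i n"
      using line_forms_in_frame[OF g one n] by blast
    have "\<kappa>1 = \<kappa>" "- \<alpha> * a1 = - \<alpha> * a" "b1 = b" using line_form_unique[OF 1(1) A1] by auto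
    then show ?thesis using 1(2) ab(1) by simp
  qed
  show ?thesis using fA fB by blast
qed

lemma separable_in_frame:
  assumes g: "invertible g"
  obtains K a b c where
    "\<And>m. (\<forall>j. m j > 0) \<Longrightarrow> A (fr g m) = c + (\<Sum>i\<in>UNIV. K i * ln (m i) - \<alpha> * a i * m i - b i / m i)"
proof -
  obtain K a b where
    f: "\<And>i m. (\<forall>j. m j > 0) \<Longrightarrow> line_form (\<lambda>m. A (fr g m)) (K i) (- \<alpha> * a i) (b i) i m"
    using frame_coefficients[OF g] by metis
  obtain c where c: "\<And>m. (\<forall>j. m j > 0) \<Longrightarrow> A (fr g m) = c + (\<Sum>i\<in>UNIV. K i * ln (m i) + - \<alpha> * a i * m i - b i / m i)"
    using separable_from_line_forms[of "\<lambda>m. A (fr g m)", OF f] by blast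
  show thesis by (rule that[of c K a b]) (use c in auto)
qed

end

section \<open>Trace forms and the reflection identity\<close>

text \<open>The projection onto symmetric matrices. Composing with it turns functions on the
  symmetric matrices into functions on the full matrix space, where open sets and derivatives are at
  hand.\<close>

definition sympart :: "real^'n^'n \<Rightarrow> real^'n^'n" where
  "sympart M = (1/2) *\<^sub>R (M + transpose M)"

lemma transpose_sympart: "transpose (sympart M) = sympart M"
  by (simp add: sympart_def transpose_scalar transpose_add add.commute)

lemma sympart_id: "transpose h = h \<Longrightarrow> sympart h = h"
  by (simp add: sympart_def flip: scaleR_2)

lemma sympart_add: "sympart (M + N) = sympart M + sympart N"
  by (simp add: sympart_def transpose_add algebra_simps)

lemma sympart_scaleR: "sympart (c *\<^sub>R M) = c *\<^sub>R sympart M"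
  by (simp add: sympart_def transpose_scalar algebra_simps)

lemma linear_sympart: "linear sympart"
  by (rule linearI) (simp_all add: sympart_add sympart_scaleR)

lemma inner_transpose: "transpose A \<bullet> B = A \<bullet> transpose (B::real^'n^'n)"
  unfolding inner_vec_def transpose_def by (subst sum.swap) simp

lemma inner_tr_eq_inner: "transpose x = x \<Longrightarrow> inner_tr a x = a \<bullet> x"
proof -
  assume x: "transpose x = x"
  have "inner_tr a x = a \<bullet> transpose x"
    by (simp add: inner_tr_def trace_def matrix_matrix_mult_def inner_vec_def transpose_def)
  then show ?thesis using x by simp
qed

lemma inner_sympart: "transpose x = x \<Longrightarrow> sympart G \<bullet> x = G \<bullet> x"
  by (simp add: sympart_def inner_add inner_transpose)

text \<open>c is a bound for the operator norm of h, hence for its quadratic form on unit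
  vectors.\<close>

lemma scaled_identity_plus_pd:
  fixes h :: "real^'n^'n"
  assumes "transpose h = h"
  obtains c where "c > 0" "\<And>s t. \<bar>t\<bar> * c < s \<Longrightarrow> s *\<^sub>R mat 1 + t *\<^sub>R h \<in> pd_mats"
proof -
  obtain c where c: "c > 0" "\<And>v. norm (h *v v) \<le> c * norm v"
    using linear_bounded_pos[of "(*v) h"] by auto
  show thesis
  proof (rule that[OF c(1)])
    fix s t :: real assume st: "\<bar>t\<bar> * c < s"
    have "v \<bullet> ((s *\<^sub>R mat 1 + t *\<^sub>R h) *v v) > 0" if "v \<noteq> 0" for v
    proof -
      have "\<bar>v \<bullet> (h *v v)\<bar> \<le> norm v * (c * norm v)"
        by (meson Cauchy_Schwarz_ineq2 c(2) mult_left_mono norm_ge_zero order_trans)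
      then have "\<bar>t\<bar> * \<bar>v \<bullet> (h *v v)\<bar> \<le> \<bar>t\<bar> * (norm v * (c * norm v))"
        by (rule mult_left_mono) simp
      then have "\<bar>t * (v \<bullet> (h *v v))\<bar> \<le> \<bar>t\<bar> * c * (norm v)^2"
        by (simp add: abs_mult power2_eq_square algebra_simps)
      moreover have "\<bar>t\<bar> * c * (norm v)^2 < s * (norm v)^2" using st that by simp
      moreover have "v \<bullet> ((s *\<^sub>R mat 1 + t *\<^sub>R h) *v v) = s * (norm v)^2 + t * (v \<bullet> (h *v v))"
        by (simp add: matrix_vector_mult_add_rdistrib inner_add_right power2_norm_eq_inner
            flip: scaleR_matrix_vector_assoc)
      ultimately show ?thesis by linarith
    qed
    then show "s *\<^sub>R mat 1 + t *\<^sub>R h \<in> pd_mats"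
      using assms by (simp add: pd_mats_def transpose_add transpose_scalar)
  qed
qed

text \<open>A symmetric h is the difference of the positive definite matrices h + c 1 and c 1 for
  large c. By additivity the resulting extension of p does not depend on c, and it is linear on all
  symmetric matrices.\<close>

lemma pd_additive_imp_trace_form:
  fixes p :: "real^'n^'n \<Rightarrow> real"
  assumes add: "\<And>x y. x \<in> pd_mats \<Longrightarrow> y \<in> pd_mats \<Longrightarrow> p (x + y) = p x + p y"
    and scale: "\<And>x c. x \<in> pd_mats \<Longrightarrow> c > 0 \<Longrightarrow> p (c *\<^sub>R x) = c * p x"
  obtains a where "transpose a = a" "\<And>x. x \<in> pd_mats \<Longrightarrow> p x = inner_tr a x"
proof -
  let ?I = "mat 1 :: real^'n^'n"
  have I: "c *\<^sub>R ?I \<in> pd_mats" if "c > 0" for c using that by (intro pd_scaleR one_pd)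
  have "\<exists>c>0. h + c *\<^sub>R ?I \<in> pd_mats" if h: "transpose h = h" for h
  proof -
    obtain c where c: "c > 0" "\<And>s t. \<bar>t\<bar> * c < s \<Longrightarrow> s *\<^sub>R ?I + t *\<^sub>R h \<in> pd_mats"
      using scaled_identity_plus_pd[OF h] by blast
    from c(2)[of 1 "c + 1"] c(1) show ?thesis by (intro exI[of _ "c + 1"]) (simp add: add.commute)
  qed
  then obtain c where c: "\<And>h. transpose h = h \<Longrightarrow> c h > 0" "\<And>h. transpose h = h \<Longrightarrow> h + c h *\<^sub>R ?I \<in> pd_mats"
    by metis
  define p' where "p' h = p (h + c h *\<^sub>R ?I) - p (c h *\<^sub>R ?I)" for h
  have p': "p' h = p (h + d *\<^sub>R ?I) - p (d *\<^sub>R ?I)" if h: "transpose h = h" and d: "d > 0" "h + d *\<^sub>R ?I \<in> pd_mats" for h d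
  proof -
    have "p (h + c h *\<^sub>R ?I) + p (d *\<^sub>R ?I) = p (h + c h *\<^sub>R ?I + d *\<^sub>R ?I)"
      using add[OF c(2)[OF h] I[OF d(1)]] by simp
    also have "h + c h *\<^sub>R ?I + d *\<^sub>R ?I = h + d *\<^sub>R ?I + c h *\<^sub>R ?I" by simp
    also have "p \<dots> = p (h + d *\<^sub>R ?I) + p (c h *\<^sub>R ?I)"
      using add[OF d(2) I[OF c(1)[OF h]]] by simp
    finally show ?thesis by (simp add: p'_def)
  qed
  have padd: "p' (h + k) = p' h + p' k" if h: "transpose h = h" and k: "transpose k = k" for h k
  proof -
    let ?d = "c h + c k"
    have e: "h + k + ?d *\<^sub>R ?I = (h + c h *\<^sub>R ?I) + (k + c k *\<^sub>R ?I)" by (simp add: algebra_simps)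
    have "p' (h + k) = p (h + k + ?d *\<^sub>R ?I) - p (?d *\<^sub>R ?I)"
    proof (rule p')
      show "transpose (h + k) = h + k" using h k by (simp add: transpose_add)
      show "?d > 0" using c(1)[OF h] c(1)[OF k] by simp
      show "h + k + ?d *\<^sub>R ?I \<in> pd_mats" unfolding e using c(2)[OF h] c(2)[OF k] by (rule pd_add)
    qed
    also have "p (?d *\<^sub>R ?I) = p (c h *\<^sub>R ?I) + p (c k *\<^sub>R ?I)"
      using add[OF I[OF c(1)[OF h]] I[OF c(1)[OF k]]] by (simp add: scaleR_add_left)
    also have "p (h + k + ?d *\<^sub>R ?I) = p (h + c h *\<^sub>R ?I) + p (k + c k *\<^sub>R ?I)"
      unfolding e using c(2)[OF h] c(2)[OF k] by (rule add)
    finally show ?thesis by (simp add: p'_def)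
  qed
  have ppos: "p' (s *\<^sub>R h) = s * p' h" if h: "transpose h = h" and s: "s > 0" for s h
  proof -
    have e: "s *\<^sub>R h + (s * c h) *\<^sub>R ?I = s *\<^sub>R (h + c h *\<^sub>R ?I)" by (simp add: algebra_simps)
    have "p' (s *\<^sub>R h) = p (s *\<^sub>R h + (s * c h) *\<^sub>R ?I) - p ((s * c h) *\<^sub>R ?I)"
    proof (rule p')
      show "transpose (s *\<^sub>R h) = s *\<^sub>R h" using h by (simp add: transpose_scalar)
      show "s * c h > 0" using s c(1)[OF h] by simp
      show "s *\<^sub>R h + (s * c h) *\<^sub>R ?I \<in> pd_mats" unfolding e using c(2)[OF h] s by (rule pd_scaleR)
    qed
    also have "p (s *\<^sub>R h + (s * c h) *\<^sub>R ?I) = s * p (h + c h *\<^sub>R ?I)"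
      unfolding e using c(2)[OF h] s by (rule scale)
    also have "p ((s * c h) *\<^sub>R ?I) = s * p (c h *\<^sub>R ?I)"
      using scale[OF I[OF c(1)[OF h]] s] by simp
    finally show ?thesis by (simp add: p'_def algebra_simps)
  qed
  have "transpose (0::real^'n^'n) = 0" by (simp add: transpose_def vec_eq_iff)
  then have p0: "p' 0 = 0" using padd[of 0 0] by simp
  have pneg: "p' (- h) = - p' h" if "transpose h = h" for h
    using padd[of h "- h"] that p0 transpose_scalar[of "-1" h] by simp
  have psc: "p' (s *\<^sub>R h) = s * p' h" if h: "transpose h = h" for s h
  proof (cases "s > 0")
    case True then show ?thesis by (rule ppos[OF h])
  next
    case False
    show ?thesis
    proof (cases "s = 0")
      case True then show ?thesis by (simp add: p0)
    next
      case False
      with \<open>\<not> s > 0\<close> have "- s > 0" by simp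
      from ppos[OF h this] show ?thesis
        using pneg[of "s *\<^sub>R h"] h by (simp add: transpose_scalar)
    qed
  qed
  \<comment> \<open>Extends the functional to all matrices, so that the adjoint represents it.
    Symmetrizing the representing matrix does not change its pairing with symmetric
    matrices.\<close>
  define l where "l M = p' (sympart M)" for M
  have "linear l"
    by (rule linearI) (simp_all add: l_def sympart_add sympart_scaleR padd psc transpose_sympart)
  then have l: "l M = adjoint l 1 \<bullet> M" for M
    using adjoint_works[of l M 1] by (simp add: inner_commute)
  show thesis
  proof (rule that)
    show "transpose (sympart (adjoint l 1)) = sympart (adjoint l 1)" by (rule transpose_sympart)
    fix x :: "real^'n^'n" assume x: "x \<in> pd_mats"
    have "p' x = p (x + 1 *\<^sub>R ?I) - p (1 *\<^sub>R ?I)"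
      by (rule p') (use x in \<open>auto simp: pd_sym intro!: pd_add one_pd\<close>)
    then have "p x = p' x" using add[OF x one_pd] by simp
    also have "\<dots> = l x" using x by (simp add: l_def sympart_id pd_sym)
    finally show "p x = inner_tr (sympart (adjoint l 1)) x"
      using x by (simp add: l inner_tr_eq_inner inner_sympart pd_sym)
  qed
qed

definition outer :: "real^'n \<Rightarrow> real^'n \<Rightarrow> real^'n^'n" where
  "outer u v = (\<chi> i j. u $ i * v $ j)"

lemma transpose_outer: "transpose (outer u v) = outer v u"
  by (simp add: outer_def transpose_def vec_eq_iff)

lemma matrix_mult_outer: "A ** outer u v = outer (A *v u) v"
  by (simp add: outer_def matrix_matrix_mult_def matrix_vector_mult_def vec_eq_iff sum_distrib_right mult.assoc)

lemma outer_mult_matrix: "outer u v ** A = outer u (transpose A *v v)"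
  by (simp add: outer_def matrix_matrix_mult_def matrix_vector_mult_def transpose_def vec_eq_iff
      sum_distrib_left vector_matrix_mult_def algebra_simps)

lemma outer_mult_vec: "outer u v *v w = (v \<bullet> w) *\<^sub>R u"
  by (simp add: outer_def matrix_vector_mult_def inner_vec_def vec_eq_iff sum_distrib_left sum_distrib_right algebra_simps)

lemma outer_add: "outer (u + u') v = outer u v + outer u' v" "outer u (v + v') = outer u v + outer u v'"
  by (simp_all add: outer_def vec_eq_iff algebra_simps)

lemma outer_diff: "outer (u - u') v = outer u v - outer u' v" "outer u (v - v') = outer u v - outer u v'"
  by (simp_all add: outer_def vec_eq_iff algebra_simps)

lemma outer_scaleR: "outer (c *\<^sub>R u) v = c *\<^sub>R outer u v" "outer u (c *\<^sub>R v) = c *\<^sub>R outer u v"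
  by (simp_all add: outer_def vec_eq_iff)

text \<open>Differentiating the hypothesis in \<open>y\<close> and in \<open>x\<close> gives two expressions for the derivative at \<open>x\<^sup>2\<close>. They agree on
  \<open>u w\<^sup>T + w u\<^sup>T\<close>, with \<open>x = 1 + u u\<^sup>T\<close> and \<open>u\<close> orthogonal to \<open>w\<close>, only if the derivative at \<open>1\<close> vanishes there.\<close>

lemma derivative_at_one_isotropic:
  fixes R :: "real^'n^'n \<Rightarrow> real"
  assumes diff: "\<And>x. x \<in> pd_mats \<Longrightarrow> (\<lambda>M. R (sympart M)) differentiable (at x)"
    and refl: "\<And>x y. x \<in> pd_mats \<Longrightarrow> y \<in> pd_mats \<Longrightarrow> R (x ** y ** x) = 2 * R x + R y - 2 * R (mat 1)"
  obtains D where "\<And>h. transpose h = h \<Longrightarrow> ((\<lambda>\<tau>. R (mat 1 + \<tau> *\<^sub>R h)) has_real_derivative D h) (at 0)"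
    "\<And>u v. norm u = 1 \<Longrightarrow> norm v = 1 \<Longrightarrow> u \<bullet> v = 0 \<Longrightarrow> D (outer u u) = D (outer v v)"
proof -
  let ?I = "mat 1 :: real^'n^'n"
  obtain D where D: "\<And>x. x \<in> pd_mats \<Longrightarrow> ((\<lambda>M. R (sympart M)) has_derivative D x) (at x)"
    using diff unfolding differentiable_def by metis
  have Dlin: "linear (D x)" if "x \<in> pd_mats" for x using D[OF that] by (rule has_derivative_linear)
  have curve: "((\<lambda>\<tau>. R (\<gamma> \<tau>)) has_real_derivative D x v) (at 0)"
    if x: "x \<in> pd_mats" and g: "(\<gamma> has_vector_derivative v) (at 0)" "\<gamma> 0 = x" "\<And>\<tau>. transpose (\<gamma> \<tau>) = \<gamma> \<tau>"
    for x v \<gamma>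
  proof -
    have "((\<lambda>\<tau>. R (sympart (\<gamma> \<tau>))) has_derivative (\<lambda>s. D x (s *\<^sub>R v))) (at 0)"
      using has_derivative_compose[OF g(1)[unfolded has_vector_derivative_def], of "\<lambda>M. R (sympart M)" "D x"] D[OF x] g(2)
      by simp
    then show ?thesis
      using g(3) linear_scale[OF Dlin[OF x]]
      by (simp add: has_field_derivative_def sympart_id mult.commute[of "D x v"] cong: )
         (simp add: mult_commute_abs)
  qed
  have line: "((\<lambda>\<tau>. R (x + \<tau> *\<^sub>R h)) has_real_derivative D x h) (at 0)"
    if "x \<in> pd_mats" "transpose h = h" for x h
    by (rule curve[OF that(1)])
       (use that in \<open>auto intro!: derivative_eq_intros simp: transpose_add transpose_scalar pd_sym\<close>)
  have nbh: "\<exists>e>0. \<forall>\<tau>. \<bar>\<tau>\<bar> < e \<longrightarrow> ?I + \<tau> *\<^sub>R h \<in> pd_mats" if h: "transpose h = h" for h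
  proof -
    obtain c where c: "c > 0" "\<And>s t. \<bar>t\<bar> * c < s \<Longrightarrow> s *\<^sub>R ?I + t *\<^sub>R h \<in> pd_mats"
      using scaled_identity_plus_pd[OF h] by blast
    have "?I + \<tau> *\<^sub>R h \<in> pd_mats" if "\<bar>\<tau>\<bar> < 1 / c" for \<tau>
      using c(2)[of \<tau> 1] that c(1) by (simp add: field_simps)
    then show ?thesis using c(1) by (intro exI[of _ "1 / c"]) auto
  qed
  have transfer: "D x v = d"
    if "((\<lambda>\<tau>. R (\<gamma> \<tau>)) has_real_derivative D x v) (at 0)" "(f has_real_derivative d) (at 0)"
      "e > 0" "\<And>\<tau>. \<bar>\<tau>\<bar> < e \<Longrightarrow> f \<tau> = R (\<gamma> \<tau>)" for x v d e f \<gamma>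
  proof -
    have "((\<lambda>\<tau>. R (\<gamma> \<tau>)) has_real_derivative d) (at 0)"
      by (rule has_field_derivative_transform_within_open[OF that(2), of "{-e<..<e}"])
         (use that(3,4) in \<open>auto simp: abs_less_iff\<close>)
    with that(1) show ?thesis by (rule DERIV_unique)
  qed
  have d1: "D (x ** x) (x ** h ** x) = D ?I h" if x: "x \<in> pd_mats" and h: "transpose h = h" for x h
  proof -
    obtain e where e: "e > 0" "\<And>\<tau>. \<bar>\<tau>\<bar> < e \<Longrightarrow> ?I + \<tau> *\<^sub>R h \<in> pd_mats" using nbh[OF h] by blast
    have xx: "x ** x \<in> pd_mats"
      using pd_congruence[OF pd_invertible[OF x] one_pd] by (simp add: pd_sym[OF x])
    have e1: "x ** x + \<tau> *\<^sub>R (x ** h ** x) = x ** (?I + \<tau> *\<^sub>R h) ** x" for \<tau>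
      by (simp add: matrix_add_ldistrib matrix_add_mult_distrib matrix_scaleR_left matrix_scaleR_right)
    have sy: "transpose (x ** h ** x) = x ** h ** x"
      using transpose_congruence[OF h, of x] by (simp add: pd_sym[OF x])
    show ?thesis
    proof (rule transfer[OF line[OF xx sy] _ e(1)])
      show "((\<lambda>\<tau>. 2 * R x + R (?I + \<tau> *\<^sub>R h) - 2 * R ?I) has_real_derivative D ?I h) (at 0)"
        using line[OF one_pd h] by (auto intro!: derivative_eq_intros)
      show "2 * R x + R (?I + \<tau> *\<^sub>R h) - 2 * R ?I = R (x ** x + \<tau> *\<^sub>R (x ** h ** x))" if "\<bar>\<tau>\<bar> < e" for \<tau>
        unfolding e1 using refl[OF x e(2)[OF that]] by simp
    qed
  qed
  have d2: "D y (h ** y + y ** h) = 2 * D ?I h" if y: "y \<in> pd_mats" and h: "transpose h = h" for y h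
  proof -
    obtain e where e: "e > 0" "\<And>\<tau>. \<bar>\<tau>\<bar> < e \<Longrightarrow> ?I + \<tau> *\<^sub>R h \<in> pd_mats" using nbh[OF h] by blast
    define \<gamma> where "\<gamma> \<tau> = y + \<tau> *\<^sub>R (h ** y + y ** h) + (\<tau>^2) *\<^sub>R (h ** y ** h)" for \<tau> :: real
    have e1: "\<gamma> \<tau> = (?I + \<tau> *\<^sub>R h) ** y ** (?I + \<tau> *\<^sub>R h)" for \<tau>
      by (simp add: \<gamma>_def matrix_add_ldistrib matrix_add_mult_distrib matrix_scaleR_left matrix_scaleR_right
          algebra_simps power2_eq_square)
    have sy: "transpose (\<gamma> \<tau>) = \<gamma> \<tau>" for \<tau>
      unfolding e1 using transpose_congruence[OF pd_sym[OF y], of "?I + \<tau> *\<^sub>R h"] h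
      by (simp add: transpose_add transpose_scalar)
    have gd: "(\<gamma> has_vector_derivative (h ** y + y ** h)) (at 0)"
      unfolding \<gamma>_def by (auto intro!: derivative_eq_intros)
    have g0: "\<gamma> 0 = y" by (simp add: \<gamma>_def)
    show ?thesis
    proof (rule transfer[OF curve[OF y gd g0 sy] _ e(1)])
      show "((\<lambda>\<tau>. 2 * R (?I + \<tau> *\<^sub>R h) + R y - 2 * R ?I) has_real_derivative 2 * D ?I h) (at 0)"
        using line[OF one_pd h] by (auto intro!: derivative_eq_intros)
      show "2 * R (?I + \<tau> *\<^sub>R h) + R y - 2 * R ?I = R (\<gamma> \<tau>)" if "\<bar>\<tau>\<bar> < e" for \<tau>
        unfolding e1 using refl[OF e(2)[OF that] y] by simp
    qed
  qed
  have zero: "D ?I (outer u w + outer w u) = 0" if u: "norm u = 1" and uw: "u \<bullet> w = 0" for u w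
  proof -
    define x where "x = ?I + outer u u"
    define h where "h = outer u w + outer w u"
    have h: "transpose h = h" by (simp add: h_def transpose_add transpose_outer add.commute)
    have xt: "transpose x = x" by (simp add: x_def transpose_add transpose_outer)
    have x: "x \<in> pd_mats"
      unfolding pd_mats_def
    proof (intro CollectI conjI allI impI xt)
      fix v :: "real^'n" assume "v \<noteq> 0"
      then have "v \<bullet> v > 0" by simp
      moreover have "v \<bullet> (x *v v) = v \<bullet> v + (u \<bullet> v)^2"
        by (simp add: x_def matrix_vector_mult_add_rdistrib outer_mult_vec inner_add_right power2_eq_square inner_commute)
      ultimately show "v \<bullet> (x *v v) > 0" by (simp add: add_pos_nonneg)
    qed
    have uu: "u \<bullet> u = 1" using u by (simp add: dot_square_norm)
    have xu: "x *v u = 2 *\<^sub>R u" and xw: "x *v w = w"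
      by (simp_all add: x_def matrix_vector_mult_add_rdistrib outer_mult_vec uu uw scaleR_2)
    have yu: "(x ** x) *v u = 4 *\<^sub>R u" and yw: "(x ** x) *v w = w"
      by (simp_all add: xu xw matrix_vector_mult_scaleR flip: matrix_vector_mul_assoc)
    have yt: "transpose (x ** x) = x ** x" by (simp add: matrix_transpose_mul xt)
    have yy: "x ** x \<in> pd_mats"
      using pd_congruence[OF pd_invertible[OF x] one_pd] by (simp add: xt)
    \<comment> \<open>x has eigenvalue 2 at u and 1 at w, so x h x = 2 h and h x^2 + x^2 h = (4 + 1)
      h. With D' the derivative at x^2, the two expressions read 2 D' h = D h and 5 D' h = 2 D h,
      which forces both to vanish.\<close>
    have "x ** h ** x = 2 *\<^sub>R h"
      by (simp add: h_def matrix_add_ldistrib matrix_add_mult_distrib matrix_mult_outer outer_mult_matrix xt xu xw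
          outer_scaleR scaleR_add_right matrix_scaleR_left del: transpose_matrix_vector)
    then have 1: "2 * D (x ** x) h = D ?I h"
      using d1[OF x h] linear_scale[OF Dlin[OF yy]] by simp
    have "h ** (x ** x) + (x ** x) ** h = 5 *\<^sub>R h"
      unfolding h_def matrix_add_ldistrib matrix_add_mult_distrib matrix_mult_outer outer_mult_matrix yt yu yw
        outer_scaleR by (simp add: vec_eq_iff)
    then have 2: "5 * D (x ** x) h = 2 * D ?I h"
      using d2[OF yy h] linear_scale[OF Dlin[OF yy]] by simp
    from 1 2 show ?thesis by (simp add: h_def)
  qed
  show thesis
  proof (rule that)
    show "((\<lambda>\<tau>. R (?I + \<tau> *\<^sub>R h)) has_real_derivative D ?I h) (at 0)" if "transpose h = h" for h
      using line[OF one_pd that] .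
    fix u v :: "real^'n" assume u: "norm u = 1" and v: "norm v = 1" and uv: "u \<bullet> v = 0"
    have uu: "u \<bullet> u = 1" "v \<bullet> v = 1" using u v by (simp_all add: dot_square_norm)
    \<comment> \<open>Polarization: u' is orthogonal to u - v, and their symmetrized outer product
      is a multiple of u u^T - v v^T.\<close>
    define u' where "u' = (1 / sqrt 2) *\<^sub>R (u + v)"
    have "u' \<bullet> u' = 1"
      by (simp add: u'_def inner_add uu uv inner_commute[of v u] flip: power2_eq_square)
    then have n: "norm u' = 1" by (simp add: norm_eq_sqrt_inner)
    have "u' \<bullet> (u - v) = 0" by (simp add: u'_def inner_add inner_diff uu uv inner_commute[of v u])
    from zero[OF n this] have "D ?I (outer u' (u - v) + outer (u - v) u') = 0" .
    also have "outer u' (u - v) + outer (u - v) u' = (2 / sqrt 2) *\<^sub>R (outer u u - outer v v)"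
      unfolding u'_def outer_scaleR outer_add outer_diff
      by (simp add: vec_eq_iff algebra_simps)
    finally have "D ?I (outer u u - outer v v) = 0"
      using linear_scale[OF Dlin[OF one_pd]] by simp
    then show "D ?I (outer u u) = D ?I (outer v v)"
      using linear_diff[OF Dlin[OF one_pd]] by simp
  qed
qed

text \<open>At the powers of two 1/2, 1, 2, 4 every logarithm is a multiple of ln 2, so that with L
  = (\<kappa> - \<kappa>') ln 2 as an unknown four evaluations form a regular linear system.\<close>

lemma log_linear_inverse_unique:
  fixes \<kappa> :: real
  assumes "\<And>t. t > 0 \<Longrightarrow> \<kappa> * ln t - t * P - Q / t + R = \<kappa>' * ln t - t * P' - Q' / t + R'"
  shows "\<kappa> = \<kappa>'" "P = P'" "Q = Q'" "R = R'"
proof -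
  define L where "L = (\<kappa> - \<kappa>') * ln 2"
  have ln: "ln (1/2::real) = - ln 2" "ln (4::real) = 2 * ln 2"
    using ln_powr[of 2 2] by (simp_all add: ln_div)
  have "- P - Q + R = - P' - Q' + R'" using assms[of 1] by simp
  moreover have "L - 2 * P - Q / 2 + R = - 2 * P' - Q' / 2 + R'"
    using assms[of 2] by (simp add: L_def algebra_simps)
  moreover have "- L - P / 2 - 2 * Q + R = - P' / 2 - 2 * Q' + R'"
    using assms[of "1/2"] by (simp add: L_def ln algebra_simps)
  moreover have "2 * L - 4 * P - Q / 4 + R = - 4 * P' - Q' / 4 + R'"
    using assms[of 4] by (simp add: L_def ln algebra_simps)
  ultimately have "L = 0" "P = P'" "Q = Q'" "R = R'" by linarith+
  then show "\<kappa> = \<kappa>'" "P = P'" "Q = Q'" "R = R'" by (simp_all add: L_def)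
qed

lemma det_orthogonal_square: "orthogonal_matrix Q \<Longrightarrow> (det (Q::real^'n^'n))\<^sup>2 = 1"
  using det_orthogonal_matrix by fastforce

lemma ln_det_fr:
  assumes "invertible g" "\<forall>j. m j > 0"
  shows "ln (det (fr g m)) = ln ((det g)\<^sup>2) + (\<Sum>i\<in>UNIV. ln (m i))"
proof -
  have "(det g)\<^sup>2 > 0" using assms(1) by (simp add: invertible_det_nz)
  moreover have "(\<Prod>i\<in>UNIV. m i) > 0" using assms(2) by (simp add: prod_pos)
  moreover have "m i \<noteq> 0" for i using assms(2) by (metis less_irrefl)
  ultimately show ?thesis
    using assms(2) by (simp add: det_fr ln_mult ln_prod)
qed

lemma ln_recip: "\<forall>j. m j > 0 \<Longrightarrow> ln (1 / m i) = - ln (m i :: real)"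
  by (simp add: ln_inverse flip: inverse_eq_divide)

lemma fr_delta: "fr Q (\<lambda>j. if j = i then 1 else 0) = outer (column i Q) (column i Q)"
proof -
  have "(fr Q (\<lambda>j. if j = i then 1 else 0)) $ a $ b = Q $ a $ i * Q $ b $ i" for a b
  proof -
    have "(Q ** diagm (\<lambda>j. if j = i then 1 else 0)) $ a $ c = (if c = i then Q $ a $ i else 0)" for c
      by (simp add: matrix_matrix_mult_def diagm_def if_distrib cong: if_cong)
    then have "(\<Sum>c\<in>UNIV. (Q ** diagm (\<lambda>j. if j = i then 1 else 0)) $ a $ c * Q $ b $ c)
        = (\<Sum>c\<in>UNIV. if c = i then Q $ a $ i * Q $ b $ i else 0)"
      by (intro sum.cong) auto
    then show ?thesis
      unfolding fr_def by (simp add: matrix_matrix_mult_def[of "Q ** _"] transpose_def)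
  qed
  then show ?thesis by (simp add: vec_eq_iff outer_def column_def)
qed

lemma inner_matrix_outer: "v \<bullet> (h *v v) = h \<bullet> outer v v"
  by (simp add: outer_def inner_vec_def matrix_vector_mult_def sum_distrib_left algebra_simps)

lemma norm_outer: "norm (outer v v) = (norm v)\<^sup>2"
proof -
  have "outer v v \<bullet> outer v v = (v \<bullet> v)\<^sup>2"
    by (simp add: outer_def inner_vec_def power2_eq_square sum_product algebra_simps)
  then have "norm (outer v v) = sqrt ((v \<bullet> v)\<^sup>2)" by (simp add: norm_eq_sqrt_inner)
  then show ?thesis by (simp add: power2_norm_eq_inner)
qed

text \<open>\<open>pd_mats\<close> lies in the subspace of symmetric matrices, so openness is stated
  through \<open>sympart\<close>. The minimum \<mu> of the quadratic form on the unit sphere is a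
  radius that works.\<close>

lemma open_sympart_pd: "open {M :: real^'n^'n. sympart M \<in> pd_mats}"
  unfolding open_dist
proof (intro ballI)
  fix M :: "real^'n^'n" assume "M \<in> {M. sympart M \<in> pd_mats}"
  then have x: "sympart M \<in> pd_mats" by simp
  have eqv: "v \<bullet> (sympart N *v v) = N \<bullet> outer v v" for N :: "real^'n^'n" and v
    by (simp add: inner_matrix_outer inner_sympart transpose_outer)
  have "axis undefined 1 \<in> sphere (0::real^'n) 1" by (simp add: norm_axis_1)
  then have ne: "sphere (0::real^'n) 1 \<noteq> {}" by blast
  have cont: "continuous_on (sphere (0::real^'n) 1) (\<lambda>v. v \<bullet> (sympart M *v v))"
    by (intro continuous_intros)
  obtain e where e: "norm e = 1" "\<And>v. norm v = 1 \<Longrightarrow> e \<bullet> (sympart M *v e) \<le> v \<bullet> (sympart M *v v)"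
    using continuous_attains_inf[OF compact_sphere ne cont] by auto
  define \<mu> where "\<mu> = e \<bullet> (sympart M *v e)"
  have mu: "\<mu> > 0" unfolding \<mu>_def using e(1) by (intro pd_pos[OF x]) auto
  have "sympart N \<in> pd_mats" if N: "dist N M < \<mu>" for N
    unfolding pd_mats_def
  proof (intro CollectI conjI allI impI transpose_sympart)
    fix v :: "real^'n" assume v: "v \<noteq> 0"
    define w where "w = (1 / norm v) *\<^sub>R v"
    have w: "norm w = 1" and vw: "v = norm v *\<^sub>R w" using v by (simp_all add: w_def)
    have "\<bar>(N - M) \<bullet> outer w w\<bar> \<le> norm (N - M) * norm (outer w w)" by (rule Cauchy_Schwarz_ineq2)
    then have "\<bar>(N - M) \<bullet> outer w w\<bar> < \<mu>" using N w by (simp add: norm_outer dist_norm)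
    moreover have "M \<bullet> outer w w \<ge> \<mu>" using e(2)[OF w] by (simp add: eqv \<mu>_def)
    ultimately have "w \<bullet> (sympart N *v w) > 0" by (simp add: eqv inner_diff_left)
    moreover have "v \<bullet> (sympart N *v v) = (norm v)\<^sup>2 * (w \<bullet> (sympart N *v w))"
      by (subst (1 2) vw) (simp add: matrix_vector_mult_scaleR power2_eq_square)
    ultimately show "v \<bullet> (sympart N *v v) > 0" using v by simp
  qed
  then show "\<exists>e>0. \<forall>y. dist y M < e \<longrightarrow> y \<in> {M. sympart M \<in> pd_mats}" using mu by blast
qed

text \<open>Derivatives along lines do not make a directional derivative linear in the direction.
  Full differentiability of A supplies this linearity for the argument at the identity.\<close>

locale matrix_equation_diff = matrix_equation \<alpha> \<beta> A B C D
  for \<alpha> \<beta> :: real and A B C D :: "real^'n^'n \<Rightarrow> real" +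
  assumes diffA: "\<And>x. x \<in> pd_mats \<Longrightarrow> (\<lambda>M. A (sympart M)) differentiable (at x)"
begin

text \<open>Along the ray through \<open>x\<close> the function \<open>A\<close> is a combination of \<open>ln t\<close>, \<open>t\<close>, \<open>1 / t\<close> and \<open>1\<close>. The coefficients of \<open>t\<close> and of \<open>1 / t\<close> are
  linear in \<open>x\<close> and in \<open>x\<^sup>-\<^sup>1\<close> because they are so in each frame and any two points share a frame. The remaining part \<open>R\<close> is affine
  along the geodesics of the cone, which leaves only multiples of \<open>ln det\<close>.\<close>

theorem A_form:
  obtains \<kappa> a b c where "transpose a = a" "transpose b = b"
    "\<And>x. x \<in> pd_mats \<Longrightarrow> A x = \<kappa> * ln (det x) - \<alpha> * inner_tr a x - inner_tr b (matrix_inv x) + c"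
proof -
  let ?I = "mat 1 :: real^'n^'n"
  let ?rep = "\<lambda>x \<kappa> P Q R. \<forall>t>0. A (t *\<^sub>R x) = \<kappa> * ln t - t * P - Q / t + R"
  have repfr: "\<exists>K p b c. \<forall>m. (\<forall>j. m j > 0) \<longrightarrow>
      ?rep (fr g m) (\<Sum>i\<in>UNIV. K i) (\<Sum>i\<in>UNIV. p i * m i) (\<Sum>i\<in>UNIV. b i / m i) (c + (\<Sum>i\<in>UNIV. K i * ln (m i)))"
    if g: "invertible g" for g
  proof -
    obtain K a b c where
      f: "\<And>m. (\<forall>j. m j > 0) \<Longrightarrow> A (fr g m) = c + (\<Sum>i\<in>UNIV. K i * ln (m i) - \<alpha> * a i * m i - b i / m i)"
      by (rule separable_in_frame[OF g]) (rule that)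
    have "?rep (fr g m) (\<Sum>i\<in>UNIV. K i) (\<Sum>i\<in>UNIV. \<alpha> * a i * m i) (\<Sum>i\<in>UNIV. b i / m i) (c + (\<Sum>i\<in>UNIV. K i * ln (m i)))"
      if m: "\<forall>j. m j > 0" for m
    proof (intro allI impI)
      fix t :: real assume t: "t > 0"
      have "A (t *\<^sub>R fr g m) = c + (\<Sum>i\<in>UNIV. K i * ln (t * m i) - \<alpha> * a i * (t * m i) - b i / (t * m i))"
        unfolding fr_scaleR using m t by (intro f) simp
      also have "(\<Sum>i\<in>UNIV. K i * ln (t * m i) - \<alpha> * a i * (t * m i) - b i / (t * m i))
          = (\<Sum>i\<in>UNIV. K i * ln t + K i * ln (m i) - t * (\<alpha> * a i * m i) - (b i / m i) / t)"
      proof (intro sum.cong refl)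
        fix i :: 'n
        have "m i > 0" using m by blast
        then show "K i * ln (t * m i) - \<alpha> * a i * (t * m i) - b i / (t * m i)
            = K i * ln t + K i * ln (m i) - t * (\<alpha> * a i * m i) - (b i / m i) / t"
          using t by (simp add: ln_mult algebra_simps)
      qed
      also have "\<dots> = (\<Sum>i\<in>UNIV. K i) * ln t + (\<Sum>i\<in>UNIV. K i * ln (m i)) - t * (\<Sum>i\<in>UNIV. \<alpha> * a i * m i) - (\<Sum>i\<in>UNIV. b i / m i) / t"
        by (simp add: sum.distrib sum_subtractf sum_distrib_left sum_distrib_right sum_divide_distrib)
      finally show "A (t *\<^sub>R fr g m) = (\<Sum>i\<in>UNIV. K i) * ln t - t * (\<Sum>i\<in>UNIV. \<alpha> * a i * m i)
          - (\<Sum>i\<in>UNIV. b i / m i) / t + (c + (\<Sum>i\<in>UNIV. K i * ln (m i)))" by simp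
    qed
    note H = this
    show ?thesis
      by (rule exI[of _ K], rule exI[of _ "\<lambda>i. \<alpha> * a i"], rule exI[of _ b], rule exI[of _ c], rule allI, rule impI, erule H)
  qed
  have "\<exists>\<kappa> P Q R. ?rep x \<kappa> P Q R" if x: "x \<in> pd_mats" for x
  proof -
    obtain g m where g: "invertible g" "\<forall>i. m i > 0" and xg: "x = fr g m"
      using simultaneous_diagonalization[OF one_pd x] by metis
    show ?thesis using repfr[OF g(1)] g(2) unfolding xg by blast
  qed
  note ex = this
  define rp where "rp x \<kappa> P Q R \<longleftrightarrow> ?rep x \<kappa> P Q R" for x \<kappa> P Q R
  have "\<forall>x\<in>pd_mats. \<exists>\<kappa> P Q R. rp x \<kappa> P Q R" using ex unfolding rp_def by blast
  then obtain kap P Q R where "\<And>x. x \<in> pd_mats \<Longrightarrow> rp x (kap x) (P x) (Q x) (R x)"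
    by metis
  then have rep: "\<And>x. x \<in> pd_mats \<Longrightarrow> ?rep x (kap x) (P x) (Q x) (R x)"
    unfolding rp_def by blast
  define frp where "frp g K p b c \<longleftrightarrow> (\<forall>m. (\<forall>j. m j > 0) \<longrightarrow> kap (fr g m) = (\<Sum>i\<in>UNIV. K i) \<and> P (fr g m) = (\<Sum>i\<in>UNIV. p i * m i)
      \<and> Q (fr g m) = (\<Sum>i\<in>UNIV. b i / m i) \<and> R (fr g m) = c + (\<Sum>i\<in>UNIV. K i * ln (m i)))" for g K p b c
  have fr': "\<exists>K p b c. frp g K p b c"
    if g: "invertible g" for g
  proof -
    obtain K p b c where r: "\<And>m. (\<forall>j. m j > 0) \<Longrightarrow>
      ?rep (fr g m) (\<Sum>i\<in>UNIV. K i) (\<Sum>i\<in>UNIV. p i * m i) (\<Sum>i\<in>UNIV. b i / m i) (c + (\<Sum>i\<in>UNIV. K i * ln (m i)))"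
      using repfr[OF g] by blast
    have "kap (fr g m) = (\<Sum>i\<in>UNIV. K i) \<and> P (fr g m) = (\<Sum>i\<in>UNIV. p i * m i)
      \<and> Q (fr g m) = (\<Sum>i\<in>UNIV. b i / m i) \<and> R (fr g m) = c + (\<Sum>i\<in>UNIV. K i * ln (m i))"
      if m: "\<forall>j. m j > 0" for m
    proof -
      have pd: "fr g m \<in> pd_mats" using fr_pd[OF g] m by blast
      have "kap (fr g m) * ln t - t * P (fr g m) - Q (fr g m) / t + R (fr g m)
        = (\<Sum>i\<in>UNIV. K i) * ln t - t * (\<Sum>i\<in>UNIV. p i * m i) - (\<Sum>i\<in>UNIV. b i / m i) / t + (c + (\<Sum>i\<in>UNIV. K i * ln (m i)))"
        if "t > 0" for t
        using rep[OF pd, rule_format, OF that] r[OF m, rule_format, OF that] by simp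
      from log_linear_inverse_unique[OF this] show ?thesis by blast
    qed
    note H = this
    show ?thesis
      unfolding frp_def
      by (rule exI[of _ K], rule exI[of _ p], rule exI[of _ b], rule exI[of _ c], rule allI, rule impI, erule H)
  qed
  \<comment> \<open>In a frame \<open>kap\<close> is the sum of the \<open>K i\<close>, whatever the
    coordinates, and every x shares a frame with the identity.\<close>
  have kapc: "kap x = kap ?I" if x: "x \<in> pd_mats" for x
  proof -
    obtain g m where g: "invertible g" "\<forall>i. m i > 0" and e: "?I = fr g (\<lambda>_. 1)" "x = fr g m"
      using simultaneous_diagonalization[OF one_pd x] by metis
    obtain K p b c where H: "frp g K p b c" using fr'[OF g(1)] by blast
    have K: "kap (fr g m) = (\<Sum>i\<in>UNIV. K i)" if "\<forall>j. m j > 0" for m using H that unfolding frp_def by blast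
    show ?thesis using K[OF g(2)] K[of "\<lambda>_. 1"] e by simp
  qed
  have Padd: "P (x + y) = P x + P y" if x: "x \<in> pd_mats" and y: "y \<in> pd_mats" for x y
  proof -
    obtain g m where g: "invertible g" "\<forall>i. m i > 0" and e: "x = fr g (\<lambda>_. 1)" "y = fr g m"
      using simultaneous_diagonalization[OF x y] by metis
    obtain K p b c where H: "frp g K p b c" using fr'[OF g(1)] by blast
    have p: "P (fr g m) = (\<Sum>i\<in>UNIV. p i * m i)" if "\<forall>j. m j > 0" for m using H that unfolding frp_def by blast
    have "P (x + y) = (\<Sum>i\<in>UNIV. p i * (1 + m i))"
      unfolding e fr_add by (rule p) (use g in \<open>simp add: add_pos_pos\<close>)
    then show ?thesis
      using p[OF g(2)] p[of "\<lambda>_. 1"] by (simp add: e sum.distrib algebra_simps)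
  qed
  have Pscale: "P (s *\<^sub>R x) = s * P x" if x: "x \<in> pd_mats" and s: "s > 0" for x s
  proof -
    obtain g m where g: "invertible g" "\<forall>i. m i > 0" and e: "x = fr g m"
      using simultaneous_diagonalization[OF one_pd x] by metis
    obtain K p b c where H: "frp g K p b c" using fr'[OF g(1)] by blast
    have p: "P (fr g m) = (\<Sum>i\<in>UNIV. p i * m i)" if "\<forall>j. m j > 0" for m using H that unfolding frp_def by blast
    have "P (s *\<^sub>R x) = (\<Sum>i\<in>UNIV. p i * (s * m i))"
      unfolding e fr_scaleR by (rule p) (use g s in simp)
    then show ?thesis using p[OF g(2)] by (simp add: e sum_distrib_left algebra_simps)
  qed
  define Qi where "Qi w = Q (matrix_inv w)" for w
  define qfp where "qfp g b \<longleftrightarrow> (\<forall>m. (\<forall>j. m j > 0) \<longrightarrow> Qi (fr g m) = (\<Sum>i\<in>UNIV. b i * m i))" for g b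
  have Qifr: "\<exists>b. qfp g b" if g: "invertible g" for g
  proof -
    define h where "h = transpose (matrix_inv g)"
    have h: "invertible h" unfolding h_def using g by (simp add: invertible_matrix_inv transpose_invertible)
    obtain K p b c where H: "frp h K p b c" using fr'[OF h] by blast
    have b: "Q (fr h m) = (\<Sum>i\<in>UNIV. b i / m i)" if "\<forall>j. m j > 0" for m using H that unfolding frp_def by blast
    have "Qi (fr g m) = (\<Sum>i\<in>UNIV. b i * m i)" if m: "\<forall>j. m j > 0" for m
    proof -
      have "matrix_inv (fr g m) = fr h (\<lambda>i. 1 / m i)"
        unfolding h_def using m by (intro fr_inv g) (metis less_irrefl)
      then show ?thesis using b[of "\<lambda>i. 1 / m i"] m by (simp add: Qi_def)
    qed
    then have "qfp g b" unfolding qfp_def by blast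
    then show ?thesis by blast
  qed
  have Qadd: "Qi (x + y) = Qi x + Qi y" if x: "x \<in> pd_mats" and y: "y \<in> pd_mats" for x y
  proof -
    obtain g m where g: "invertible g" "\<forall>i. m i > 0" and e: "x = fr g (\<lambda>_. 1)" "y = fr g m"
      using simultaneous_diagonalization[OF x y] by metis
    obtain p where H: "qfp g p" using Qifr[OF g(1)] by blast
    have p: "Qi (fr g m) = (\<Sum>i\<in>UNIV. p i * m i)" if "\<forall>j. m j > 0" for m using H that unfolding qfp_def by blast
    have "Qi (x + y) = (\<Sum>i\<in>UNIV. p i * (1 + m i))"
      unfolding e fr_add by (rule p) (use g in \<open>simp add: add_pos_pos\<close>)
    then show ?thesis
      using p[OF g(2)] p[of "\<lambda>_. 1"] by (simp add: e sum.distrib algebra_simps)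
  qed
  have Qscale: "Qi (s *\<^sub>R x) = s * Qi x" if x: "x \<in> pd_mats" and s: "s > 0" for x s
  proof -
    obtain g m where g: "invertible g" "\<forall>i. m i > 0" and e: "x = fr g m"
      using simultaneous_diagonalization[OF one_pd x] by metis
    obtain p where H: "qfp g p" using Qifr[OF g(1)] by blast
    have p: "Qi (fr g m) = (\<Sum>i\<in>UNIV. p i * m i)" if "\<forall>j. m j > 0" for m using H that unfolding qfp_def by blast
    have "Qi (s *\<^sub>R x) = (\<Sum>i\<in>UNIV. p i * (s * m i))"
      unfolding e fr_scaleR by (rule p) (use g s in simp)
    then show ?thesis using p[OF g(2)] by (simp add: e sum_distrib_left algebra_simps)
  qed
  obtain a' where a': "transpose a' = a'" "\<And>x. x \<in> pd_mats \<Longrightarrow> P x = inner_tr a' x"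
    using pd_additive_imp_trace_form[of P, OF Padd Pscale] by metis
  obtain b where b: "transpose b = b" "\<And>x. x \<in> pd_mats \<Longrightarrow> Qi x = inner_tr b x"
    using pd_additive_imp_trace_form[of Qi, OF Qadd Qscale] by metis
  have AR: "A x = R x - P x - Q x" if "x \<in> pd_mats" for x
    using rep[OF that] by (auto dest: spec[of _ 1])
  have A2R: "A (2 *\<^sub>R x) = kap ?I * ln 2 - 2 * P x - Q x / 2 + R x" if "x \<in> pd_mats" for x
    using rep[OF that] kapc[OF that] by (auto dest: spec[of _ 2])
  \<comment> \<open>Twice A (2 x) minus A x eliminates Q. As P is a trace form, R inherits
    differentiability from A.\<close>
  have RA: "R x = 2 * A (2 *\<^sub>R x) - A x + 3 * P x - 2 * kap ?I * ln 2" if "x \<in> pd_mats" for x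
    using AR[OF that] A2R[OF that] by (simp add: algebra_simps)
  have diffR: "(\<lambda>M. R (sympart M)) differentiable (at x)" if x: "x \<in> pd_mats" for x
  proof -
    have op: "\<forall>\<^sub>F M in nhds x. sympart M \<in> pd_mats"
      using open_sympart_pd x by (auto simp: eventually_nhds sympart_id pd_sym)
    have d1: "(\<lambda>M. A (sympart M)) differentiable (at x)" using diffA[OF x] .
    have d2: "(\<lambda>M. A (2 *\<^sub>R sympart M)) differentiable (at x)"
    proof -
      have "(\<lambda>M. A (sympart M)) differentiable (at (2 *\<^sub>R x))" using diffA[OF pd_scaleR[OF x]] by simp
      then have "(\<lambda>M. A (sympart (2 *\<^sub>R M))) differentiable (at x)"
        by (intro differentiable_compose[of "\<lambda>M. A (sympart M)" "\<lambda>M. 2 *\<^sub>R M"]) auto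
      then show ?thesis by (simp add: sympart_scaleR)
    qed
    have d3: "(\<lambda>M. a' \<bullet> sympart M) differentiable (at x)"
      using linear_sympart by (intro linear_imp_differentiable linear_compose[of sympart "\<lambda>M. a' \<bullet> M", unfolded o_def])
        (auto intro!: bounded_linear.linear[OF bounded_linear_inner_right])
    have "(\<lambda>M. 2 * A (2 *\<^sub>R sympart M) - A (sympart M) + 3 * (a' \<bullet> sympart M) - 2 * kap ?I * ln 2) differentiable (at x)"
      using d1 d2 d3 by (intro derivative_intros)
    then obtain D where "((\<lambda>M. 2 * A (2 *\<^sub>R sympart M) - A (sympart M) + 3 * (a' \<bullet> sympart M) - 2 * kap ?I * ln 2) has_derivative D) (at x)"
      unfolding differentiable_def by blast
    then have "((\<lambda>M. R (sympart M)) has_derivative D) (at x)"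
    proof (rule has_derivative_transform_eventually)
      show "\<forall>\<^sub>F M in at x. 2 * A (2 *\<^sub>R sympart M) - A (sympart M) + 3 * (a' \<bullet> sympart M) - 2 * kap ?I * ln 2 = R (sympart M)"
        using op by (auto simp: eventually_at_filter RA a'(2) inner_tr_eq_inner transpose_sympart elim: eventually_mono)
      show "2 * A (2 *\<^sub>R sympart x) - A (sympart x) + 3 * (a' \<bullet> sympart x) - 2 * kap ?I * ln 2 = R (sympart x)"
        using x by (simp add: sympart_id pd_sym RA a'(2) inner_tr_eq_inner)
    qed simp
    then show ?thesis unfolding differentiable_def by blast
  qed
  \<comment> \<open>An orthogonal frame contains the identity, at coordinates 1, and inversion keeps
    the frame while changing the sign of every ln m.\<close>
  have Rinv: "R (matrix_inv y) = 2 * R ?I - R y" if y: "y \<in> pd_mats" for y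
  proof -
    obtain q m where q: "orthogonal_matrix q" and m: "\<forall>i. m i > 0" and e: "y = fr q m"
      using pd_spectral[OF y] by metis
    have qi: "invertible q" using q by (rule invertible_orthogonal)
    have "matrix_inv q = transpose q" using q by (intro matrix_inv_eqI) (simp add: orthogonal_matrix_def)
    then have i: "matrix_inv y = fr q (\<lambda>i. 1 / m i)"
      using fr_inv[OF qi, of m] m e by (metis less_irrefl transpose_transpose)
    obtain K p b c where H: "frp q K p b c" using fr'[OF qi] by blast
    have K: "R (fr q m) = c + (\<Sum>i\<in>UNIV. K i * ln (m i))" if "\<forall>j. m j > 0" for m using H that unfolding frp_def by blast
    show ?thesis
      using K[OF m] K[of "\<lambda>_. 1"] K[of "\<lambda>i. 1 / m i", unfolded ln_recip[OF m]] m
      by (simp add: i[unfolded e] e fr_orthogonal_one[OF q] sum_negf)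
  qed
  \<comment> \<open>With x = fr g 1 and y^-1 = fr g n, the product x y x is fr g (1 / n), the
    geodesic reflection of y^-1 at x. R is affine in the logarithms of the coordinates, so it
    respects reflections; \<open>Rinv\<close> then replaces y^-1 by y.\<close>
  have Rrefl: "R (x ** y ** x) = 2 * R x + R y - 2 * R ?I" if x: "x \<in> pd_mats" and y: "y \<in> pd_mats" for x y
  proof -
    obtain g n where g: "invertible g" and n: "\<forall>i. n i > 0" and e: "x = fr g (\<lambda>_. 1)" "matrix_inv y = fr g n"
      using simultaneous_diagonalization[OF x pd_inv[OF y]] by metis
    define gi where "gi = matrix_inv g"
    have G: "g ** gi = mat 1" "gi ** g = mat 1" using g by (simp_all add: gi_def matrix_inv_both)
    then have Gt: "transpose g ** transpose gi = mat 1" by (metis matrix_transpose_mul transpose_mat)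
    have "y = matrix_inv (fr g n)" using e(2) matrix_inv_matrix_inv[OF pd_invertible[OF y]] by simp
    then have yy: "y = transpose gi ** diagm (\<lambda>i. 1 / n i) ** gi"
      using fr_inv[OF g, of n] n by (simp add: fr_def gi_def less_imp_neq[symmetric])
    have "x ** y ** x = g ** (transpose g ** transpose gi) ** diagm (\<lambda>i. 1 / n i) ** (gi ** g) ** transpose g"
      unfolding yy e(1) by (simp add: fr_def diagm_one matrix_mul_assoc)
    then have xyx: "x ** y ** x = fr g (\<lambda>i. 1 / n i)" by (simp add: G Gt fr_def)
    obtain K p b c where H: "frp g K p b c" using fr'[OF g] by blast
    have K: "R (fr g m) = c + (\<Sum>i\<in>UNIV. K i * ln (m i))" if "\<forall>j. m j > 0" for m using H that unfolding frp_def by blast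
    have "R (x ** y ** x) = 2 * R x - R (matrix_inv y)"
      using K[OF n] K[of "\<lambda>_. 1"] K[of "\<lambda>i. 1 / n i", unfolded ln_recip[OF n]] n by (simp add: xyx[unfolded e(1)] e sum_negf)
    then show ?thesis using Rinv[OF y] by simp
  qed
  obtain D where D: "\<And>h. transpose h = h \<Longrightarrow> ((\<lambda>\<tau>. R (?I + \<tau> *\<^sub>R h)) has_real_derivative D h) (at 0)"
    "\<And>u v. norm u = 1 \<Longrightarrow> norm v = 1 \<Longrightarrow> u \<bullet> v = 0 \<Longrightarrow> D (outer u u) = D (outer v v)"
    using derivative_at_one_isotropic[of R, OF diffR Rrefl] by metis
  define r where "r = real CARD('n)"
  have r: "r > 0" by (simp add: r_def)
  have Rform: "R x = R ?I + kap ?I / r * ln (det x)" if x: "x \<in> pd_mats" for x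
  proof -
    obtain q m where q: "orthogonal_matrix q" and m: "\<forall>i. m i > 0" and e: "x = fr q m"
      using pd_spectral[OF x] by metis
    have qi: "invertible q" using q by (rule invertible_orthogonal)
    obtain K p b c where H: "frp q K p b c" using fr'[OF qi] by blast
    have K: "R (fr q m) = c + (\<Sum>i\<in>UNIV. K i * ln (m i))" if "\<forall>j. m j > 0" for m using H that unfolding frp_def by blast
    have Ks: "kap (fr q m) = (\<Sum>i\<in>UNIV. K i)" if "\<forall>j. m j > 0" for m using H that unfolding frp_def by blast
    \<comment> \<open>K i is the derivative of R at the identity in the direction of the i-th
      eigenprojection. Isotropy makes all of these equal, and their sum is the constant
      \<open>kap\<close>.\<close>
    have KD: "K i = D (outer (column i q) (column i q))" for i
    proof -
      have up: "?I + \<tau> *\<^sub>R outer (column i q) (column i q) = fr q ((\<lambda>_. 1)(i := 1 + \<tau>))" for \<tau>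
      proof -
        have "(\<lambda>_. 1::real)(i := 1 + \<tau>) = (\<lambda>j. 1 + \<tau> * (if j = i then 1 else 0))" by auto
        then show ?thesis
          unfolding fr_delta[symmetric] fr_scaleR fr_orthogonal_one[OF q, symmetric] fr_add by simp
      qed
      have val: "R (?I + \<tau> *\<^sub>R outer (column i q) (column i q)) = c + K i * ln (1 + \<tau>)" if "\<bar>\<tau>\<bar> < 1" for \<tau>
      proof -
        have "\<forall>j. ((\<lambda>_. 1)(i := 1 + \<tau>)) j > 0" using that by auto
        from K[OF this] have "R (?I + \<tau> *\<^sub>R outer (column i q) (column i q))
           = c + (\<Sum>j\<in>UNIV. K j * ln (((\<lambda>_. 1)(i := 1 + \<tau>)) j))" by (simp only: up)
        also have "(\<Sum>j\<in>UNIV. K j * ln (((\<lambda>_. 1)(i := 1 + \<tau>)) j)) = (\<Sum>j\<in>UNIV. if j = i then K i * ln (1 + \<tau>) else 0)"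
          by (intro sum.cong) auto
        finally show ?thesis by simp
      qed
      have "((\<lambda>\<tau>. c + K i * ln (1 + \<tau>)) has_real_derivative K i) (at 0)"
        by (auto intro!: derivative_eq_intros)
      then have "((\<lambda>\<tau>. R (?I + \<tau> *\<^sub>R outer (column i q) (column i q))) has_real_derivative K i) (at 0)"
        by (rule has_field_derivative_transform_within_open[where S = "{-1<..<1}"]) (auto simp: val)
      moreover have "((\<lambda>\<tau>. R (?I + \<tau> *\<^sub>R outer (column i q) (column i q))) has_real_derivative
          D (outer (column i q) (column i q))) (at 0)"
        by (rule D(1)) (simp add: transpose_outer)
      ultimately show ?thesis by (rule DERIV_unique)
    qed
    have "K i = K j" for i j
    proof (cases "i = j")
      case False
      have "norm (column i q) = 1" "norm (column j q) = 1" "column i q \<bullet> column j q = 0"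
        using q False unfolding orthogonal_matrix_orthonormal_columns by (auto simp: orthogonal_def)
      then show ?thesis unfolding KD by (rule D(2))
    qed simp
    then obtain K0 where K0: "\<And>i. K i = K0" by metis
    have "kap ?I = r * K0" using Ks[OF m] kapc[OF x] by (simp add: K0 r_def e)
    then have K0': "K0 = kap ?I / r" using r by simp
    have "R x = R ?I + (\<Sum>i\<in>UNIV. K0 * ln (m i))"
      using K[OF m] K[of "\<lambda>_. 1"] by (simp add: e fr_orthogonal_one[OF q] K0)
    also have "(\<Sum>i\<in>UNIV. K0 * ln (m i)) = K0 * ln (det x)"
      using ln_det_fr[OF qi m] det_orthogonal_square[OF q] by (simp add: e sum_distrib_left)
    finally show ?thesis by (simp add: K0')
  qed
  show thesis
  proof (rule that[of "(1 / \<alpha>) *\<^sub>R a'" b "kap ?I / r" "R ?I"])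
    show "transpose ((1 / \<alpha>) *\<^sub>R a') = (1 / \<alpha>) *\<^sub>R a'" by (simp add: transpose_scalar a'(1))
    show "transpose b = b" by (rule b(1))
    fix x :: "real^'n^'n" assume x: "x \<in> pd_mats"
    have "Q x = inner_tr b (matrix_inv x)"
      using b(2)[OF pd_inv[OF x]] by (simp add: Qi_def matrix_inv_matrix_inv pd_invertible[OF x])
    moreover have "\<alpha> * inner_tr ((1 / \<alpha>) *\<^sub>R a') x = P x"
      using x ab(1) by (simp add: a'(2) inner_tr_eq_inner pd_sym)
    ultimately show "A x = kap ?I / r * ln (det x) - \<alpha> * inner_tr ((1 / \<alpha>) *\<^sub>R a') x - inner_tr b (matrix_inv x) + R ?I"
      using AR[OF x] Rform[OF x] by simp
  qed
qed

text \<open>The formula for A identifies the line coefficients of A in each frame, and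
  \<open>frame_coefficients\<close> passes them on to B. This determines B up to a constant per
  frame; the constants agree because each y^-1 shares a frame with the identity.\<close>

theorem solution:
  obtains \<kappa> a b cA cB where "transpose a = a" "transpose b = b"
    "\<And>x. x \<in> pd_mats \<Longrightarrow> A x = \<kappa> * ln (det x) - \<alpha> * inner_tr a x - inner_tr b (matrix_inv x) + cA"
    "\<And>y. y \<in> pd_mats \<Longrightarrow> B y = \<kappa> * ln (det y) - \<beta> * inner_tr b y - inner_tr a (matrix_inv y) + cB"
proof -
  obtain \<kappa> a b c where sym: "transpose a = a" "transpose b = b"
    and A: "\<And>x. x \<in> pd_mats \<Longrightarrow> A x = \<kappa> * ln (det x) - \<alpha> * inner_tr a x - inner_tr b (matrix_inv x) + c"
    by (rule A_form) blast
  define B' where "B' y = B y - (\<kappa> * ln (det y) - \<beta> * inner_tr b y - inner_tr a (matrix_inv y))" for y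
  have frame: "\<exists>d. \<forall>n. (\<forall>j. n j > 0) \<longrightarrow> B' (matrix_inv (fr g n)) = d" if g: "invertible g" for g
  proof -
    define h where "h = transpose (matrix_inv g)"
    have h: "invertible h" unfolding h_def using g by (simp add: invertible_matrix_inv transpose_invertible)
    define qa where "qa i = (transpose g ** a ** g) $ i $ i" for i
    define qb where "qb i = (transpose h ** b ** h) $ i $ i" for i
    have inv: "matrix_inv (fr g m) = fr h (\<lambda>i. 1 / m i)" if "\<forall>j. m j > 0" for m
      unfolding h_def using that by (intro fr_inv g) (metis less_irrefl)
    have expl: "A (fr g m) = \<kappa> * ln ((det g)\<^sup>2) + c + (\<Sum>i\<in>UNIV. \<kappa> * ln (m i) - \<alpha> * qa i * m i - qb i / m i)"
      if m: "\<forall>j. m j > 0" for m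
    proof -
      have "fr g m \<in> pd_mats" using fr_pd[OF g] m by blast
      from A[OF this] show ?thesis
        by (simp add: ln_det_fr[OF g m] inv[OF m] inner_tr_fr qa_def[symmetric] qb_def[symmetric]
            sum_subtractf sum.distrib sum_distrib_left algebra_simps)
    qed
    have lf: "line_form (\<lambda>m. A (fr g m)) \<kappa> (- \<alpha> * qa i) (qb i) i (\<lambda>_. 1)" for i
      unfolding line_form_def
    proof (intro allI impI)
      fix t :: real assume t: "t > 0"
      define d where "d = \<kappa> * ln ((det g)\<^sup>2) + c + (\<Sum>j\<in>UNIV - {i}. - \<alpha> * qa j - qb j)"
      have v: "A (fr g ((\<lambda>_. 1)(i := s))) = d + (\<kappa> * ln s - \<alpha> * qa i * s - qb i / s)" if s: "s > 0" for s
      proof -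
        have "\<forall>j. ((\<lambda>_. 1)(i := s)) j > 0" using s by auto
        from expl[OF this] show ?thesis
          by (subst (asm) sum.remove[where x = i]) (auto simp: d_def)
      qed
      have "((\<lambda>s. d + (\<kappa> * ln s - \<alpha> * qa i * s - qb i / s)) has_real_derivative (\<kappa> / t + - \<alpha> * qa i + qb i / t\<^sup>2)) (at t)"
        using t by (auto intro!: derivative_eq_intros simp: power2_eq_square field_simps)
      then show "((\<lambda>s. A (fr g ((\<lambda>_. 1)(i := s)))) has_real_derivative (\<kappa> / t + - \<alpha> * qa i + qb i / t\<^sup>2)) (at t)"
        by (rule has_field_derivative_transform_within_open[where S = "{0<..}"]) (use t v in auto)
    qed
    have lfB: "line_form (\<lambda>n. B (matrix_inv (fr g n))) (- \<kappa>) (- qa i) (\<beta> * qb i) i n" if n: "\<forall>j. n j > 0" for i n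
    proof -
      obtain \<kappa>1 a1 b1 where 1: "\<And>m. (\<forall>j. m j > 0) \<Longrightarrow> line_form (\<lambda>m. A (fr g m)) \<kappa>1 (- \<alpha> * a1) b1 i m
         \<and> line_form (\<lambda>n. B (matrix_inv (fr g n))) (- \<kappa>1) (- a1) (\<beta> * b1) i m"
        using frame_coefficients[OF g] by blast
      from 1[of "\<lambda>_. 1"] have "line_form (\<lambda>m. A (fr g m)) \<kappa>1 (- \<alpha> * a1) b1 i (\<lambda>_. 1)" by simp
      from line_form_unique[OF this lf] have "\<kappa>1 = \<kappa>" "a1 = qa i" "b1 = qb i" using ab(1) by auto
      with 1[OF n] show ?thesis by simp
    qed
    obtain d where d: "\<And>n. (\<forall>j. n j > 0) \<Longrightarrow>
       B (matrix_inv (fr g n)) = d + (\<Sum>i\<in>UNIV. - \<kappa> * ln (n i) + - qa i * n i - \<beta> * qb i / n i)"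
      using separable_from_line_forms[of "\<lambda>n. B (matrix_inv (fr g n))", OF lfB] by blast
    have "B' (matrix_inv (fr g n)) = d - \<kappa> * ln ((det h)\<^sup>2)" if n: "\<forall>j. n j > 0" for n
    proof -
      have p: "fr g n \<in> pd_mats" using fr_pd[OF g] n by blast
      have n': "\<forall>j. 1 / n j > 0" using n by simp
      have e1: "ln (det (matrix_inv (fr g n))) = ln ((det h)\<^sup>2) - (\<Sum>i\<in>UNIV. ln (n i))"
        unfolding inv[OF n] ln_det_fr[OF h n'] ln_recip[OF n] by (simp add: sum_negf)
      have e2: "inner_tr b (matrix_inv (fr g n)) = (\<Sum>i\<in>UNIV. qb i / n i)"
        unfolding inv[OF n] inner_tr_fr qb_def by simp
      have e3: "inner_tr a (matrix_inv (matrix_inv (fr g n))) = (\<Sum>i\<in>UNIV. qa i * n i)"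
        using matrix_inv_matrix_inv[OF pd_invertible[OF p]] by (simp add: inner_tr_fr qa_def mult.commute)
      show ?thesis
        unfolding B'_def e1 e2 e3 d[OF n]
        by (simp add: sum.distrib sum_subtractf sum_distrib_left sum_negf right_diff_distrib)
    qed
    then show ?thesis by blast
  qed
  have const: "B' y = B' (mat 1)" if y: "y \<in> pd_mats" for y
  proof -
    obtain g m where g: "invertible g" and m: "\<forall>i. m i > 0" and e: "mat 1 = fr g (\<lambda>_. 1)" "matrix_inv y = fr g m"
      using simultaneous_diagonalization[OF one_pd pd_inv[OF y]] by metis
    obtain d where d: "\<And>n. (\<forall>j. n j > 0) \<Longrightarrow> B' (matrix_inv (fr g n)) = d" using frame[OF g] by blast
    have "y = matrix_inv (fr g m)" using e(2) matrix_inv_matrix_inv[OF pd_invertible[OF y]] by simp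
    moreover have "mat 1 = matrix_inv (fr g (\<lambda>_. 1))"
      unfolding e(1)[symmetric] by (rule matrix_inv_eqI(1)[symmetric]) simp
    ultimately show ?thesis using d[OF m] d[of "\<lambda>_. 1"] by simp
  qed
  have "B y = \<kappa> * ln (det y) - \<beta> * inner_tr b y - inner_tr a (matrix_inv y) + B' (mat 1)"
    if "y \<in> pd_mats" for y
    using const[OF that] unfolding B'_def[of y] by linarith
  with sym A show thesis using that[of a b \<kappa> c "B' (mat 1)"] by presburger
qed

end

section \<open>Lebesgue measure on symmetric matrices\<close>

text \<open>The equivalence behind it speaks of finite values: finiteness of either side implies the
  equality, so otherwise both sides are infinite. The Borel function J represents the Jacobian on
  S.\<close>

lemma emeasure_differentiable_image:
  fixes f :: "real^'m::{finite,wellorder} \<Rightarrow> real^'m::_"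
  assumes S: "S \<in> sets borel" "f ` S \<in> sets borel"
    and der: "\<And>x. x \<in> S \<Longrightarrow> (f has_derivative f' x) (at x within S)" and inj: "inj_on f S"
    and J: "J \<in> borel_measurable borel" "\<And>x. x \<in> S \<Longrightarrow> J x = \<bar>det (matrix (f' x))\<bar>"
  shows "emeasure lborel (f ` S) = (\<integral>\<^sup>+x. ennreal (J x) * indicator S x \<partial>lborel)"
proof -
  have SL: "S \<in> sets lebesgue" using S(1) by simp
  define h where "h x = (if x \<in> S then J x else 0)" for x
  have h: "h \<in> borel_measurable borel" "\<And>x. 0 \<le> h x"
    unfolding h_def using J S by (auto intro!: measurable_If_set)
  have hi: "(h has_integral r) UNIV \<longleftrightarrow> ((\<lambda>x. \<bar>det (matrix (f' x))\<bar>) has_integral r) S" for r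
    unfolding h_def has_integral_restrict_UNIV using J(2) by (intro has_integral_cong) auto
  have nn: "(\<integral>\<^sup>+x. ennreal (J x) * indicator S x \<partial>lborel) = (\<integral>\<^sup>+x. ennreal (h x) \<partial>lborel)"
    by (intro nn_integral_cong) (auto simp: h_def indicator_def)
  note eqv = has_measure_differentiable_image[OF SL der inj]
  show ?thesis
  proof (cases "(\<integral>\<^sup>+x. ennreal (h x) \<partial>lborel) < \<infinity>")
    case True
    then obtain r where r: "(\<integral>\<^sup>+x. ennreal (h x) \<partial>lborel) = ennreal r" "0 \<le> r"
      by (cases "\<integral>\<^sup>+x. ennreal (h x) \<partial>lborel" rule: ennreal_cases) auto
    have "(h has_integral r) UNIV" by (rule nn_integral_has_integral[OF h r])
    then have "f ` S \<in> lmeasurable \<and> measure lebesgue (f ` S) = r" using eqv hi by blast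
    then have "emeasure lebesgue (f ` S) = ennreal r"
      by (auto simp: emeasure_eq_measure2)
    then show ?thesis using nn r S by simp
  next
    case False
    have "emeasure lborel (f ` S) = \<infinity>"
    proof (rule ccontr)
      assume "emeasure lborel (f ` S) \<noteq> \<infinity>"
      then have "f ` S \<in> lmeasurable" using S(2) by (intro fmeasurableI) (auto simp: top.not_eq_extremum)
      then have "(h has_integral (measure lebesgue (f ` S))) UNIV" using eqv hi by blast
      then have "integral\<^sup>N lborel h = ennreal (measure lebesgue (f ` S))"
        using nn_integral_has_integral_lborel[OF h] by blast
      then show False using False by simp
    qed
    then show ?thesis using False nn by (metis infinity_ennreal_def top.not_eq_extremum)
  qed
qed

text \<open>Both sides integrate F against a measure. On a Borel set B the two measures agree by the
  volume formula for the part of S that f maps into B.\<close>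

lemma nn_integral_change_of_variables:
  fixes f :: "real^'m::{finite,wellorder} \<Rightarrow> real^'m::_"
  assumes S: "S \<in> sets borel" "f ` S \<in> sets borel" and f: "f \<in> borel_measurable borel"
    and der: "\<And>x. x \<in> S \<Longrightarrow> (f has_derivative f' x) (at x within S)" and inj: "inj_on f S"
    and J: "J \<in> borel_measurable borel" "\<And>x. x \<in> S \<Longrightarrow> J x = \<bar>det (matrix (f' x))\<bar>"
    and F: "F \<in> borel_measurable borel"
  shows "(\<integral>\<^sup>+x. F x * indicator (f ` S) x \<partial>lborel) = (\<integral>\<^sup>+x. F (f x) * ennreal (J x) * indicator S x \<partial>lborel)"
proof -
  note [measurable] = S f J(1) F
  let ?M1 = "density lborel (indicator (f ` S))"
  let ?D = "density lborel (\<lambda>x. ennreal (J x) * indicator S x)"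
  let ?M2 = "distr ?D borel f"
  have "?M1 = ?M2"
  proof (rule measure_eqI)
    show "sets ?M1 = sets ?M2" by simp
    fix B assume "B \<in> sets ?M1"
    then have B[measurable]: "B \<in> sets borel" by simp
    let ?T = "S \<inter> f -` B"
    have T: "?T \<in> sets borel"
      using measurable_sets[OF f B] S(1) by (simp add: sets.Int)
    have fT: "f ` ?T = f ` S \<inter> B" by auto
    have "emeasure ?M2 B = emeasure ?D (f -` B)"
      by (subst emeasure_distr) auto
    also have "\<dots> = (\<integral>\<^sup>+x. ennreal (J x) * indicator S x * indicator (f -` B) x \<partial>lborel)"
      using measurable_sets[OF f B] by (subst emeasure_density) auto
    also have "\<dots> = (\<integral>\<^sup>+x. ennreal (J x) * indicator ?T x \<partial>lborel)"
      by (intro nn_integral_cong) (auto simp: indicator_def)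
    also have "\<dots> = emeasure lborel (f ` ?T)"
    proof (rule emeasure_differentiable_image[symmetric])
      show "?T \<in> sets borel" by (rule T)
      show "f ` ?T \<in> sets borel" unfolding fT by measurable
      show "(f has_derivative f' x) (at x within ?T)" if "x \<in> ?T" for x
        using der[of x] that by (auto intro: has_derivative_subset)
      show "inj_on f ?T" using inj by (rule inj_on_subset) auto
    qed (use J in auto)
    also have "\<dots> = emeasure ?M1 B"
      unfolding fT by (subst emeasure_density) (auto simp: nn_integral_indicator[symmetric] indicator_inter_arith)
    finally show "emeasure ?M1 B = emeasure ?M2 B" by simp
  qed
  then have "integral\<^sup>N ?M1 F = integral\<^sup>N ?M2 F" by simp
  moreover have "integral\<^sup>N ?M1 F = (\<integral>\<^sup>+x. F x * indicator (f ` S) x \<partial>lborel)"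
    by (subst nn_integral_density) (auto simp: mult.commute)
  moreover have "integral\<^sup>N ?M2 F = (\<integral>\<^sup>+x. F (f x) * ennreal (J x) * indicator S x \<partial>lborel)"
    by (subst nn_integral_distr) (auto simp: nn_integral_density mult_ac)
  ultimately show ?thesis by simp
qed

text \<open>The change of variables theorem is available for Cartesian spaces with a well-ordered index type, so the upper triangular
  index pairs are turned into such a type.\<close>

typedef (overloaded) 'n upt = "{p :: 'n::{finite,linorder} \<times> 'n. fst p \<le> snd p}"
  morphisms of_upt to_upt
  by (rule exI[of _ "(undefined, undefined)"]) simp

lemma of_upt_le: "fst (of_upt p) \<le> snd (of_upt p)"
  using of_upt[of p] by simp

instance upt :: ("{finite,linorder}") finite
proof
  have "(UNIV :: 'a upt set) = to_upt ` {p. fst p \<le> snd p}"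
    using type_definition.Abs_image[OF type_definition_upt] by (rule sym)
  moreover have "finite (to_upt ` {p :: 'a \<times> 'a. fst p \<le> snd p})" by simp
  ultimately show "finite (UNIV :: 'a upt set)" by (simp only:)
qed

instantiation upt :: ("{finite,linorder}") linorder
begin
definition less_eq_upt :: "'a upt \<Rightarrow> 'a upt \<Rightarrow> bool" where
  "less_eq_upt p q \<longleftrightarrow> fst (of_upt p) < fst (of_upt q)
     \<or> fst (of_upt p) = fst (of_upt q) \<and> snd (of_upt p) \<le> snd (of_upt q)"
definition less_upt :: "'a upt \<Rightarrow> 'a upt \<Rightarrow> bool" where
  "less_upt p q \<longleftrightarrow> p \<le> q \<and> \<not> q \<le> p"
instance
  by standard (auto simp: less_eq_upt_def less_upt_def of_upt_inject[symmetric] prod_eq_iff)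
end

instance upt :: ("{finite,linorder}") wellorder
proof
  fix P :: "'a upt \<Rightarrow> bool" and a
  assume step: "\<And>x. (\<And>y. y < x \<Longrightarrow> P y) \<Longrightarrow> P x"
  have "wf {(x, y :: 'a upt). x < y}"
  proof (rule finite_acyclic_wf)
    show "finite {(x, y :: 'a upt). x < y}" by (rule finite_subset[OF subset_UNIV]) simp
    show "acyclic {(x, y :: 'a upt). x < y}"
      unfolding acyclic_def by (subst trancl_id) (auto simp: trans_def)
  qed
  then show "P a" by (rule wf_induct_rule) (use step in auto)
qed

definition symu :: "(real, 'n upt) vec \<Rightarrow> ((real, 'n::{finite,linorder}) vec, 'n) vec" where
  "symu v = (\<chi> i j. v $ to_upt (if i \<le> j then (i, j) else (j, i)))"

definition unsym :: "((real, 'n::{finite,linorder}) vec, 'n) vec \<Rightarrow> (real, 'n upt) vec" where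
  "unsym M = (\<chi> p. M $ fst (of_upt p) $ snd (of_upt p))"

lemma unsym_symu: "unsym (symu v) = v"
  by (simp add: unsym_def symu_def vec_eq_iff of_upt_le of_upt_inverse)

lemma transpose_symu: "transpose (symu v) = symu v"
  by (auto simp: symu_def transpose_def vec_eq_iff)

lemma symu_unsym:
  assumes "transpose M = M"
  shows "symu (unsym M) = M"
proof -
  have "M $ j $ i = M $ i $ j" for i j
    using assms by (metis transpose_def vec_lambda_beta)
  then show ?thesis
    by (auto simp: unsym_def symu_def vec_eq_iff to_upt_inverse)
qed

lemma linear_symu: "linear symu"
  by (rule linearI) (auto simp: symu_def vec_eq_iff)

lemma linear_unsym: "linear unsym"
  by (rule linearI) (auto simp: unsym_def vec_eq_iff)

lemma symu_measurable[measurable]: "symu \<in> borel_measurable borel"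
  using linear_symu by (intro borel_measurable_continuous_onI linear_continuous_on) (simp add: linear_conv_bounded_linear)

lemma unsym_measurable[measurable]: "unsym \<in> borel_measurable borel"
  using linear_unsym by (intro borel_measurable_continuous_onI linear_continuous_on) (simp add: linear_conv_bounded_linear)


lemma prod_Basis_cart: "(\<Prod>b\<in>Basis. (x :: real^'m) \<bullet> b) = (\<Prod>p\<in>UNIV. x $ p)"
proof -
  have "(Basis :: (real^'m) set) = range (\<lambda>p. axis p 1)"
    by (auto simp: Basis_vec_def)
  then have "(\<Prod>b\<in>Basis. x \<bullet> b) = (\<Prod>b\<in>range (\<lambda>p. axis p 1). x \<bullet> b)" by simp
  also have "\<dots> = (\<Prod>p\<in>UNIV. x \<bullet> axis p 1)"
    by (subst prod.reindex) (auto simp: inj_on_def axis_eq_axis)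
  finally show ?thesis by (simp add: inner_axis)
qed

text \<open>A product over a set of pairs and Lebesgue measure over an index type are compared on
  boxes, which determine the latter.\<close>

lemma lborel_upt:
  "distr (Pi\<^sub>M {p. fst p \<le> snd p} (\<lambda>_. lborel)) borel (\<lambda>f. \<chi> p :: 'n::{finite,linorder} upt. (f (of_upt p) :: real)) = lborel"
proof (rule lborel_eqI[symmetric])
  let ?U = "{p :: 'n \<times> 'n. fst p \<le> snd p}"
  let ?m = "\<lambda>f. \<chi> p :: 'n upt. (f (of_upt p) :: real)"
  interpret product_sigma_finite "\<lambda>_ :: 'n \<times> 'n. lborel :: real measure" ..
  have U: "finite ?U" by simp
  have meas[measurable]: "?m \<in> borel_measurable (Pi\<^sub>M ?U (\<lambda>_. lborel))"
  proof (rule iffD2[OF borel_measurable_euclidean_space], rule ballI)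
    fix b :: "real^('n upt)" assume "b \<in> Basis"
    then obtain p where b: "b = axis p 1" by (auto simp: Basis_vec_def)
    show "(\<lambda>x. ?m x \<bullet> b) \<in> borel_measurable (Pi\<^sub>M ?U (\<lambda>_. lborel))"
      using measurable_component_singleton[of "of_upt p" ?U "\<lambda>_. lborel"] by (simp add: b inner_axis of_upt_le)
  qed
  show "sets (distr (Pi\<^sub>M ?U (\<lambda>_. lborel)) borel ?m) = sets borel" by simp
  fix l u :: "real^('n upt)" assume le: "\<And>b. b \<in> Basis \<Longrightarrow> l \<bullet> b \<le> u \<bullet> b"
  have le': "l $ p \<le> u $ p" for p using le[of "axis p 1"] by (simp add: inner_axis axis_in_Basis_iff)
  have "?m -` box l u \<inter> space (Pi\<^sub>M ?U (\<lambda>_. lborel)) = (\<Pi>\<^sub>E p\<in>?U. {l $ to_upt p <..< u $ to_upt p})"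
  proof (intro set_eqI iffI)
    fix f assume "f \<in> ?m -` box l u \<inter> space (Pi\<^sub>M ?U (\<lambda>_. lborel))"
    then have f: "f \<in> extensional ?U" and b: "\<And>q. l $ q < f (of_upt q) \<and> f (of_upt q) < u $ q"
      by (auto simp: space_PiM PiE_def mem_box_cart)
    show "f \<in> (\<Pi>\<^sub>E p\<in>?U. {l $ to_upt p <..< u $ to_upt p})"
    proof (rule PiE_I)
      fix p assume "p \<in> ?U"
      then show "f p \<in> {l $ to_upt p <..< u $ to_upt p}"
        using b[of "to_upt p"] by (simp add: to_upt_inverse)
    qed (use f in \<open>auto simp: extensional_def\<close>)
  next
    fix f assume f: "f \<in> (\<Pi>\<^sub>E p\<in>?U. {l $ to_upt p <..< u $ to_upt p})"
    have "l $ q < f (of_upt q) \<and> f (of_upt q) < u $ q" for q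
      using PiE_mem[OF f, of "of_upt q"] by (simp add: of_upt_le of_upt_inverse)
    then show "f \<in> ?m -` box l u \<inter> space (Pi\<^sub>M ?U (\<lambda>_. lborel))"
      using f by (auto simp: space_PiM PiE_def mem_box_cart)
  qed
  then have "emeasure (distr (Pi\<^sub>M ?U (\<lambda>_. lborel)) borel ?m) (box l u)
      = emeasure (Pi\<^sub>M ?U (\<lambda>_. lborel)) (\<Pi>\<^sub>E p\<in>?U. {l $ to_upt p <..< u $ to_upt p})"
    by (subst emeasure_distr) (auto simp: meas)
  also have "\<dots> = (\<Prod>p\<in>?U. emeasure lborel {l $ to_upt p <..< u $ to_upt p})"
    by (rule emeasure_PiM[OF U]) simp
  also have "\<dots> = (\<Prod>p\<in>?U. ennreal ((u - l) $ to_upt p))"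
    by (intro prod.cong) (auto simp: le')
  also have "\<dots> = ennreal (\<Prod>p\<in>?U. (u - l) $ to_upt p)"
    by (intro prod_ennreal) (simp add: le')
  also have "(\<Prod>p\<in>?U. (u - l) $ to_upt p) = (\<Prod>q\<in>UNIV. (u - l) $ q)"
    by (rule prod.reindex_bij_witness[where i = of_upt and j = to_upt])
       (auto simp: to_upt_inverse of_upt_inverse of_upt_le)
  also have "\<dots> = (\<Prod>b\<in>Basis. (u - l) \<bullet> b)" by (rule prod_Basis_cart[symmetric])
  finally show "emeasure (distr (Pi\<^sub>M ?U (\<lambda>_. lborel)) borel ?m) (box l u) = ennreal (\<Prod>b\<in>Basis. (u - l) \<bullet> b)" .
qed

lemma leb_sym_eq: "leb_sym = distr lborel borel (symu :: _ \<Rightarrow> ((real, 'n::{finite,linorder}) vec, 'n) vec)"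
proof -
  let ?U = "{p :: 'n \<times> 'n. fst p \<le> snd p}"
  let ?m = "\<lambda>f. \<chi> p :: 'n upt. (f (of_upt p) :: real)"
  have meas: "?m \<in> borel_measurable (Pi\<^sub>M ?U (\<lambda>_. lborel))"
  proof (rule iffD2[OF borel_measurable_euclidean_space], rule ballI)
    fix b :: "real^('n upt)" assume "b \<in> Basis"
    then obtain p where b: "b = axis p 1" by (auto simp: Basis_vec_def)
    show "(\<lambda>x. ?m x \<bullet> b) \<in> borel_measurable (Pi\<^sub>M ?U (\<lambda>_. lborel))"
      using measurable_component_singleton[of "of_upt p" ?U "\<lambda>_. lborel"] by (simp add: b inner_axis of_upt_le)
  qed
  have "symu (?m f) = sym_of_fun f" for f
    by (simp add: symu_def sym_of_fun_def vec_eq_iff to_upt_inverse)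
  then have "distr (distr (Pi\<^sub>M ?U (\<lambda>_. lborel)) borel ?m) borel symu = leb_sym"
    using distr_distr[OF symu_measurable meas] by (simp add: leb_sym_def o_def)
  then show ?thesis unfolding lborel_upt by (rule sym)
qed

lemma sets_leb_sym[measurable_cong, simp]: "sets leb_sym = sets borel"
  by (simp add: leb_sym_def)

lemma space_leb_sym[simp]: "space leb_sym = UNIV"
  by (simp add: leb_sym_def)

lemma nn_integral_leb_sym:
  "F \<in> borel_measurable borel \<Longrightarrow> integral\<^sup>N leb_sym F = (\<integral>\<^sup>+v. F (symu v) \<partial>lborel)"
  by (simp add: leb_sym_eq nn_integral_distr)

section \<open>Continuity, measurability and derivatives of the matrix operations\<close>

lemma bounded_bilinear_matrix_mult: "bounded_bilinear ((**) :: real^'n^'n \<Rightarrow> real^'n^'n \<Rightarrow> real^'n^'n)"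
  unfolding bilinear_conv_bounded_bilinear[symmetric] bilinear_def
  by (auto intro!: linearI simp: matrix_add_ldistrib matrix_add_mult_distrib matrix_scaleR_left matrix_scaleR_right)

lemma continuous_on_matrix_mult[continuous_intros]:
  fixes f g :: "'a::topological_space \<Rightarrow> real^'n^'n"
  shows "continuous_on S f \<Longrightarrow> continuous_on S g \<Longrightarrow> continuous_on S (\<lambda>x. f x ** g x)"
  by (rule bounded_bilinear.continuous_on[OF bounded_bilinear_matrix_mult])

lemma measurable_matrix_mult[measurable]:
  fixes f g :: "'a \<Rightarrow> real^'n^'n"
  assumes "f \<in> borel_measurable M" "g \<in> borel_measurable M"
  shows "(\<lambda>x. f x ** g x) \<in> borel_measurable M"
  by (rule borel_measurable_continuous_Pair[OF assms]) (intro continuous_intros)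

lemma continuous_on_det[continuous_intros]:
  fixes f :: "'a::topological_space \<Rightarrow> real^'n^'n"
  shows "continuous_on S f \<Longrightarrow> continuous_on S (\<lambda>x. det (f x))"
  unfolding det_def by (intro continuous_intros)

lemma measurable_det[measurable]:
  "f \<in> borel_measurable M \<Longrightarrow> (\<lambda>x. det (f x :: real^'n^'n)) \<in> borel_measurable M"
  by (rule borel_measurable_continuous_on[where f = det]) (intro continuous_intros)

text \<open>Cramer's rule for the columns of the inverse; its rational entries yield continuity of
  the inversion.\<close>

lemma matrix_inv_cramer:
  fixes A :: "real^'n^'n"
  assumes "det A \<noteq> 0"
  shows "matrix_inv A = (\<chi> k j. det (\<chi> i l. if l = k then (if i = j then 1 else 0) else A $ i $ l) / det A)"
proof -
  have inv: "invertible A" using assms by (simp add: invertible_det_nz)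
  have "matrix_inv A $ k $ j = det (\<chi> i l. if l = k then (if i = j then 1 else 0) else A $ i $ l) / det A" for k j
  proof -
    have "A *v (matrix_inv A *v axis j 1) = axis j 1"
      by (simp add: matrix_vector_mul_assoc matrix_inv_both[OF inv])
    then have "matrix_inv A *v axis j 1 = (\<chi> k. det (\<chi> i l. if l = k then axis j 1 $ i else A $ i $ l) / det A)"
      using cramer[OF assms] by blast
    moreover have "(matrix_inv A *v axis j 1) $ k = matrix_inv A $ k $ j"
      by (simp add: matrix_vector_mult_def axis_def if_distrib cong: if_cong)
    ultimately show ?thesis by (simp add: axis_def if_distrib cong: if_cong)
  qed
  then show ?thesis by (simp add: vec_eq_iff)
qed

lemma continuous_on_matrix_inv: "continuous_on {A :: real^'n^'n. det A \<noteq> 0} matrix_inv"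
proof -
  have "continuous_on {A :: real^'n^'n. det A \<noteq> 0} (\<lambda>A. if l = k then (if i = j then 1 else 0) else A $ i $ l)"
    for i j k l :: 'n
    by (cases "l = k"; cases "i = j") (auto intro!: continuous_intros)
  then have "continuous_on {A :: real^'n^'n. det A \<noteq> 0}
     (\<lambda>A. \<chi> k j. det (\<chi> i l. if l = k then (if i = j then 1 else 0) else A $ i $ l) / det A)"
    by (intro continuous_on_vec_lambda continuous_on_divide continuous_on_det)
       (auto intro!: continuous_on_id)
  then show ?thesis by (rule continuous_on_eq) (simp add: matrix_inv_cramer)
qed

lemma measurable_matrix_inv[measurable]: "matrix_inv \<in> borel_measurable (borel :: (real^'n^'n) measure)"
proof -
  let ?S = "{A :: real^'n^'n. det A \<noteq> 0}"
  \<comment> \<open>For a singular matrix \<open>matrix_inv\<close> chooses from an unsatisfiable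
    predicate, so all singular matrices share this one value.\<close>
  define c where "c = (SOME B :: real^'n^'n. False)"
  have c: "matrix_inv A = c" if "A \<notin> ?S" for A :: "real^'n^'n"
  proof -
    have "\<not> invertible A" using that by (simp add: invertible_det_nz)
    then have "(\<lambda>B. A ** B = mat 1 \<and> B ** A = mat 1) = (\<lambda>B. False)" by (auto simp: invertible_def)
    then show ?thesis by (simp add: matrix_inv_def c_def)
  qed
  have S: "?S \<in> sets borel" by measurable
  have "(\<lambda>A. if A \<in> ?S then matrix_inv A else c) \<in> borel_measurable borel"
    by (rule borel_measurable_continuous_on_if[OF S continuous_on_matrix_inv continuous_on_const])
  moreover have "(\<lambda>A. if A \<in> ?S then matrix_inv A else c) = matrix_inv"
    using c by (intro ext) simp
  ultimately show ?thesis by simp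
qed

text \<open>The remainder is exactly (A^-1 - X^-1) (X - A) A^-1. Its first factor tends to zero by
  continuity of the inversion, so the whole is o(X - A).\<close>

lemma has_derivative_matrix_inv:
  fixes A :: "real^'n^'n"
  assumes "invertible A"
  shows "(matrix_inv has_derivative (\<lambda>h. - (matrix_inv A ** h ** matrix_inv A))) (at A)"
proof -
  interpret mm: bounded_bilinear "(**) :: real^'n^'n \<Rightarrow> real^'n^'n \<Rightarrow> real^'n^'n"
    by (rule bounded_bilinear_matrix_mult)
  have op: "open {A :: real^'n^'n. det A \<noteq> 0}"
    by (rule open_Collect_neq) (intro continuous_intros)+
  have dA: "det A \<noteq> 0" using assms by (simp add: invertible_det_nz)
  have cont: "isCont matrix_inv A"
    using continuous_on_eq_continuous_at[OF op, of matrix_inv] continuous_on_matrix_inv dA by blast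
  obtain K where K: "K > 0" "\<And>(a :: real^'n^'n) (b :: real^'n^'n). norm (a ** b) \<le> norm a * norm b * K"
    using mm.pos_bounded by blast
  let ?L = "\<lambda>h. - (matrix_inv A ** h ** matrix_inv A)"
  have bl: "bounded_linear ?L"
    unfolding linear_conv_bounded_linear[symmetric]
    by (rule linearI) (simp_all add: mm.add_left mm.add_right mm.scaleR_left mm.scaleR_right)
  have rem: "matrix_inv X - matrix_inv A - ?L (X - A)
      = (matrix_inv A - matrix_inv X) ** (X - A) ** matrix_inv A" if "det X \<noteq> 0" for X
  proof -
    have X: "invertible X" using that by (simp add: invertible_det_nz)
    have "matrix_inv X ** (X - A) ** matrix_inv A = matrix_inv A - matrix_inv X"
      by (simp add: mm.diff_left mm.diff_right matrix_inv_both X assms)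
         (simp add: matrix_inv_both assms flip: matrix_mul_assoc)
    then show ?thesis by (simp add: mm.diff_left)
  qed
  show ?thesis
    unfolding has_derivative_iff_norm
  proof (intro conjI bl)
    have ev: "\<forall>\<^sub>F X in at A. det X \<noteq> 0"
      using op dA by (auto simp: eventually_at_topological)
    have lim: "((\<lambda>X. norm (matrix_inv A - matrix_inv X) * K * norm (matrix_inv A) * K) \<longlongrightarrow> 0) (at A)"
    proof -
      have "((\<lambda>X. norm (matrix_inv A - matrix_inv X) * K * norm (matrix_inv A) * K) \<longlongrightarrow>
         norm (matrix_inv A - matrix_inv A) * K * norm (matrix_inv A) * K) (at A)"
        using cont unfolding isCont_def by (intro tendsto_intros)
      then show ?thesis by simp
    qed
    show "((\<lambda>X. norm (matrix_inv X - matrix_inv A - ?L (X - A)) / norm (X - A)) \<longlongrightarrow> 0) (at A)"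
    proof (rule Lim_null_comparison[OF _ lim])
      show "\<forall>\<^sub>F X in at A. norm (norm (matrix_inv X - matrix_inv A - ?L (X - A)) / norm (X - A))
          \<le> norm (matrix_inv A - matrix_inv X) * K * norm (matrix_inv A) * K"
        using ev eventually_neq_at_within[of A]
      proof eventually_elim
        case (elim X)
        have "norm ((matrix_inv A - matrix_inv X) ** (X - A) ** matrix_inv A)
            \<le> norm ((matrix_inv A - matrix_inv X) ** (X - A)) * norm (matrix_inv A) * K" by (rule K)
        also have "\<dots> \<le> (norm (matrix_inv A - matrix_inv X) * norm (X - A) * K) * norm (matrix_inv A) * K"
          using K by (intro mult_right_mono) auto
        finally have "norm (matrix_inv X - matrix_inv A - ?L (X - A))
            \<le> norm (X - A) * (norm (matrix_inv A - matrix_inv X) * K * norm (matrix_inv A) * K)"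
          unfolding rem[OF elim(1)] by (simp add: algebra_simps)
        moreover have "norm (X - A) > 0" using elim(2) by simp
        ultimately show ?case by (simp add: pos_divide_le_eq mult.commute)
      qed
    qed
  qed
qed

section \<open>Jacobians of congruences and of translated inverses\<close>

definition congm :: "((real, 'n::{finite,linorder}) vec, 'n) vec \<Rightarrow> (real, 'n upt) vec \<Rightarrow> (real, 'n upt) vec" where
  "congm g v = unsym (g ** symu v ** transpose g)"

text \<open>The known value is |det g|^(r+1) for matrices of size r. It is handled here through
  multiplicativity, and computed for diagonal matrices and for \<open>stretch\<close>.\<close>

definition jac :: "((real, 'n::{finite,linorder}) vec, 'n) vec \<Rightarrow> real" where
  "jac g = \<bar>det (matrix (congm g))\<bar>"

lemma symu_congm: "symu (congm g v) = g ** symu v ** transpose g"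
  unfolding congm_def by (intro symu_unsym transpose_congruence transpose_symu)

lemma linear_congm: "linear (congm g)"
  unfolding congm_def
  by (rule linearI) (simp_all add: linear_add[OF linear_symu] linear_add[OF linear_unsym]
      linear_scale[OF linear_symu] linear_scale[OF linear_unsym] matrix_add_ldistrib matrix_add_mult_distrib
      matrix_scaleR_left matrix_scaleR_right)

lemma congm_mult: "congm (g ** h) = congm g \<circ> congm h"
  by (rule ext) (simp add: congm_def[of "g ** h"] congm_def[of g] symu_congm matrix_transpose_mul matrix_mul_assoc)

lemma jac_mult: "jac (g ** h) = jac g * jac h"
  by (simp add: jac_def congm_mult matrix_compose[OF linear_congm linear_congm] det_mul abs_mult)

lemma jac_one: "jac (mat 1 :: ((real, 'n::{finite,linorder}) vec, 'n) vec) = 1"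
proof -
  have "congm (mat 1 :: ((real, 'n) vec, 'n) vec) = id" by (rule ext) (simp add: congm_def unsym_symu)
  then show ?thesis by (simp add: jac_def)
qed

lemma jac_nonneg: "jac g \<ge> 0"
  by (simp add: jac_def)

lemma continuous_on_transpose[continuous_intros]:
  fixes f :: "'a::topological_space \<Rightarrow> real^'n^'n"
  assumes "continuous_on S f"
  shows "continuous_on S (\<lambda>x. transpose (f x))"
proof -
  have "linear (transpose :: real^'n^'n \<Rightarrow> real^'n^'n)"
    by (rule linearI) (simp_all add: transpose_add transpose_scalar)
  then have "bounded_linear (transpose :: real^'n^'n \<Rightarrow> real^'n^'n)" by (simp add: linear_conv_bounded_linear)
  then show ?thesis using assms by (rule bounded_linear.continuous_on)
qed

lemma continuous_on_unsym[continuous_intros]: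
  "continuous_on S f \<Longrightarrow> continuous_on S (\<lambda>x. unsym (f x))"
  by (rule bounded_linear.continuous_on[OF linear_unsym[unfolded linear_conv_bounded_linear]])

lemma continuous_on_symu[continuous_intros]:
  "continuous_on S f \<Longrightarrow> continuous_on S (\<lambda>x. symu (f x))"
  by (rule bounded_linear.continuous_on[OF linear_symu[unfolded linear_conv_bounded_linear]])

lemma measurable_jac[measurable]: "(jac :: ((real, 'n::{finite,linorder}) vec, 'n) vec \<Rightarrow> real) \<in> borel_measurable borel"
proof (rule borel_measurable_continuous_onI)
  have "continuous_on UNIV (\<lambda>g :: ((real, 'n) vec, 'n) vec. \<chi> i j. congm g (axis j 1) $ i)"
    unfolding congm_def by (intro continuous_on_vec_lambda continuous_intros)
  then show "continuous_on UNIV (jac :: ((real, 'n) vec, 'n) vec \<Rightarrow> real)"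
    unfolding jac_def matrix_def by (intro continuous_on_rabs continuous_on_det)
qed

lemma pd_borel[measurable]: "pd_mats \<in> sets (borel :: (real^'n^'n) measure)"
proof -
  have eq: "pd_mats = {M :: real^'n^'n. transpose M = M} \<inter> {M. sympart M \<in> pd_mats}"
    by (auto simp: sympart_id pd_sym)
  have "closed {M :: real^'n^'n. transpose M = M}"
    by (intro closed_Collect_eq continuous_intros)
  then show ?thesis by (subst eq) (intro sets.Int borel_closed borel_open open_sympart_pd)
qed

text \<open>A translation by k in the variable y^-1. With k = \<alpha> x it is the first component u
  of \<open>phi \<alpha> 0\<close>; with k = - \<alpha> u, applied to x, it is the second.\<close>

definition psi :: "real^'n^'n \<Rightarrow> real^'n^'n \<Rightarrow> real^'n^'n" where
  "psi k y = matrix_inv (matrix_inv y + k)"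

definition pdom :: "real^'n^'n \<Rightarrow> (real^'n^'n) set" where
  "pdom k = {y \<in> pd_mats. matrix_inv y + k \<in> pd_mats}"

lemma psi_pdom:
  assumes "y \<in> pdom k"
  shows "psi k y \<in> pdom (- k)" "psi (- k) (psi k y) = y"
  using assms by (auto simp: pdom_def psi_def matrix_inv_matrix_inv pd_invertible pd_inv)

lemma pdom_borel[measurable]: "pdom k \<in> sets borel"
proof -
  have "pdom k = pd_mats \<inter> (\<lambda>y. matrix_inv y + k) -` pd_mats" by (auto simp: pdom_def)
  moreover have "(\<lambda>y. matrix_inv y + k) -` pd_mats \<in> sets borel"
    using measurable_sets[of "\<lambda>y. matrix_inv y + k" borel borel pd_mats] by simp
  ultimately show ?thesis by (simp add: sets.Int)
qed

text \<open>The derivative of \<open>psi k\<close> at \<open>y\<close> is \<open>h \<mapsto> g h g\<^sup>T\<close> with \<open>g = u y\<^sup>-\<^sup>1\<close> and \<open>u = psi k y\<close>.\<close>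

lemma nn_integral_psi:
  fixes k :: "((real, 'n::{finite,linorder}) vec, 'n) vec"
  assumes F[measurable]: "F \<in> borel_measurable borel"
  shows "(\<integral>\<^sup>+u. F u * indicator (pdom (- k)) u \<partial>leb_sym)
    = (\<integral>\<^sup>+y. F (psi k y) * ennreal (jac (psi k y ** matrix_inv y)) * indicator (pdom k) y \<partial>leb_sym)"
proof -
  define f where "f v = unsym (psi k (symu v))" for v
  define S where "S = symu -` pdom k"
  define J where "J v = jac (psi k (symu v) ** matrix_inv (symu v))" for v
  have psim[measurable]: "psi k \<in> borel_measurable borel" unfolding psi_def by measurable
  have sf: "symu (f v) = psi k (symu v)" if "v \<in> S" for v
    using psi_pdom(1)[of "symu v" k] that by (simp add: f_def S_def symu_unsym pdom_def pd_sym)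
  have fS: "f ` S = symu -` pdom (- k)"
  proof (intro set_eqI iffI)
    fix w assume "w \<in> f ` S"
    then show "w \<in> symu -` pdom (- k)" using psi_pdom(1) sf by (auto simp: S_def)
  next
    fix w assume w: "w \<in> symu -` pdom (- k)"
    define v where "v = unsym (psi (- k) (symu w))"
    have p: "psi (- k) (symu w) \<in> pdom k" "psi k (psi (- k) (symu w)) = symu w"
      using psi_pdom[of "symu w" "- k"] w by auto
    then have sv: "symu v = psi (- k) (symu w)" by (simp add: v_def symu_unsym pdom_def pd_sym)
    then have "v \<in> S" using p by (simp add: S_def)
    moreover have "f v = w" by (simp add: f_def sv p unsym_symu)
    ultimately show "w \<in> f ` S" by blast
  qed
  have S1: "S \<in> sets borel" unfolding S_def using measurable_sets[OF symu_measurable pdom_borel] by simp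
  have S2: "f ` S \<in> sets borel" unfolding fS using measurable_sets[OF symu_measurable pdom_borel] by simp
  have fm: "f \<in> borel_measurable borel" unfolding f_def by measurable
  have Jm: "J \<in> borel_measurable borel" unfolding J_def by measurable
  have inj: "inj_on f S"
  proof (rule inj_onI)
    fix v w assume vw: "v \<in> S" "w \<in> S" "f v = f w"
    then have "psi k (symu v) = psi k (symu w)" using sf by metis
    then have "symu v = symu w" using psi_pdom(2) vw by (metis S_def vimageD)
    then show "v = w" by (metis unsym_symu)
  qed
  have der: "(f has_derivative congm (psi k (symu v) ** matrix_inv (symu v))) (at v within S)" if v: "v \<in> S" for v
  proof -
    let ?x = "symu v" and ?u = "psi k (symu v)"
    have x: "?x \<in> pd_mats" "matrix_inv ?x + k \<in> pd_mats" using v by (auto simp: S_def pdom_def)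
    have u: "?u \<in> pd_mats" using x by (simp add: psi_def pd_inv)
    have d1: "(symu has_derivative symu) (at v)"
      using linear_symu[unfolded linear_conv_bounded_linear] by (rule bounded_linear_imp_has_derivative)
    have d2: "((\<lambda>v. matrix_inv (symu v) + k) has_derivative (\<lambda>h. - (matrix_inv ?x ** symu h ** matrix_inv ?x))) (at v)"
      using has_derivative_compose[OF d1 has_derivative_matrix_inv[OF pd_invertible[OF x(1)]]]
      by (auto intro!: derivative_eq_intros)
    have d3: "((\<lambda>v. psi k (symu v)) has_derivative (\<lambda>h. - (?u ** (- (matrix_inv ?x ** symu h ** matrix_inv ?x)) ** ?u))) (at v)"
      using has_derivative_compose[OF d2 has_derivative_matrix_inv[OF pd_invertible[OF x(2)]]]
      by (simp add: psi_def)
    have d4: "(unsym has_derivative unsym) (at ?u)"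
      using linear_unsym[unfolded linear_conv_bounded_linear] by (rule bounded_linear_imp_has_derivative)
    have d5: "(f has_derivative (\<lambda>h. unsym (- (?u ** (- (matrix_inv ?x ** symu h ** matrix_inv ?x)) ** ?u)))) (at v)"
      unfolding f_def using has_derivative_compose[OF d3 d4] .
    have "- (?u ** (- (matrix_inv ?x ** symu h ** matrix_inv ?x)) ** ?u)
        = (?u ** matrix_inv ?x) ** symu h ** transpose (?u ** matrix_inv ?x)" for h
    proof -
      interpret mm: bounded_bilinear "(**) :: ((real, 'n) vec, 'n) vec \<Rightarrow> ((real, 'n) vec, 'n) vec \<Rightarrow> ((real, 'n) vec, 'n) vec"
        by (rule bounded_bilinear_matrix_mult)
      show ?thesis
        by (simp add: mm.minus_left mm.minus_right matrix_transpose_mul pd_sym[OF u] pd_sym[OF pd_inv[OF x(1)]] matrix_mul_assoc)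
    qed
    then have "(\<lambda>h. unsym (- (?u ** (- (matrix_inv ?x ** symu h ** matrix_inv ?x)) ** ?u)))
       = congm (?u ** matrix_inv ?x)" by (simp add: congm_def fun_eq_iff)
    with d5 show ?thesis by (simp add: has_derivative_at_withinI)
  qed
  have Fm: "(\<lambda>v. F (symu v)) \<in> borel_measurable borel" by measurable
  have J: "J v = \<bar>det (matrix (congm (psi k (symu v) ** matrix_inv (symu v))))\<bar>" for v
    by (simp add: J_def jac_def)
  have "(\<integral>\<^sup>+u. F u * indicator (pdom (- k)) u \<partial>leb_sym) = (\<integral>\<^sup>+w. F (symu w) * indicator (f ` S) w \<partial>lborel)"
    by (subst nn_integral_leb_sym) (auto intro!: nn_integral_cong simp: fS indicator_def)
  also have "\<dots> = (\<integral>\<^sup>+v. F (symu (f v)) * ennreal (J v) * indicator S v \<partial>lborel)"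
    by (rule nn_integral_change_of_variables[OF S1 S2 fm der inj Jm J Fm])
  also have "\<dots> = (\<integral>\<^sup>+v. F (psi k (symu v)) * ennreal (J v) * indicator S v \<partial>lborel)"
    by (intro nn_integral_cong) (auto simp: sf indicator_def)
  also have "\<dots> = (\<integral>\<^sup>+y. F (psi k y) * ennreal (jac (psi k y ** matrix_inv y)) * indicator (pdom k) y \<partial>leb_sym)"
    by (subst nn_integral_leb_sym) (auto intro!: nn_integral_cong simp: J_def S_def indicator_def)
  finally show ?thesis .
qed

lemma sigma_finite_leb_sym: "sigma_finite_measure (leb_sym :: (((real, 'n::{finite,linorder}) vec, 'n) vec) measure)"
proof
  let ?A = "\<lambda>n::nat. {M :: ((real, 'n) vec, 'n) vec. norm (unsym M) \<le> real n}"
  have m: "?A n \<in> sets borel" for n by measurable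
  show "\<exists>A::(((real, 'n) vec, 'n) vec) set set. countable A \<and> A \<subseteq> sets leb_sym \<and> \<Union>A = space leb_sym \<and> (\<forall>a\<in>A. emeasure leb_sym a \<noteq> \<infinity>)"
  proof (intro exI[of _ "range ?A"] conjI ballI)
    show "\<Union>(range ?A) = space leb_sym" by (auto intro: real_arch_simple)
    fix a assume "a \<in> range ?A"
    then obtain n where a: "a = ?A n" by blast
    have "emeasure leb_sym a = emeasure lborel (symu -` ?A n)"
      unfolding leb_sym_eq a using m by (subst emeasure_distr) auto
    also have "symu -` ?A n = cball 0 (real n)" by (auto simp: unsym_symu)
    finally show "emeasure leb_sym a \<noteq> \<infinity>" using emeasure_lborel_cball_finite by (simp add: less_top[symmetric])
  qed (use m in auto)
qed

section \<open>The map \<open>phi\<close> in a common frame, and its invariance of Lebesgue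
  measure\<close>

lemma fr_pd_iff:
  assumes g: "invertible g"
  shows "fr g m \<in> pd_mats \<longleftrightarrow> (\<forall>i. m i > 0)"
proof
  assume "fr g m \<in> pd_mats"
  then have "matrix_inv g ** fr g m ** transpose (matrix_inv g) \<in> pd_mats"
    using g by (intro pd_congruence invertible_matrix_inv)
  moreover have "matrix_inv g ** fr g m ** transpose (matrix_inv g)
      = (matrix_inv g ** g) ** diagm m ** transpose (matrix_inv g ** g)"
    by (simp add: fr_def matrix_transpose_mul matrix_mul_assoc)
  ultimately have pd: "diagm m \<in> pd_mats" using g by (simp add: matrix_inv_both)
  show "\<forall>i. m i > 0"
  proof
    fix i
    have "axis i 1 \<bullet> (diagm m *v axis i 1) > 0" using pd_pos[OF pd] by (simp add: axis_eq_0_iff)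
    then show "m i > 0" by (simp add: diagm_vec inner_axis axis_def inner_vec_def if_distrib cong: if_cong)
  qed
qed (use fr_pd[OF g] in blast)

lemma fr_inv_pair:
  assumes "x \<in> pd_mats" "y \<in> pd_mats"
  obtains g m n where "invertible g" "\<forall>i. m i > 0" "\<forall>i. n i > 0" "x = fr g m" "y = matrix_inv (fr g n)"
proof -
  obtain g n where "invertible g" "\<forall>i. n i > 0" "x = fr g (\<lambda>_. 1)" "matrix_inv y = fr g n"
    using simultaneous_diagonalization[OF assms(1) pd_inv[OF assms(2)]] by metis
  then show thesis
    using that[of g "\<lambda>_. 1" n] matrix_inv_matrix_inv[OF pd_invertible[OF assms(2)]] by simp
qed

lemma fr_diff: "fr g m - fr g n = fr g (\<lambda>i. m i - n i)"
proof -
  have "fr g (\<lambda>i. m i - n i) + fr g n = fr g m" by (simp add: fr_add)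
  then show ?thesis by (metis add_diff_cancel_right')
qed

text \<open>In a common frame of x and u^-1 both conditions say n i > \<alpha> m i. The admissible
  pairs (x, u) thus have the same description from either side, which is what exchanging the
  integrations requires.\<close>

lemma inv_minus_pd_iff:
  fixes x u :: "real^'n^'n"
  assumes "x \<in> pd_mats" "u \<in> pd_mats"
  shows "matrix_inv x - \<alpha> *\<^sub>R u \<in> pd_mats \<longleftrightarrow> matrix_inv u - \<alpha> *\<^sub>R x \<in> pd_mats"
proof -
  obtain g m n where g: "invertible g" and m: "\<forall>i. m i > 0" and n: "\<forall>i. n i > 0"
    and x: "x = fr g m" and u: "u = matrix_inv (fr g n)"
    using fr_inv_pair[OF assms] by metis
  define h where "h = transpose (matrix_inv g)"
  have h: "invertible h" unfolding h_def using g by (simp add: invertible_matrix_inv transpose_invertible)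
  have inv: "matrix_inv (fr g d) = fr h (\<lambda>i. 1 / d i)" if "\<forall>i. d i > 0" for d
    unfolding h_def using that by (intro fr_inv g) (metis less_irrefl)
  have "matrix_inv x - \<alpha> *\<^sub>R u = fr h (\<lambda>i. 1 / m i - \<alpha> * (1 / n i))"
    unfolding x u inv[OF m] inv[OF n] by (simp only: fr_scaleR fr_diff)
  moreover have "matrix_inv u - \<alpha> *\<^sub>R x = fr g (\<lambda>i. n i - \<alpha> * m i)"
  proof -
    have "fr g n \<in> pd_mats" using fr_pd[OF g] n by blast
    then have "matrix_inv u = fr g n" unfolding u by (simp add: matrix_inv_matrix_inv pd_invertible)
    then show ?thesis unfolding x by (simp only: fr_scaleR fr_diff)
  qed
  moreover have "1 / m i - \<alpha> * (1 / n i) > 0 \<longleftrightarrow> n i - \<alpha> * m i > 0" for i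
    using m n by (simp add: field_simps)
  ultimately show ?thesis by (simp add: fr_pd_iff g h)
qed

lemma matrix_inv_matrix_inv_pd: "x \<in> pd_mats \<Longrightarrow> matrix_inv (matrix_inv x) = (x :: real^'n^'n)"
  by (simp add: matrix_inv_matrix_inv pd_invertible)

text \<open>Inversion leads to the frame g^-T with reciprocal coordinates. It enters when
  \<open>phi\<close> is applied a second time, since u^-1 and v are in the frame g while
  \<open>phi_fr\<close> asks for u and v^-1.\<close>

lemma dual_frame:
  fixes g :: "real^'n^'n"
  assumes g: "invertible g"
  obtains h where "invertible h"
    "\<And>m. \<forall>i. m i > 0 \<Longrightarrow> matrix_inv (fr g m) = fr h (\<lambda>i. 1 / m i)"
    "\<And>m. \<forall>i. m i > 0 \<Longrightarrow> fr g m = matrix_inv (fr h (\<lambda>i. 1 / m i))"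
proof -
  define h where "h = transpose (matrix_inv g)"
  have h: "invertible h" unfolding h_def using g by (simp add: invertible_matrix_inv transpose_invertible)
  have inv: "matrix_inv (fr g d) = fr h (\<lambda>i. 1 / d i)" if "\<forall>i. d i > 0" for d
    unfolding h_def using that by (intro fr_inv g) (metis less_irrefl)
  have "fr g m = matrix_inv (fr h (\<lambda>i. 1 / m i))" if m: "\<forall>i. m i > 0" for m
  proof -
    have "fr g m \<in> pd_mats" using fr_pd[OF g] m by blast
    then show ?thesis unfolding inv[OF m, symmetric] by (simp add: matrix_inv_matrix_inv_pd)
  qed
  then show thesis using that[OF h] inv by blast
qed

lemma psi_fr1:
  assumes g: "invertible g" and n: "\<forall>i. n i > 0"
  shows "psi (\<alpha> *\<^sub>R fr g m) (matrix_inv (fr g n)) = matrix_inv (fr g (\<lambda>i. n i + \<alpha> * m i))"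
proof -
  have "fr g n \<in> pd_mats" using fr_pd[OF g] n by blast
  then show ?thesis by (simp add: psi_def matrix_inv_matrix_inv_pd fr_scaleR fr_add)
qed

lemma psi_fr2:
  assumes g: "invertible g" and m: "\<forall>i. m i > 0" and n: "\<forall>i. n i > 0" and "\<alpha> \<ge> 0"
  shows "psi (- (\<alpha> *\<^sub>R matrix_inv (fr g (\<lambda>i. n i + \<alpha> * m i)))) (fr g m) = fr g (\<lambda>i. m i * ((n i + \<alpha> * m i) / n i))"
proof -
  obtain h where h: "invertible h"
    and inv: "\<And>m. \<forall>i. m i > 0 \<Longrightarrow> matrix_inv (fr g m) = fr h (\<lambda>i. 1 / m i)"
    using dual_frame[OF g] by metis
  let ?p = "\<lambda>i. n i + \<alpha> * m i" and ?q = "\<lambda>i. m i * ((n i + \<alpha> * m i) / n i)"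
  have p: "\<forall>i. ?p i > 0" using m n \<open>\<alpha> \<ge> 0\<close> by (simp add: add_pos_nonneg less_imp_le)
  have q: "\<forall>i. ?q i > 0" using m n p by simp
  have "1 / m i - \<alpha> * (1 / ?p i) = 1 / ?q i" for i
  proof -
    have "m i > 0" "n i > 0" "?p i > 0" using m n p by auto
    then show ?thesis by (simp add: divide_simps)
  qed
  then have "matrix_inv (fr g m) + - (\<alpha> *\<^sub>R matrix_inv (fr g ?p)) = matrix_inv (fr g ?q)"
    unfolding inv[OF m] inv[OF p] inv[OF q] by (simp only: fr_scaleR fr_diff add_uminus_conv_diff)
  moreover have "fr g ?q \<in> pd_mats" using q unfolding fr_pd_iff[OF g] .
  ultimately show ?thesis by (simp add: psi_def matrix_inv_matrix_inv_pd)
qed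

lemma phi_zero_psi:
  fixes x y :: "real^'n^'n"
  assumes "x \<in> pd_mats" "y \<in> pd_mats" "\<alpha> \<ge> 0"
  shows "phi \<alpha> 0 x y = (psi (\<alpha> *\<^sub>R x) y, psi (- (\<alpha> *\<^sub>R psi (\<alpha> *\<^sub>R x) y)) x)"
proof -
  obtain g m n where g: "invertible g" and m: "\<forall>i. m i > 0" and n: "\<forall>i. n i > 0"
    and x: "x = fr g m" and y: "y = matrix_inv (fr g n)"
    using fr_inv_pair[OF assms(1,2)] by metis
  have "n i * ((n i + \<alpha> * m i) / (n i + 0 * m i)) = n i + \<alpha> * m i" for i
    using n by (simp add: less_imp_neq[symmetric])
  then show ?thesis
    unfolding x y using phi_fr[OF g, of m n \<alpha> 0] m n assms(3)
    by (simp add: psi_fr1[OF g n] psi_fr2[OF g m n assms(3)] less_imp_neq[symmetric])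
qed

text \<open>v x^-1 and u y^-1 are diagonal in the frames g and g^-T, with reciprocal entries.
  Conjugation by y carries the first into the frame of the second, where they are inverse to each
  other, and the multiplicative \<open>jac\<close> does not notice conjugation.\<close>

lemma jac_cancel:
  fixes x y :: "((real, 'n::{finite,linorder}) vec, 'n) vec"
  assumes "x \<in> pd_mats" "y \<in> pd_mats" "\<alpha> \<ge> 0"
  defines "u \<equiv> psi (\<alpha> *\<^sub>R x) y"
  defines "v \<equiv> psi (- (\<alpha> *\<^sub>R u)) x"
  shows "jac (v ** matrix_inv x) * jac (u ** matrix_inv y) = 1"
proof -
  obtain g m n where g: "invertible g" and m: "\<forall>i. m i > 0" and n: "\<forall>i. n i > 0"
    and x: "x = fr g m" and y: "y = matrix_inv (fr g n)"
    using fr_inv_pair[OF assms(1,2)] by metis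
  define gi where "gi = matrix_inv g"
  have G: "g ** gi = mat 1" "gi ** g = mat 1" using g by (simp_all add: gi_def matrix_inv_both)
  then have Gt: "transpose gi ** transpose g = mat 1" "transpose g ** transpose gi = mat 1"
    by (metis matrix_transpose_mul transpose_mat)+
  have c1: "gi ** (g ** X) = X" "transpose g ** (transpose gi ** X) = X" for X :: "((real, 'n) vec, 'n) vec"
    by (simp_all add: matrix_mul_assoc G Gt)
  have c2: "diagm a ** (diagm b ** X) = diagm (\<lambda>i. a i * b i) ** X" for a b and X :: "((real, 'n) vec, 'n) vec"
    by (simp add: matrix_mul_assoc diagm_mult)
  let ?p = "\<lambda>i. n i + \<alpha> * m i"
  have p: "\<forall>i. ?p i > 0" using m n \<open>\<alpha> \<ge> 0\<close> by (simp add: add_pos_nonneg less_imp_le)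
  have inv: "matrix_inv (fr g d) = transpose gi ** diagm (\<lambda>i. 1 / d i) ** gi" if "\<forall>i. d i > 0" for d
    using fr_inv[OF g, of d] that by (simp add: fr_def gi_def less_imp_neq[symmetric])
  have u: "u = matrix_inv (fr g ?p)" unfolding u_def x y by (rule psi_fr1[OF g n])
  have v: "v = fr g (\<lambda>i. m i * (?p i / n i))" unfolding v_def u x by (rule psi_fr2[OF g m n assms(3)])
  have yi: "matrix_inv y = fr g n"
  proof -
    have "fr g n \<in> pd_mats" using fr_pd[OF g] n by blast
    then show ?thesis by (simp add: y matrix_inv_matrix_inv_pd)
  qed
  have one: "1 / n i * (m i * (?p i / n i) * (1 / m i * (n i * (1 / ?p i * n i)))) = 1" for i
  proof -
    have "m i > 0" "n i > 0" "?p i > 0" using m n p by auto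
    then show ?thesis by simp
  qed
  have "y ** (v ** matrix_inv x) ** matrix_inv y ** (u ** matrix_inv y)
      = transpose gi ** diagm (\<lambda>i. 1 / n i * (m i * (?p i / n i) * (1 / m i * (n i * (1 / ?p i * n i))))) ** transpose g"
    unfolding yi u v x inv[OF m] inv[OF p] unfolding y unfolding inv[OF n] unfolding fr_def
    by (simp only: c1 c2 matrix_mul_assoc[symmetric] mult.assoc)
  also have "\<dots> = mat 1" unfolding one by (simp add: diagm_one Gt)
  finally have "jac y * (jac (v ** matrix_inv x)) * jac (matrix_inv y) * jac (u ** matrix_inv y) = 1"
    by (metis jac_mult jac_one)
  moreover have "jac y * jac (matrix_inv y) = 1"
    using assms(2) by (simp add: matrix_inv_both pd_invertible jac_one flip: jac_mult)
  ultimately show ?thesis by (metis mult.assoc mult.commute mult.left_neutral)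
qed

lemma phi_pd:
  fixes x y :: "real^'n^'n"
  assumes "x \<in> pd_mats" "y \<in> pd_mats" "\<alpha> \<ge> 0" "\<beta> \<ge> 0"
  shows "fst (phi \<alpha> \<beta> x y) \<in> pd_mats" "snd (phi \<alpha> \<beta> x y) \<in> pd_mats"
proof -
  obtain g m n where g: "invertible g" and m: "\<forall>i. m i > 0" and n: "\<forall>i. n i > 0"
    and x: "x = fr g m" and y: "y = matrix_inv (fr g n)"
    using fr_inv_pair[OF assms(1,2)] by metis
  have k: "(n i + \<alpha> * m i) / (n i + \<beta> * m i) > 0" for i
    using m n assms(3,4) by (intro divide_pos_pos add_pos_nonneg mult_nonneg_nonneg) (auto simp: less_imp_le)
  show "fst (phi \<alpha> \<beta> x y) \<in> pd_mats" "snd (phi \<alpha> \<beta> x y) \<in> pd_mats"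
    unfolding x y phi_fr[OF g m[rule_format] n[rule_format] assms(3,4)] fst_conv snd_conv
    using m n k by (auto intro!: pd_inv fr_pd g simp del: times_divide_eq_right)
qed

text \<open>Reduces invariance of Lebesgue measure to a vanishing second parameter, where each
  component is a single application of \<open>psi\<close>.\<close>

lemma phi_compose:
  fixes x y :: "real^'n^'n"
  assumes "x \<in> pd_mats" "y \<in> pd_mats" "\<alpha> \<ge> 0" "\<beta> \<ge> 0"
  shows "phi \<alpha> \<beta> x y = prod.swap (phi \<beta> 0 (fst (phi \<alpha> 0 x y)) (snd (phi \<alpha> 0 x y)))"
proof -
  obtain g m n where g: "invertible g" and m: "\<forall>i. m i > 0" and n: "\<forall>i. n i > 0"
    and x: "x = fr g m" and y: "y = matrix_inv (fr g n)"
    using fr_inv_pair[OF assms(1,2)] by metis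
  obtain h where h: "invertible h"
    and i1: "\<And>m. \<forall>i. m i > 0 \<Longrightarrow> matrix_inv (fr g m) = fr h (\<lambda>i. 1 / m i)"
    and i3: "\<And>m. \<forall>i. m i > 0 \<Longrightarrow> fr g m = matrix_inv (fr h (\<lambda>i. 1 / m i))"
    using dual_frame[OF g] by metis
  have mn: "m i > 0" "n i > 0" "n i + \<alpha> * m i > 0" "n i + \<beta> * m i > 0" for i
    using m n assms(3,4) by (simp_all add: add_pos_nonneg less_imp_le)
  let ?p = "\<lambda>i. n i * ((n i + \<alpha> * m i) / (n i + 0 * m i))" and ?q = "\<lambda>i. m i * ((n i + \<alpha> * m i) / (n i + 0 * m i))"
  have n0: "n i + 0 * m i > 0" for i using mn(2)[of i] by simp
  have pq: "\<forall>i. ?p i > 0" "\<forall>i. ?q i > 0"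
    by (intro allI mult_pos_pos divide_pos_pos mn n0)+
  have pq': "1 / ?p i > 0" "1 / ?q i > 0" for i
    by (intro divide_pos_pos zero_less_one pq[rule_format])+
  have e1: "phi \<alpha> 0 x y = (fr h (\<lambda>i. 1 / ?p i), matrix_inv (fr h (\<lambda>i. 1 / ?q i)))"
    unfolding x y using phi_fr[OF g mn(1,2) assms(3), of 0] i1[OF pq(1)] i3[OF pq(2)] by simp
  let ?k = "\<lambda>i. (1 / ?q i + \<beta> * (1 / ?p i)) / (1 / ?q i + 0 * (1 / ?p i))"
  have k: "?k i = (n i + \<beta> * m i) / n i" for i
    using mn[of i] by (simp add: divide_simps)
  have qk: "1 / ?q i * ?k i = 1 / (m i * ((n i + \<alpha> * m i) / (n i + \<beta> * m i)))" for i
    unfolding k using mn[of i] by (simp add: divide_simps)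
  have pk: "1 / ?p i * ?k i = 1 / (n i * ((n i + \<alpha> * m i) / (n i + \<beta> * m i)))" for i
    unfolding k using mn[of i] by (simp add: divide_simps)
  have M: "\<forall>i. m i * ((n i + \<alpha> * m i) / (n i + \<beta> * m i)) > 0" "\<forall>i. n i * ((n i + \<alpha> * m i) / (n i + \<beta> * m i)) > 0"
    using mn by auto
  have "phi \<beta> 0 (fr h (\<lambda>i. 1 / ?p i)) (matrix_inv (fr h (\<lambda>i. 1 / ?q i)))
     = (matrix_inv (fr h (\<lambda>i. 1 / ?q i * ?k i)), fr h (\<lambda>i. 1 / ?p i * ?k i))"
    by (rule phi_fr[OF h pq' assms(4) order_refl])
  also have "\<dots> = (fr g (\<lambda>i. m i * ((n i + \<alpha> * m i) / (n i + \<beta> * m i))),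
      matrix_inv (fr g (\<lambda>i. n i * ((n i + \<alpha> * m i) / (n i + \<beta> * m i)))))"
    unfolding qk pk i3[OF M(1)] i1[OF M(2)] ..
  finally show ?thesis
    unfolding e1 unfolding x y phi_fr[OF g mn(1,2) assms(3,4)] by simp
qed

text \<open>At (u, v) the multiplier is k again, but it now acts on reciprocal coordinates and so
  cancels the first one.\<close>

lemma phi_invol:
  fixes x y :: "real^'n^'n"
  assumes "x \<in> pd_mats" "y \<in> pd_mats" "\<alpha> \<ge> 0" "\<beta> \<ge> 0"
  shows "phi \<alpha> \<beta> (fst (phi \<alpha> \<beta> x y)) (snd (phi \<alpha> \<beta> x y)) = (x, y)"
proof -
  obtain g m n where g: "invertible g" and m: "\<forall>i. m i > 0" and n: "\<forall>i. n i > 0"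
    and x: "x = fr g m" and y: "y = matrix_inv (fr g n)"
    using fr_inv_pair[OF assms(1,2)] by metis
  obtain h where h: "invertible h"
    and i1: "\<And>m. \<forall>i. m i > 0 \<Longrightarrow> matrix_inv (fr g m) = fr h (\<lambda>i. 1 / m i)"
    and i3: "\<And>m. \<forall>i. m i > 0 \<Longrightarrow> fr g m = matrix_inv (fr h (\<lambda>i. 1 / m i))"
    using dual_frame[OF g] by metis
  have mn: "m i > 0" "n i > 0" "n i + \<alpha> * m i > 0" "n i + \<beta> * m i > 0" for i
    using m n assms(3,4) by (simp_all add: add_pos_nonneg less_imp_le)
  let ?k = "\<lambda>i. (n i + \<alpha> * m i) / (n i + \<beta> * m i)"
  have M: "\<forall>i. m i * ?k i > 0" "\<forall>i. n i * ?k i > 0" using mn by auto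
  have M': "1 / (n i * ?k i) > 0" "1 / (m i * ?k i) > 0" for i using mn by auto
  have e1: "phi \<alpha> \<beta> x y = (fr h (\<lambda>i. 1 / (n i * ?k i)), matrix_inv (fr h (\<lambda>i. 1 / (m i * ?k i))))"
    unfolding x y phi_fr[OF g mn(1,2) assms(3,4)] i1[OF M(2)] i3[OF M(1)] ..
  let ?l = "\<lambda>i. (1 / (m i * ?k i) + \<alpha> * (1 / (n i * ?k i))) / (1 / (m i * ?k i) + \<beta> * (1 / (n i * ?k i)))"
  have l: "?l i = ?k i" for i
  proof -
    have kp: "?k i > 0" using mn[of i] by simp
    have "1 / (m i * ?k i) + c * (1 / (n i * ?k i)) = (n i + c * m i) / (m i * n i * ?k i)" for c
      using mn[of i] by (simp add: divide_simps) (simp add: algebra_simps)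
    then show ?thesis using mn[of i] kp by simp
  qed
  have qk: "1 / (m i * ?k i) * ?l i = 1 / m i" "1 / (n i * ?k i) * ?l i = 1 / n i" for i
    unfolding l using mn[of i] by simp_all
  have "phi \<alpha> \<beta> (fr h (\<lambda>i. 1 / (n i * ?k i))) (matrix_inv (fr h (\<lambda>i. 1 / (m i * ?k i))))
     = (matrix_inv (fr h (\<lambda>i. 1 / (m i * ?k i) * ?l i)), fr h (\<lambda>i. 1 / (n i * ?k i) * ?l i))"
    by (rule phi_fr[OF h M' assms(3,4)])
  also have "\<dots> = (x, y)" unfolding qk x y i3[OF m] i1[OF n] ..
  finally show ?thesis unfolding e1 by simp
qed

lemma det_matrix_inv: "invertible (A :: real^'n^'n) \<Longrightarrow> det (matrix_inv A) = 1 / det A"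
  by (metis det_I det_mul invertible_det_nz matrix_inv_both(1) nonzero_mult_div_cancel_left)

text \<open>These conserved combinations are the ones that occur in a product of two MGIG densities,
  and they carry the law of (X, Y) over to (U, V).\<close>

lemma phi_invariants:
  fixes x y :: "real^'n^'n"
  assumes "x \<in> pd_mats" "y \<in> pd_mats" "\<alpha> \<ge> 0" "\<beta> \<ge> 0"
  defines "u \<equiv> fst (phi \<alpha> \<beta> x y)" and "v \<equiv> snd (phi \<alpha> \<beta> x y)"
  shows "det u * det v = det x * det y"
    "matrix_inv u + \<beta> *\<^sub>R v = matrix_inv y + \<alpha> *\<^sub>R x"
    "matrix_inv v + \<alpha> *\<^sub>R u = matrix_inv x + \<beta> *\<^sub>R y"
proof -
  obtain g m n where g: "invertible g" and m: "\<forall>i. m i > 0" and n: "\<forall>i. n i > 0"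
    and x: "x = fr g m" and y: "y = matrix_inv (fr g n)"
    using fr_inv_pair[OF assms(1,2)] by metis
  obtain h where h: "invertible h"
    and i1: "\<And>m. \<forall>i. m i > 0 \<Longrightarrow> matrix_inv (fr g m) = fr h (\<lambda>i. 1 / m i)"
    using dual_frame[OF g] by metis
  have mn: "m i > 0" "n i > 0" "n i + \<alpha> * m i > 0" "n i + \<beta> * m i > 0" for i
    using m n assms(3,4) by (simp_all add: add_pos_nonneg less_imp_le)
  let ?k = "\<lambda>i. (n i + \<alpha> * m i) / (n i + \<beta> * m i)"
  have M: "\<forall>i. m i * ?k i > 0" "\<forall>i. n i * ?k i > 0" using mn by auto
  have pd: "fr g n \<in> pd_mats" "fr g (\<lambda>i. n i * ?k i) \<in> pd_mats"
    unfolding fr_pd_iff[OF g] using n M(2) by blast+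
  have u: "u = matrix_inv (fr g (\<lambda>i. n i * ?k i))" and v: "v = fr g (\<lambda>i. m i * ?k i)"
    unfolding u_def v_def x y phi_fr[OF g mn(1,2) assms(3,4)] by simp_all
  have dg: "det g \<noteq> 0" using g by (simp add: invertible_det_nz)
  have P: "(\<Prod>i\<in>UNIV. ?k i) > 0" "(\<Prod>i\<in>UNIV. n i) > 0" "(\<Prod>i\<in>UNIV. m i) > 0"
    using mn by (auto intro!: prod_pos)
  have cancel: "1 / (d * (b * a)) * (d * (c * a)) = d * c * (1 / (d * b))" if "d \<noteq> 0" "a > 0" for a b c d :: real
    using that by simp
  show "det u * det v = det x * det y"
    unfolding u v x y det_matrix_inv[OF pd_invertible[OF pd(1)]] det_matrix_inv[OF pd_invertible[OF pd(2)]] det_fr prod.distrib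
    by (rule cancel) (use dg P in auto)
  show "matrix_inv u + \<beta> *\<^sub>R v = matrix_inv y + \<alpha> *\<^sub>R x"
  proof -
    have "n i * ?k i + \<beta> * (m i * ?k i) = n i + \<alpha> * m i" for i
    proof -
      have "n i * ?k i + \<beta> * (m i * ?k i) = (n i + \<beta> * m i) * ?k i" by (simp only: distrib_right mult.assoc)
      then show ?thesis using mn[of i] by simp
    qed
    then show ?thesis
      unfolding u v x y matrix_inv_matrix_inv_pd[OF pd(1)] matrix_inv_matrix_inv_pd[OF pd(2)] fr_scaleR fr_add by simp
  qed
  show "matrix_inv v + \<alpha> *\<^sub>R u = matrix_inv x + \<beta> *\<^sub>R y"
  proof -
    have "1 / (m i * ?k i) + \<alpha> * (1 / (n i * ?k i)) = 1 / m i + \<beta> * (1 / n i)" for i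
    proof -
      have "1 / (m i * ?k i) + \<alpha> * (1 / (n i * ?k i)) = (n i + \<alpha> * m i) / (m i * n i * ?k i)"
        using mn[of i] by (simp add: divide_simps) (simp add: algebra_simps)
      also have "\<dots> = (n i + \<beta> * m i) / (m i * n i)" using mn[of i] by simp
      also have "\<dots> = 1 / m i + \<beta> * (1 / n i)" using mn[of i] by (simp add: divide_simps)
      finally show ?thesis .
    qed
    then show ?thesis
      unfolding u v x y i1[OF m] i1[OF n] i1[OF M(1)] i1[OF M(2)] fr_scaleR fr_add by simp
  qed
qed

lemma pdom_scaled: "x \<in> pd_mats \<Longrightarrow> \<alpha> \<ge> 0 \<Longrightarrow> pdom (\<alpha> *\<^sub>R x) = pd_mats"
  by (cases "\<alpha> = 0") (auto simp: pdom_def pd_inv pd_add pd_scaleR)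

text \<open>Pass from \<open>(x, y)\<close> to \<open>(x, u)\<close> and then to \<open>(v, u)\<close>; by multiplicativity of \<open>jac\<close> the two Jacobians cancel.\<close>

lemma phi_zero_preserves:
  fixes F :: "((real, 'n::{finite,linorder}) vec, 'n) vec \<times> ((real, 'n) vec, 'n) vec \<Rightarrow> ennreal"
  assumes F[measurable]: "F \<in> borel_measurable (borel \<Otimes>\<^sub>M borel)" and \<alpha>: "\<alpha> \<ge> 0"
  shows "(\<integral>\<^sup>+x. \<integral>\<^sup>+y. F (phi \<alpha> 0 x y) * indicator pd_mats x * indicator pd_mats y \<partial>leb_sym \<partial>leb_sym)
    = (\<integral>\<^sup>+x. \<integral>\<^sup>+y. F (x, y) * indicator pd_mats x * indicator pd_mats y \<partial>leb_sym \<partial>leb_sym)"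
proof -
  interpret L: sigma_finite_measure "leb_sym :: (((real, 'n) vec, 'n) vec) measure" by (rule sigma_finite_leb_sym)
  interpret P: pair_sigma_finite "leb_sym :: (((real, 'n) vec, 'n) vec) measure" "leb_sym :: (((real, 'n) vec, 'n) vec) measure" ..
  define H where "H x u = F (u, psi (- (\<alpha> *\<^sub>R u)) x) * ennreal (jac (psi (- (\<alpha> *\<^sub>R u)) x ** matrix_inv x))
      * (indicator pd_mats u * indicator pd_mats x * indicator pd_mats (matrix_inv x + - (\<alpha> *\<^sub>R u)))" for x u
  have Hm: "(\<lambda>(x, u). H x u) \<in> borel_measurable (leb_sym \<Otimes>\<^sub>M leb_sym)"
    unfolding H_def psi_def by measurable
  have step1: "(\<integral>\<^sup>+v. F (u, v) * indicator pd_mats u * indicator pd_mats v \<partial>leb_sym) = (\<integral>\<^sup>+x. H x u \<partial>leb_sym)" for u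
  proof (cases "u \<in> pd_mats")
    case True
    have Fu: "(\<lambda>v. F (u, v)) \<in> borel_measurable borel" by measurable
    have "(\<integral>\<^sup>+v. F (u, v) * indicator pd_mats u * indicator pd_mats v \<partial>leb_sym)
       = (\<integral>\<^sup>+v. F (u, v) * indicator (pdom (- (- (\<alpha> *\<^sub>R u)))) v \<partial>leb_sym)"
      using True \<alpha> by (simp add: pdom_scaled)
    also have "\<dots> = (\<integral>\<^sup>+x. F (u, psi (- (\<alpha> *\<^sub>R u)) x) * ennreal (jac (psi (- (\<alpha> *\<^sub>R u)) x ** matrix_inv x))
        * indicator (pdom (- (\<alpha> *\<^sub>R u))) x \<partial>leb_sym)"
      by (rule nn_integral_psi[OF Fu])
    also have "\<dots> = (\<integral>\<^sup>+x. H x u \<partial>leb_sym)"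
      using True by (intro nn_integral_cong) (auto simp: H_def pdom_def indicator_def)
    finally show ?thesis .
  qed (simp add: H_def)
  have step2: "(\<integral>\<^sup>+u. H x u \<partial>leb_sym) = (\<integral>\<^sup>+y. F (phi \<alpha> 0 x y) * indicator pd_mats x * indicator pd_mats y \<partial>leb_sym)" for x
  proof (cases "x \<in> pd_mats")
    case x: True
    define F' where "F' u = F (u, psi (- (\<alpha> *\<^sub>R u)) x) * ennreal (jac (psi (- (\<alpha> *\<^sub>R u)) x ** matrix_inv x))" for u
    have F'm: "F' \<in> borel_measurable borel" unfolding F'_def psi_def by measurable
    have "(\<integral>\<^sup>+u. H x u \<partial>leb_sym) = (\<integral>\<^sup>+u. F' u * indicator (pdom (- (\<alpha> *\<^sub>R x))) u \<partial>leb_sym)"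
    proof (intro nn_integral_cong)
      fix u :: "((real, 'n) vec, 'n) vec"
      show "H x u = F' u * indicator (pdom (- (\<alpha> *\<^sub>R x))) u"
        using inv_minus_pd_iff[OF x, of u \<alpha>] x
        by (cases "u \<in> pd_mats") (auto simp: H_def F'_def pdom_def indicator_def)
    qed
    also have "\<dots> = (\<integral>\<^sup>+y. F' (psi (\<alpha> *\<^sub>R x) y) * ennreal (jac (psi (\<alpha> *\<^sub>R x) y ** matrix_inv y)) * indicator (pdom (\<alpha> *\<^sub>R x)) y \<partial>leb_sym)"
      by (rule nn_integral_psi[OF F'm])
    also have "\<dots> = (\<integral>\<^sup>+y. F (phi \<alpha> 0 x y) * indicator pd_mats x * indicator pd_mats y \<partial>leb_sym)"
    proof (intro nn_integral_cong)
      fix y :: "((real, 'n) vec, 'n) vec"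
      show "F' (psi (\<alpha> *\<^sub>R x) y) * ennreal (jac (psi (\<alpha> *\<^sub>R x) y ** matrix_inv y)) * indicator (pdom (\<alpha> *\<^sub>R x)) y
        = F (phi \<alpha> 0 x y) * indicator pd_mats x * indicator pd_mats y"
      proof (cases "y \<in> pd_mats")
        case y: True
        show ?thesis
          using x y jac_cancel[OF x y \<alpha>]
          by (simp add: pdom_scaled[OF x \<alpha>] phi_zero_psi[OF x y \<alpha>] F'_def mult.assoc jac_nonneg flip: ennreal_mult')
      qed (simp add: pdom_scaled[OF x \<alpha>])
    qed
    finally show ?thesis .
  qed (simp add: H_def)
  have "(\<integral>\<^sup>+u. \<integral>\<^sup>+v. F (u, v) * indicator pd_mats u * indicator pd_mats v \<partial>leb_sym \<partial>leb_sym)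
      = (\<integral>\<^sup>+u. \<integral>\<^sup>+x. H x u \<partial>leb_sym \<partial>leb_sym)" by (simp only: step1)
  also have "\<dots> = (\<integral>\<^sup>+x. \<integral>\<^sup>+u. H x u \<partial>leb_sym \<partial>leb_sym)"
    by (rule P.Fubini'[OF Hm])
  also have "\<dots> = (\<integral>\<^sup>+x. \<integral>\<^sup>+y. F (phi \<alpha> 0 x y) * indicator pd_mats x * indicator pd_mats y \<partial>leb_sym \<partial>leb_sym)"
    by (simp only: step2)
  finally show ?thesis by simp
qed

lemma measurable_phi[measurable]:
  "(\<lambda>z. phi \<alpha> \<beta> (fst z) (snd z)) \<in> measurable (borel \<Otimes>\<^sub>M borel) (borel \<Otimes>\<^sub>M (borel :: (real^'n^'n) measure))"
  unfolding phi_def by measurable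

lemma phi_preserves:
  fixes F :: "((real, 'n::{finite,linorder}) vec, 'n) vec \<times> ((real, 'n) vec, 'n) vec \<Rightarrow> ennreal"
  assumes F[measurable]: "F \<in> borel_measurable (borel \<Otimes>\<^sub>M borel)" and ab: "\<alpha> \<ge> 0" "\<beta> \<ge> 0"
  shows "(\<integral>\<^sup>+z. F (phi \<alpha> \<beta> (fst z) (snd z)) * indicator (pd_mats \<times> pd_mats) z \<partial>(leb_sym \<Otimes>\<^sub>M leb_sym))
    = (\<integral>\<^sup>+z. F z * indicator (pd_mats \<times> pd_mats) z \<partial>(leb_sym \<Otimes>\<^sub>M leb_sym))"
proof -
  interpret L: sigma_finite_measure "leb_sym :: (((real, 'n) vec, 'n) vec) measure" by (rule sigma_finite_leb_sym)
  interpret P: pair_sigma_finite "leb_sym :: (((real, 'n) vec, 'n) vec) measure" "leb_sym :: (((real, 'n) vec, 'n) vec) measure" ..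
  define W where "W z = F (prod.swap (phi \<beta> 0 (fst z) (snd z)))" for z
  have Wm[measurable]: "W \<in> borel_measurable (borel \<Otimes>\<^sub>M borel)"
    unfolding W_def prod.swap_def by measurable
  have Fm: "F \<in> borel_measurable (leb_sym \<Otimes>\<^sub>M leb_sym)" by measurable
  have G: "(\<lambda>z. F (prod.swap z)) \<in> borel_measurable (borel \<Otimes>\<^sub>M borel)"
    unfolding prod.swap_def by measurable
  have "(\<integral>\<^sup>+z. F (phi \<alpha> \<beta> (fst z) (snd z)) * indicator (pd_mats \<times> pd_mats) z \<partial>(leb_sym \<Otimes>\<^sub>M leb_sym))
     = (\<integral>\<^sup>+x. \<integral>\<^sup>+y. F (phi \<alpha> \<beta> x y) * indicator (pd_mats \<times> pd_mats) (x, y) \<partial>leb_sym \<partial>leb_sym)"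
    by (subst L.nn_integral_fst[symmetric]) (auto intro!: borel_measurable_times_ennreal)
  also have "\<dots> = (\<integral>\<^sup>+x. \<integral>\<^sup>+y. W (phi \<alpha> 0 x y) * indicator pd_mats x * indicator pd_mats y \<partial>leb_sym \<partial>leb_sym)"
    by (intro nn_integral_cong) (auto simp: indicator_def W_def phi_compose[OF _ _ ab])
  also have "\<dots> = (\<integral>\<^sup>+x. \<integral>\<^sup>+y. W (x, y) * indicator pd_mats x * indicator pd_mats y \<partial>leb_sym \<partial>leb_sym)"
    by (rule phi_zero_preserves[OF Wm ab(1)])
  also have "\<dots> = (\<integral>\<^sup>+x. \<integral>\<^sup>+y. (\<lambda>z. F (prod.swap z)) (phi \<beta> 0 x y) * indicator pd_mats x * indicator pd_mats y \<partial>leb_sym \<partial>leb_sym)"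
    by (simp add: W_def)
  also have "\<dots> = (\<integral>\<^sup>+x. \<integral>\<^sup>+y. F (y, x) * indicator pd_mats x * indicator pd_mats y \<partial>leb_sym \<partial>leb_sym)"
    using phi_zero_preserves[OF G ab(2)] by simp
  also have "\<dots> = (\<integral>\<^sup>+x. \<integral>\<^sup>+y. F (x, y) * indicator pd_mats y * indicator pd_mats x \<partial>leb_sym \<partial>leb_sym)"
    by (rule P.Fubini'[where f = "\<lambda>x y. F (x, y) * indicator pd_mats y * indicator pd_mats x"]) measurable
  also have "\<dots> = (\<integral>\<^sup>+x. \<integral>\<^sup>+y. F (x, y) * indicator (pd_mats \<times> pd_mats) (x, y) \<partial>leb_sym \<partial>leb_sym)"
    by (intro nn_integral_cong) (auto simp: indicator_def)
  also have "\<dots> = (\<integral>\<^sup>+z. F z * indicator (pd_mats \<times> pd_mats) z \<partial>(leb_sym \<Otimes>\<^sub>M leb_sym))"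
    by (subst L.nn_integral_fst[symmetric]) auto
  finally show ?thesis .
qed

section \<open>From almost everywhere to everywhere on the cone\<close>

lemma emeasure_leb_sym_open_pos:
  fixes x :: "((real, 'n::{finite,linorder}) vec, 'n) vec"
  assumes "open U" "x \<in> U" "transpose x = x"
  shows "emeasure leb_sym U > 0"
proof -
  have "emeasure leb_sym U = emeasure lborel (symu -` U)"
    unfolding leb_sym_eq using assms(1) by (subst emeasure_distr) auto
  moreover have op: "open (symu -` U)"
    using assms(1) continuous_on_symu[OF continuous_on_id, of UNIV] by (intro open_vimage) auto
  moreover have ne: "symu -` U \<noteq> {}" using assms(2,3) by (metis empty_iff symu_unsym vimageI)
  moreover have "emeasure lborel (symu -` U) \<noteq> 0"
  proof
    assume "emeasure lborel (symu -` U) = 0"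
    then have "symu -` U \<in> null_sets lborel" using op by (auto simp: null_sets_def)
    then have "negligible (symu -` U)" by (simp add: negligible_iff_null_sets null_sets_completionI)
    with open_not_negligible[OF op ne] show False by blast
  qed
  ultimately show ?thesis by (simp add: zero_less_iff_neq_zero)
qed

text \<open>A point where f and g differ yields an open set U, of positive measure, such that they
  differ at every symmetric matrix in U. The condition on \<open>sympart\<close> turns a relatively
  open subset of the cone into an open one.\<close>

lemma AE_leb_sym_continuous_eq:
  fixes f g :: "((real, 'n::{finite,linorder}) vec, 'n) vec \<Rightarrow> real"
  assumes ae: "AE x in leb_sym. x \<in> pd_mats \<longrightarrow> f x = g x"
    and cf: "continuous_on pd_mats f" and cg: "continuous_on pd_mats g" and x: "x \<in> pd_mats"
  shows "f x = g x"
proof (rule ccontr)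
  assume ne: "f x \<noteq> g x"
  have "continuous_on pd_mats (\<lambda>x. f x - g x)" using cf cg by (intro continuous_intros)
  moreover have "open (- {0::real})" by auto
  ultimately obtain A where A: "open A" "A \<inter> pd_mats = (\<lambda>x. f x - g x) -` (- {0}) \<inter> pd_mats"
    unfolding continuous_on_open_invariant by blast
  define U where "U = A \<inter> {M. sympart M \<in> pd_mats}"
  have U: "open U" unfolding U_def using A(1) open_sympart_pd by blast
  have "x \<in> U" using A(2) ne x by (auto simp: U_def sympart_id pd_sym)
  then have pos: "emeasure leb_sym U > 0" using emeasure_leb_sym_open_pos[OF U] pd_sym[OF x] by blast
  have sy: "AE M in leb_sym. transpose M = (M :: ((real, 'n) vec, 'n) vec)"
    unfolding leb_sym_eq
    by (subst AE_distr_iff) (auto simp: transpose_symu intro!: borel_closed closed_Collect_eq continuous_intros)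
  have "AE M in leb_sym. M \<notin> U"
    using ae sy
  proof eventually_elim
    case (elim M)
    show "M \<notin> U"
    proof
      assume "M \<in> U"
      then have "M \<in> pd_mats" "M \<in> A" using elim(2) by (auto simp: U_def sympart_id)
      then have "f M \<noteq> g M" using A(2) by auto
      with elim(1) \<open>M \<in> pd_mats\<close> show False by blast
    qed
  qed
  then have "emeasure leb_sym U = 0"
    using U by (subst (asm) AE_iff_measurable[of U]) auto
  with pos show False by simp
qed

section \<open>Integrability forces positive definite parameters\<close>

lemma nn_integral_congruence:
  fixes g :: "((real, 'n::{finite,linorder}) vec, 'n) vec"
  assumes g: "invertible g" and F[measurable]: "F \<in> borel_measurable borel"
  shows "(\<integral>\<^sup>+x. F x * indicator pd_mats x \<partial>leb_sym)
    = (\<integral>\<^sup>+k. F (g ** k ** transpose g) * ennreal (jac g) * indicator pd_mats k \<partial>leb_sym)"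
proof -
  define S where "S = symu -` (pd_mats :: (((real, 'n) vec, 'n) vec) set)"
  have S1: "S \<in> sets borel" unfolding S_def using measurable_sets[OF symu_measurable pd_borel] by simp
  have fS: "congm g ` S = S"
  proof (intro set_eqI iffI)
    fix w assume "w \<in> congm g ` S"
    then show "w \<in> S" using pd_congruence[OF g] by (auto simp: S_def symu_congm)
  next
    fix w assume w: "w \<in> S"
    have "congm (matrix_inv g) w \<in> S"
      using pd_congruence[OF invertible_matrix_inv[OF g]] w by (auto simp: S_def symu_congm)
    moreover have "congm g (congm (matrix_inv g) w) = w"
    proof -
      have "congm g (congm (matrix_inv g) w) = congm (g ** matrix_inv g) w" by (simp add: congm_mult)
      then show ?thesis by (simp add: matrix_inv_both[OF g] congm_def unsym_symu)
    qed
    ultimately show "w \<in> congm g ` S" by (metis image_eqI)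
  qed
  have inj: "inj_on (congm g) S"
  proof (rule inj_on_inverseI)
    fix w
    have "congm (matrix_inv g) (congm g w) = congm (matrix_inv g ** g) w" by (simp add: congm_mult)
    then show "congm (matrix_inv g) (congm g w) = w" by (simp add: matrix_inv_both[OF g] congm_def unsym_symu)
  qed
  have cm: "congm g \<in> borel_measurable borel" unfolding congm_def by measurable
  have der: "(congm g has_derivative congm g) (at v within S)" for v
    using linear_congm[unfolded linear_conv_bounded_linear] by (rule bounded_linear_imp_has_derivative)
  have Fm: "(\<lambda>v. F (symu v)) \<in> borel_measurable borel" by measurable
  have "(\<integral>\<^sup>+x. F x * indicator pd_mats x \<partial>leb_sym) = (\<integral>\<^sup>+w. F (symu w) * indicator (congm g ` S) w \<partial>lborel)"
    unfolding fS by (subst nn_integral_leb_sym) (auto intro!: nn_integral_cong simp: S_def indicator_def)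
  also have "\<dots> = (\<integral>\<^sup>+v. F (symu (congm g v)) * ennreal (jac g) * indicator S v \<partial>lborel)"
    by (rule nn_integral_change_of_variables[OF S1 _ cm der inj _ _ Fm]) (simp_all add: fS S1 jac_def)
  also have "\<dots> = (\<integral>\<^sup>+k. F (g ** k ** transpose g) * ennreal (jac g) * indicator pd_mats k \<partial>leb_sym)"
  proof (subst nn_integral_leb_sym)
    show "(\<lambda>k. F (g ** k ** transpose g) * ennreal (jac g) * indicator pd_mats k) \<in> borel_measurable borel" by measurable
  qed (auto intro!: nn_integral_cong simp: S_def indicator_def symu_congm)
  finally show ?thesis .
qed

text \<open>Reflecting the pairs moves the factors d (fst p) to the lower triangle. Both triangles
  together cover every pair, giving each index r times, and the diagonal once more; hence the
  exponent r + 1.\<close>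

lemma prod_upper_pairs:
  fixes d :: "'n::{finite,linorder} \<Rightarrow> real"
  shows "(\<Prod>p\<in>{p :: 'n \<times> 'n. fst p \<le> snd p}. d (fst p) * d (snd p)) = (\<Prod>i\<in>UNIV. d i) ^ (CARD('n) + 1)"
proof -
  let ?U = "{p :: 'n \<times> 'n. fst p \<le> snd p}" and ?V = "{p :: 'n \<times> 'n. snd p \<le> fst p}"
  have sw: "(\<Prod>p\<in>?U. d (fst p)) = (\<Prod>p\<in>?V. d (snd p))"
    by (rule prod.reindex_bij_witness[where i = prod.swap and j = prod.swap]) auto
  have "(\<Prod>p\<in>?U. d (fst p) * d (snd p)) = (\<Prod>p\<in>?V. d (snd p)) * (\<Prod>p\<in>?U. d (snd p))"
    by (simp add: prod.distrib sw)
  also have "\<dots> = (\<Prod>p\<in>?V \<union> ?U. d (snd p)) * (\<Prod>p\<in>?V \<inter> ?U. d (snd p))"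
    by (rule prod.union_inter[symmetric]) auto
  also have "?V \<union> ?U = UNIV \<times> UNIV" by auto
  also have "(\<Prod>p\<in>(UNIV :: 'n set) \<times> UNIV. d (snd p)) = (\<Prod>i\<in>UNIV. d i) ^ CARD('n)"
    using prod.cartesian_product[of "\<lambda>_ :: 'n. d" UNIV UNIV] by (simp add: case_prod_unfold del: UNIV_Times_UNIV)
  also have "(\<Prod>p\<in>?V \<inter> ?U. d (snd p)) = (\<Prod>i\<in>UNIV. d i)"
    by (rule prod.reindex_bij_witness[where i = "\<lambda>i. (i, i)" and j = snd]) auto
  finally show ?thesis by (simp add: mult.commute)
qed

lemma jac_diagm:
  fixes d :: "'n::{finite,linorder} \<Rightarrow> real"
  shows "jac (diagm d) = \<bar>\<Prod>i\<in>UNIV. d i\<bar> ^ (CARD('n) + 1)"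
proof -
  have c: "congm (diagm d) v $ p = d (fst (of_upt p)) * d (snd (of_upt p)) * v $ p" for v p
  proof -
    have "(diagm d ** M ** transpose (diagm d)) $ i $ j = d i * d j * M $ i $ j" for M :: "((real, 'n) vec, 'n) vec" and i j
    proof -
      have "(diagm d ** M) $ i $ k = d i * M $ i $ k" for k
        by (simp add: diagm_def matrix_matrix_mult_def if_distrib[of "\<lambda>x. x * _"] cong: if_cong)
      moreover have "(N ** diagm d) $ i $ j = N $ i $ j * d j" for N :: "((real, 'n) vec, 'n) vec"
        by (simp add: diagm_def matrix_matrix_mult_def if_distrib[of "(*) _"] cong: if_cong)
      ultimately show ?thesis by (simp add: transpose_diagm)
    qed
    then show ?thesis
      by (simp add: congm_def unsym_def symu_def of_upt_le of_upt_inverse)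
  qed
  have "det (matrix (congm (diagm d))) = (\<Prod>p\<in>UNIV. matrix (congm (diagm d)) $ p $ p)"
    by (rule det_diagonal) (simp add: matrix_def c axis_def)
  also have "\<dots> = (\<Prod>p\<in>UNIV. d (fst (of_upt p)) * d (snd (of_upt p)))"
    by (simp add: matrix_def c axis_def)
  also have "\<dots> = (\<Prod>p\<in>{p :: 'n \<times> 'n. fst p \<le> snd p}. d (fst p) * d (snd p))"
    by (rule prod.reindex_bij_witness[where i = to_upt and j = of_upt])
       (auto simp: to_upt_inverse of_upt_inverse of_upt_le)
  finally show ?thesis by (simp add: jac_def prod_upper_pairs power_abs abs_mult)
qed

text \<open>For orthogonal Q this scales the i-th column of Q by t and fixes its orthogonal
  complement. Matrices g k g with g of this kind leave every compact part of the cone along one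
  eigendirection as t grows or shrinks.\<close>

definition stretch :: "real^'n^'n \<Rightarrow> 'n \<Rightarrow> real \<Rightarrow> real^'n^'n" where
  "stretch Q i t = fr Q ((\<lambda>_. 1)(i := t))"

lemma stretch_outer:
  assumes "orthogonal_matrix Q"
  shows "stretch Q i t = mat 1 + (t - 1) *\<^sub>R outer (column i Q) (column i Q)"
proof -
  have "(\<lambda>_. 1::real)(i := t) = (\<lambda>j. 1 + (t - 1) * (if j = i then 1 else 0))" by auto
  then show ?thesis
    unfolding stretch_def fr_delta[symmetric] fr_scaleR fr_orthogonal_one[OF assms, symmetric] fr_add by simp
qed

lemma transpose_stretch: "transpose (stretch Q i t) = stretch Q i t"
  by (simp add: stretch_def transpose_fr)

lemma fr_mult_orthogonal:
  assumes "orthogonal_matrix Q"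
  shows "fr Q a ** fr Q b = fr Q (\<lambda>i. a i * b i)"
proof -
  have "fr Q a ** fr Q b = Q ** diagm a ** (transpose Q ** Q) ** diagm b ** transpose Q"
    by (simp add: fr_def matrix_mul_assoc)
  also have "\<dots> = Q ** (diagm a ** diagm b) ** transpose Q"
    using assms by (simp add: orthogonal_matrix_def matrix_mul_assoc)
  finally show ?thesis by (simp add: fr_def diagm_mult)
qed

lemma stretch_mult_inverse:
  assumes "orthogonal_matrix Q" "t > 0"
  shows "stretch Q i t ** stretch Q i (1 / t) = mat 1"
proof -
  have "(\<lambda>j. ((\<lambda>_. 1)(i := t)) j * ((\<lambda>_. 1)(i := 1 / t)) j) = (\<lambda>_. 1::real)" using assms(2) by auto
  then show ?thesis
    unfolding stretch_def fr_mult_orthogonal[OF assms(1)] by (simp add: fr_orthogonal_one[OF assms(1)])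
qed

lemma det_stretch:
  assumes "orthogonal_matrix Q"
  shows "det (stretch Q i t) = t"
proof -
  have "(\<Prod>j\<in>UNIV. ((\<lambda>_. 1)(i := t)) j) = (\<Prod>j\<in>UNIV. if j = i then t else 1)" by (rule prod.cong) auto
  then show ?thesis by (simp add: stretch_def det_fr det_orthogonal_square[OF assms])
qed

lemma jac_stretch:
  fixes Q :: "((real, 'n::{finite,linorder}) vec, 'n) vec"
  assumes Q: "orthogonal_matrix Q" and t: "t > 0"
  shows "jac (stretch Q i t) = t ^ (CARD('n) + 1)"
proof -
  have p: "(\<Prod>j\<in>UNIV. ((\<lambda>_. 1)(i := t)) j) = t"
  proof -
    have "(\<Prod>j\<in>UNIV. ((\<lambda>_. 1)(i := t)) j) = (\<Prod>j\<in>UNIV. if j = i then t else 1)" by (rule prod.cong) auto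
    then show ?thesis by simp
  qed
  have jd: "jac (diagm ((\<lambda>_. 1)(i := t))) = t ^ (CARD('n) + 1)"
    unfolding jac_diagm p using t by simp
  have q: "jac Q * jac (transpose Q) = 1"
    using Q unfolding jac_mult[symmetric] by (simp add: orthogonal_matrix_def jac_one)
  have "jac (stretch Q i t) = (jac Q * jac (transpose Q)) * jac (diagm ((\<lambda>_. 1)(i := t)))"
    unfolding stretch_def fr_def jac_mult by (simp only: mult_ac)
  then show ?thesis unfolding q jd by simp
qed

lemma inner_tr_commute: "inner_tr a b = inner_tr b a"
  unfolding inner_tr_def by (rule trace_mul_sym)

lemma inner_tr_abs_le: "transpose x = x \<Longrightarrow> \<bar>inner_tr a x\<bar> \<le> norm a * norm x"
  by (simp add: inner_tr_eq_inner Cauchy_Schwarz_ineq2)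

text \<open>The stretch multiplies the eigenvalue \<mu> i \<le> 0 of a by s^2 \<ge> 1, and it is
  weighted by a positive diagonal entry of Q^T k Q, so the sum cannot grow.\<close>

lemma inner_tr_stretch_le:
  assumes Q: "orthogonal_matrix Q" and a: "a = fr Q \<mu>" and i: "\<mu> i \<le> 0" and s: "s \<ge> 1" and k: "k \<in> pd_mats"
  shows "inner_tr a (stretch Q i s ** k ** stretch Q i s) \<le> inner_tr a k"
proof -
  define q where "q j = (transpose Q ** k ** Q) $ j $ j" for j
  have qpos: "q j > 0" for j
  proof -
    have "transpose Q ** k ** transpose (transpose Q) \<in> pd_mats"
      using Q k by (intro pd_congruence invertible_orthogonal) auto
    then have "axis j 1 \<bullet> ((transpose Q ** k ** Q) *v axis j 1) > 0" by (intro pd_pos) (auto simp: axis_eq_0_iff)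
    moreover have "axis j 1 \<bullet> (M *v axis j 1) = M $ j $ j" for M :: "real^'a^'a"
      by (simp add: matrix_vector_mult_basis inner_axis' column_def)
    ultimately show ?thesis unfolding q_def by metis
  qed
  let ?d = "(\<lambda>_. 1::real)(i := s)"
  have sas: "stretch Q i s ** a ** stretch Q i s = fr Q (\<lambda>j. ?d j * \<mu> j * ?d j)"
    unfolding stretch_def a fr_mult_orthogonal[OF Q] ..
  have "inner_tr a (stretch Q i s ** k ** stretch Q i s) = trace ((a ** stretch Q i s ** k) ** stretch Q i s)"
    by (simp add: inner_tr_def matrix_mul_assoc)
  also have "\<dots> = trace (stretch Q i s ** (a ** stretch Q i s ** k))" by (rule trace_mul_sym)
  also have "\<dots> = inner_tr (fr Q (\<lambda>j. ?d j * \<mu> j * ?d j)) k"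
    unfolding inner_tr_def sas[symmetric] by (simp only: matrix_mul_assoc)
  also have "\<dots> = (\<Sum>j\<in>UNIV. (?d j * \<mu> j * ?d j) * q j)"
    by (subst inner_tr_commute) (simp add: inner_tr_fr q_def)
  also have "\<dots> \<le> (\<Sum>j\<in>UNIV. \<mu> j * q j)"
  proof (rule sum_mono)
    fix j
    have "s * s \<ge> 1" using s mult_mono[of 1 s 1 s] by simp
    then have "(s * s - 1) * (\<mu> i * q i) \<le> 0"
      using i qpos[of i] by (intro mult_nonneg_nonpos mult_nonpos_nonneg) auto
    then show "(?d j * \<mu> j * ?d j) * q j \<le> \<mu> j * q j" by (auto simp: algebra_simps)
  qed
  also have "\<dots> = inner_tr a k"
    by (subst inner_tr_commute) (simp add: inner_tr_fr q_def a)
  finally show ?thesis .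
qed

text \<open>For s \<le> 1 the matrices \<open>stretch Q i s\<close> stay in a ball that does not
  depend on Q, i or s. This controls the parameter about whose sign nothing is known.\<close>

lemma inner_tr_contract_le:
  fixes b :: "real^'n^'n"
  obtains C where "C \<ge> 0" "\<And>Q i s k. orthogonal_matrix Q \<Longrightarrow> 0 < s \<Longrightarrow> s \<le> 1 \<Longrightarrow> transpose k = k \<Longrightarrow>
     inner_tr b (stretch Q i s ** k ** stretch Q i s) \<le> C * norm k"
proof -
  interpret mm: bounded_bilinear "(**) :: real^'n^'n \<Rightarrow> real^'n^'n \<Rightarrow> real^'n^'n"
    by (rule bounded_bilinear_matrix_mult)
  obtain K where K: "K > 0" "\<And>(a :: real^'n^'n) (b :: real^'n^'n). norm (a ** b) \<le> norm a * norm b * K"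
    using mm.pos_bounded by blast
  define N where "N = norm (mat 1 :: real^'n^'n) + 1"
  have N: "N \<ge> 0" by (simp add: N_def)
  show thesis
  proof (rule that[of "norm b * (N * K * N * K)"])
    show "norm b * (N * K * N * K) \<ge> 0" using N K by simp
    fix Q :: "real^'n^'n" and i and s :: real and k :: "real^'n^'n"
    assume Q: "orthogonal_matrix Q" and s: "0 < s" "s \<le> 1" and k: "transpose k = k"
    let ?g = "stretch Q i s"
    have "norm (column i Q) = 1" using Q by (simp add: orthogonal_matrix_orthonormal_columns)
    then have "norm ((s - 1) *\<^sub>R outer (column i Q) (column i Q)) \<le> 1" using s by (simp add: norm_outer)
    then have g: "norm ?g \<le> N"
      unfolding stretch_outer[OF Q] N_def by (meson norm_triangle_ineq order_trans add_left_mono)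
    have "norm (?g ** k ** ?g) \<le> norm (?g ** k) * norm ?g * K" by (rule K)
    also have "\<dots> \<le> (norm ?g * norm k * K) * norm ?g * K" using K by (intro mult_right_mono) auto
    also have "\<dots> \<le> (N * norm k * K) * N * K"
      using g N K by (intro mult_right_mono mult_mono) auto
    finally have n: "norm (?g ** k ** ?g) \<le> N * K * N * K * norm k" by (simp add: algebra_simps)
    have "transpose (?g ** k ** ?g) = ?g ** k ** ?g"
      using transpose_congruence[OF k, of ?g] by (simp add: transpose_stretch)
    from inner_tr_abs_le[OF this, of b] have "inner_tr b (?g ** k ** ?g) \<le> norm b * norm (?g ** k ** ?g)" by linarith
    also have "\<dots> \<le> norm b * (N * K * N * K * norm k)" using n by (rule mult_left_mono) simp
    finally show "inner_tr b (?g ** k ** ?g) \<le> norm b * (N * K * N * K) * norm k" by (simp add: mult.assoc)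
  qed
qed


text \<open>h has finite values, so the sets where h > n decrease to the empty set, and a finite
  measure is continuous from above.\<close>

lemma tail_mass_zero:
  assumes [measurable]: "f \<in> borel_measurable M" "h \<in> borel_measurable M"
    and fin: "(\<integral>\<^sup>+x. f x \<partial>M) < \<infinity>"
    and c: "\<And>n::nat. c \<le> (\<integral>\<^sup>+x. f x * indicator {x. h x > real n} x \<partial>M)"
  shows "c = 0"
proof -
  define A where "A n = {x \<in> space M. h x > real n}" for n :: nat
  have A[measurable]: "A n \<in> sets M" for n unfolding A_def by measurable
  have eA: "emeasure (density M f) (A n) = (\<integral>\<^sup>+x. f x * indicator {x. h x > real n} x \<partial>M)" for n
    by (subst emeasure_density) (auto intro!: nn_integral_cong simp: A_def indicator_def)
  have "(\<integral>\<^sup>+x. f x * indicator {x. h x > real n} x \<partial>M) \<le> (\<integral>\<^sup>+x. f x \<partial>M)" for n :: nat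
    by (intro nn_integral_mono) (auto simp: indicator_def)
  then have finA: "emeasure (density M f) (A n) \<noteq> \<infinity>" for n
    unfolding eA using fin by (metis infinity_ennreal_def not_less top.extremum)
  have "(\<lambda>n. emeasure (density M f) (A n)) \<longlonglongrightarrow> emeasure (density M f) (\<Inter>n. A n)"
    by (rule Lim_emeasure_decseq) (use finA in \<open>auto simp: decseq_def A_def\<close>)
  moreover have "(\<Inter>n. A n) = {}"
  proof -
    have "\<exists>n. x \<notin> A n" for x using real_arch_simple[of "h x"] by (auto simp: A_def not_less)
    then show ?thesis by blast
  qed
  ultimately have "(\<lambda>n. emeasure (density M f) (A n)) \<longlonglongrightarrow> 0" by simp
  then have "c \<le> 0" by (rule LIMSEQ_le_const) (use c eA in auto)
  then show ?thesis by simp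
qed

text \<open>A neighbourhood of the identity in the cone on which k and k^-1 are bounded; N exceeds
  the norm of the identity so that the identity belongs to it. The window from 1/2 to 2 around e . e
  = 1 later locates the stretched copies.\<close>

lemma emeasure_pd_nbhd_one_pos:
  fixes e :: "(real, 'n::{finite,linorder}) vec"
  assumes "e \<bullet> e = 1"
  defines "N \<equiv> norm (mat 1 :: ((real, 'n) vec, 'n) vec) + 1"
  shows "emeasure leb_sym {k \<in> pd_mats. norm k < N \<and> norm (matrix_inv k) < N \<and> 1/2 < e \<bullet> (k *v e) \<and> e \<bullet> (k *v e) < 2} > 0"
    and "{k \<in> pd_mats. norm k < N \<and> norm (matrix_inv k) < N \<and> 1/2 < e \<bullet> (k *v e) \<and> e \<bullet> (k *v e) < 2} \<in> sets borel"
proof -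
  let ?K = "{k \<in> pd_mats. norm k < N \<and> norm (matrix_inv k) < N \<and> 1/2 < e \<bullet> (k *v e) \<and> e \<bullet> (k *v e) < 2}"
  let ?D = "{A :: ((real, 'n) vec, 'n) vec. det A \<noteq> 0}"
  have cont: "continuous_on UNIV (\<lambda>k :: ((real, 'n) vec, 'n) vec. e \<bullet> (k *v e))"
    unfolding inner_matrix_outer by (intro continuous_intros)
  have opD: "open ?D" by (rule open_Collect_neq) (intro continuous_intros)+
  have op2: "open (?D \<inter> matrix_inv -` ball 0 N)"
    by (rule continuous_open_preimage[OF continuous_on_matrix_inv opD open_ball])
  define U where "U = {M. sympart M \<in> pd_mats} \<inter> ball 0 N \<inter> (?D \<inter> matrix_inv -` ball 0 N)
     \<inter> {k. 1/2 < e \<bullet> (k *v e)} \<inter> {k. e \<bullet> (k *v e) < 2}"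
  have U: "open U"
    unfolding U_def by (intro open_Int open_sympart_pd open_ball op2 open_Collect_less cont continuous_intros)
  have i1: "matrix_inv (mat 1 :: ((real, 'n) vec, 'n) vec) = mat 1" by (rule matrix_inv_eqI) simp
  have "mat 1 \<in> U" using one_pd by (simp add: U_def N_def i1 assms(1) sympart_id)
  then have pos: "emeasure leb_sym U > 0" by (intro emeasure_leb_sym_open_pos[OF U]) auto
  have KU: "?K = {M. transpose M = M} \<inter> U"
    by (auto simp: U_def sympart_id pd_sym dest: det_pd_pos)
  have cl: "closed {M :: ((real, 'n) vec, 'n) vec. transpose M = M}" by (intro closed_Collect_eq continuous_intros)
  show Km: "?K \<in> sets borel" unfolding KU using cl U by (intro sets.Int borel_closed borel_open)
  have sy: "AE M in leb_sym. transpose M = (M :: ((real, 'n) vec, 'n) vec)"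
    unfolding leb_sym_eq
    by (subst AE_distr_iff) (auto simp: transpose_symu intro!: borel_closed closed_Collect_eq continuous_intros)
  have "emeasure leb_sym U = emeasure leb_sym ?K"
  proof (rule emeasure_eq_AE)
    show "AE M in leb_sym. M \<in> U \<longleftrightarrow> M \<in> ?K" unfolding KU using sy by eventually_elim simp
    show "U \<in> sets leb_sym" using U by (simp add: borel_open)
    show "?K \<in> sets leb_sym" using Km by (simp only: sets_leb_sym)
  qed
  with pos show "emeasure leb_sym ?K > 0" by simp
qed

lemma measurable_mgig_dens[measurable]:
  fixes a b :: "((real, 'n::{finite,linorder}) vec, 'n) vec"
  shows "mgig_dens lam a b \<in> borel_measurable borel"
proof -
  have tr: "(\<lambda>x. trace (f x)) \<in> borel_measurable borel" if "f \<in> borel_measurable borel"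
    for f :: "((real, 'n) vec, 'n) vec \<Rightarrow> ((real, 'n) vec, 'n) vec"
  proof -
    have "continuous_on UNIV (trace :: ((real, 'n) vec, 'n) vec \<Rightarrow> real)"
      unfolding trace_def by (intro continuous_intros)
    then show ?thesis using that by (rule borel_measurable_continuous_on)
  qed
  have 1: "(\<lambda>x. inner_tr a x) \<in> borel_measurable borel" unfolding inner_tr_def by (rule tr) measurable
  have 2: "(\<lambda>x. inner_tr b (matrix_inv x)) \<in> borel_measurable borel" unfolding inner_tr_def by (rule tr) measurable
  have 3: "mgig_dens lam a b = (\<lambda>x. indicator pd_mats x * det x powr (lam - (real CARD('n) + 1) / 2)
       * exp (- inner_tr a x - inner_tr b (matrix_inv x)))" by (simp add: mgig_dens_def fun_eq_iff)
  show ?thesis unfolding 3 using 1 2 by measurable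
qed

text \<open>The matrices \<open>g k g\<close> with \<open>g = stretch Q i t\<close> and \<open>k\<close> in a fixed neighbourhood of the identity carry mass of order \<open>t powr (2 * lam)\<close>
  as long as the exponent stays bounded.\<close>

lemma mgig_shell_mass:
  fixes a b Q :: "((real, 'n::{finite,linorder}) vec, 'n) vec" and i :: 'n and T :: "real set" and lam C1 C2 :: real
  assumes Q: "orthogonal_matrix Q"
  defines "N \<equiv> norm (mat 1 :: ((real, 'n) vec, 'n) vec) + 1" and "e \<equiv> column i Q"
  assumes T: "\<And>t. t \<in> T \<Longrightarrow> t > 0 \<and> t powr (2 * lam) \<ge> 1"
    and bnd: "\<And>t k. t \<in> T \<Longrightarrow> k \<in> pd_mats \<Longrightarrow> norm k < N \<Longrightarrow> norm (matrix_inv k) < N \<Longrightarrow>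
        inner_tr a (stretch Q i t ** k ** stretch Q i t) \<le> C1
        \<and> inner_tr b (stretch Q i (1 / t) ** matrix_inv k ** stretch Q i (1 / t)) \<le> C2"
  obtains c where "c > 0" "\<And>t. t \<in> T \<Longrightarrow> c \<le> (\<integral>\<^sup>+x. ennreal (mgig_dens lam a b x)
      * indicator {x. t^2 / 2 < e \<bullet> (x *v e) \<and> e \<bullet> (x *v e) < 2 * t^2} x \<partial>leb_sym)"
proof -
  have ee: "e \<bullet> e = 1" unfolding e_def using Q by (simp add: orthogonal_matrix_orthonormal_columns dot_square_norm)
  let ?K = "{k \<in> pd_mats. norm k < N \<and> norm (matrix_inv k) < N \<and> 1/2 < e \<bullet> (k *v e) \<and> e \<bullet> (k *v e) < 2}"
  have Kpos: "emeasure leb_sym ?K > 0" and Km: "?K \<in> sets borel"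
    unfolding N_def using emeasure_pd_nbhd_one_pos[OF ee] by blast+
  define p where "p = lam - (real CARD('n) + 1) / 2"
  have "compact (det ` cball (0 :: ((real, 'n) vec, 'n) vec) N)"
    by (intro compact_continuous_image continuous_intros compact_cball)
  then have "bounded (det ` cball (0 :: ((real, 'n) vec, 'n) vec) N)" by (rule compact_imp_bounded)
  then obtain M0 where "\<forall>x\<in>det ` cball (0 :: ((real, 'n) vec, 'n) vec) N. norm x \<le> M0"
    unfolding bounded_iff by blast
  then have M0: "\<bar>det k\<bar> \<le> M0" if "norm k \<le> N" for k :: "((real, 'n) vec, 'n) vec"
    using that by auto
  \<comment> \<open>Bounds both det k and 1 / det k, the latter because k^-1 lies in the same ball;
    the maximum with 1 keeps ln M1 nonnegative.\<close>
  define M1 where "M1 = max M0 1"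
  have M1: "M1 \<ge> 1" "\<And>k :: ((real, 'n) vec, 'n) vec. norm k \<le> N \<Longrightarrow> \<bar>det k\<bar> \<le> M1"
    using M0 by (auto simp: M1_def le_max_iff_disj)
  define c0 where "c0 = exp (- \<bar>p\<bar> * ln M1) * exp (- C1 - C2)"
  have c0: "c0 > 0" by (simp add: c0_def)
  have low: "c0 \<le> mgig_dens lam a b (stretch Q i t ** k ** stretch Q i t) * jac (stretch Q i t)
      \<and> t^2 / 2 < e \<bullet> ((stretch Q i t ** k ** stretch Q i t) *v e) \<and> e \<bullet> ((stretch Q i t ** k ** stretch Q i t) *v e) < 2 * t^2"
    if t: "t \<in> T" and kK: "k \<in> ?K" for t k
  proof -
    let ?g = "stretch Q i t" and ?h = "stretch Q i (1 / t)"
    let ?x = "?g ** k ** ?g"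
    have t0: "t > 0" and t1: "t powr (2 * lam) \<ge> 1" using T[OF t] by auto
    have k: "k \<in> pd_mats" "norm k < N" "norm (matrix_inv k) < N" "1/2 < e \<bullet> (k *v e)" "e \<bullet> (k *v e) < 2" using kK by auto
    have gi: "invertible ?g" "matrix_inv ?g = ?h" using matrix_inv_eqI[OF stretch_mult_inverse[OF Q t0]] by auto
    have x: "?x \<in> pd_mats" using pd_congruence[OF gi(1) k(1)] by (simp add: transpose_stretch)
    have xi: "matrix_inv ?x = ?h ** matrix_inv k ** ?h"
      by (simp add: matrix_inv_mult invertible_mult gi pd_invertible[OF k(1)] matrix_mul_assoc)
    have dx: "det ?x = t^2 * det k" by (simp add: det_mul det_stretch[OF Q] power2_eq_square)
    have dk: "det k > 0" using det_pd_pos[OF k(1)] .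
    have dk1: "det k \<le> M1" using M1(2)[of k] k(2) dk by simp
    have dk2: "1 / det k \<le> M1"
      using M1(2)[of "matrix_inv k"] k(3) dk by (simp add: det_matrix_inv pd_invertible[OF k(1)])
    have lnb: "\<bar>ln (det k)\<bar> \<le> ln M1"
    proof -
      have "ln (det k) \<le> ln M1" using dk1 dk M1(1) by simp
      moreover have "ln (1 / det k) \<le> ln M1" using dk2 dk M1(1) by (subst ln_le_cancel_iff) auto
      then have "- ln (det k) \<le> ln M1" using dk by (simp add: ln_div)
      ultimately show ?thesis by linarith
    qed
    have "\<bar>p * ln (det k)\<bar> \<le> \<bar>p\<bar> * ln M1" unfolding abs_mult using lnb by (intro mult_left_mono) auto
    then have detp: "exp (- \<bar>p\<bar> * ln M1) \<le> det k powr p"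
      using dk by (simp add: powr_def)
    have ex: "exp (- C1 - C2) \<le> exp (- inner_tr a ?x - inner_tr b (matrix_inv ?x))"
      using bnd[OF t k(1-3)] unfolding xi by simp
    \<comment> \<open>The determinant contributes t^(2 lam - (r + 1)) and the Jacobian t^(r +
      1).\<close>
    have "det ?x powr p * jac ?g = t powr (2 * lam) * det k powr p"
    proof -
      have "jac ?g = t powr (real CARD('n) + 1)"
        using t0 by (simp add: jac_stretch[OF Q t0] powr_add powr_realpow)
      moreover have "det ?x powr p = t powr (2 * p) * det k powr p"
        unfolding dx using t0 dk by (simp add: powr_mult powr_powr flip: powr_numeral)
      moreover have "t powr (2 * p) * t powr (real CARD('n) + 1) = t powr (2 * lam)"
        unfolding powr_add[symmetric] by (simp add: p_def field_simps)
      ultimately show ?thesis by (simp add: mult_ac)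
    qed
    then have "mgig_dens lam a b ?x * jac ?g = t powr (2 * lam) * det k powr p * exp (- inner_tr a ?x - inner_tr b (matrix_inv ?x))"
      using x by (simp add: mgig_dens_def p_def mult_ac)
    moreover have "1 * exp (- \<bar>p\<bar> * ln M1) * exp (- C1 - C2) \<le> t powr (2 * lam) * det k powr p * exp (- inner_tr a ?x - inner_tr b (matrix_inv ?x))"
      by (intro mult_mono t1 detp ex) auto
    ultimately have A: "c0 \<le> mgig_dens lam a b ?x * jac ?g" by (simp add: c0_def)
    have ge: "?g *v e = t *\<^sub>R e"
      unfolding stretch_outer[OF Q] e_def[symmetric]
      by (simp add: matrix_vector_mult_add_rdistrib outer_mult_vec ee algebra_simps flip: scaleR_matrix_vector_assoc)
    have "e \<bullet> (?x *v e) = t^2 * (e \<bullet> (k *v e))"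
      using inner_congruence[of e ?g k] by (simp add: transpose_stretch ge matrix_vector_mult_scaleR power2_eq_square del: transpose_matrix_vector)
    moreover have "t^2 > 0" using t0 by simp
    ultimately have "t^2 / 2 < e \<bullet> (?x *v e)" "e \<bullet> (?x *v e) < 2 * t^2" using k(4,5) by auto
    with A show ?thesis by blast
  qed
  show thesis
  proof (rule that)
    show "ennreal c0 * emeasure leb_sym ?K > 0" using c0 Kpos by (simp add: ennreal_zero_less_mult_iff)
    fix t assume t: "t \<in> T"
    then have t0: "t > 0" using T by blast
    let ?g = "stretch Q i t"
    let ?R = "{x. t^2 / 2 < e \<bullet> (x *v e) \<and> e \<bullet> (x *v e) < 2 * t^2}"
    have gi: "invertible ?g" using matrix_inv_eqI[OF stretch_mult_inverse[OF Q t0]] by auto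
    have cont: "continuous_on UNIV (\<lambda>k :: ((real, 'n) vec, 'n) vec. e \<bullet> (k *v e))"
      unfolding inner_matrix_outer by (intro continuous_intros)
    have o1: "open {x :: ((real, 'n) vec, 'n) vec. t^2 / 2 < e \<bullet> (x *v e)}"
      by (rule open_Collect_less[OF continuous_on_const cont])
    have o2: "open {x :: ((real, 'n) vec, 'n) vec. e \<bullet> (x *v e) < 2 * t^2}"
      by (rule open_Collect_less[OF cont continuous_on_const])
    have "?R = {x. t^2 / 2 < e \<bullet> (x *v e)} \<inter> {x. e \<bullet> (x *v e) < 2 * t^2}" by blast
    with open_Int[OF o1 o2] have "open ?R" by (simp only:)
    then have Rm[measurable]: "?R \<in> sets borel" by (rule borel_open)
    let ?F = "\<lambda>x. ennreal (mgig_dens lam a b x) * indicator ?R x"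
    have "ennreal c0 * emeasure leb_sym ?K = (\<integral>\<^sup>+k. ennreal c0 * indicator ?K k \<partial>leb_sym)"
      by (rule nn_integral_cmult_indicator[symmetric]) (simp only: sets_leb_sym Km)
    also have "\<dots> \<le> (\<integral>\<^sup>+k. ?F (?g ** k ** transpose ?g) * ennreal (jac ?g) * indicator pd_mats k \<partial>leb_sym)"
    proof (rule nn_integral_mono)
      fix k :: "((real, 'n) vec, 'n) vec"
      show "ennreal c0 * indicator ?K k \<le> ?F (?g ** k ** transpose ?g) * ennreal (jac ?g) * indicator pd_mats k"
      proof (cases "k \<in> ?K")
        case True
        from low[OF t this] have l: "c0 \<le> mgig_dens lam a b (?g ** k ** ?g) * jac ?g" and r: "?g ** k ** ?g \<in> ?R" by auto
        have "ennreal c0 \<le> ennreal (mgig_dens lam a b (?g ** k ** ?g)) * ennreal (jac ?g)"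
          using l by (subst ennreal_mult[symmetric]) (auto simp: jac_nonneg mgig_dens_def)
        then show ?thesis using True r by (simp add: transpose_stretch)
      qed simp
    qed
    also have "\<dots> = (\<integral>\<^sup>+x. ?F x * indicator pd_mats x \<partial>leb_sym)"
      by (rule nn_integral_congruence[OF gi, symmetric]) measurable
    also have "\<dots> = (\<integral>\<^sup>+x. ?F x \<partial>leb_sym)"
      by (intro nn_integral_cong) (auto simp: mgig_dens_def indicator_def)
    finally show "ennreal c0 * emeasure leb_sym ?K \<le> (\<integral>\<^sup>+x. ?F x \<partial>leb_sym)" .
  qed
qed

text \<open>Stretching by t \<ge> 1 along an eigenvector of a with eigenvalue \<le> 0 keeps the
  exponent bounded below. For lam \<ge> 0, shells with e . x e of order t^2 would then hold a fixed
  mass arbitrarily far out.\<close>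

lemma mgig_first_parameter:
  fixes a b :: "((real, 'n::{finite,linorder}) vec, 'n) vec"
  assumes sym: "transpose a = a" and fin: "(\<integral>\<^sup>+x. ennreal (mgig_dens lam a b x) \<partial>leb_sym) < \<infinity>"
    and npd: "a \<notin> pd_mats"
  shows "lam < 0"
proof (rule ccontr)
  assume "\<not> lam < 0"
  then have lam: "lam \<ge> 0" by simp
  define N where "N = norm (mat 1 :: ((real, 'n) vec, 'n) vec) + 1"
  obtain Q \<mu> where Q: "orthogonal_matrix Q" and a: "a = fr Q \<mu>"
    using spectral_decomposition[OF sym] unfolding fr_def by metis
  obtain i where i: "\<mu> i \<le> 0"
    using npd fr_pd_iff[OF invertible_orthogonal[OF Q], of \<mu>] unfolding a by (metis not_le)
  obtain C where C: "C \<ge> 0" "\<And>Q i s k. orthogonal_matrix Q \<Longrightarrow> 0 < s \<Longrightarrow> s \<le> 1 \<Longrightarrow> transpose k = k \<Longrightarrow>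
     inner_tr b (stretch Q i s ** k ** stretch Q i s) \<le> C * norm k" using inner_tr_contract_le by blast
  define e where "e = column i Q"
  obtain c where c: "c > 0" "\<And>t. t \<in> {1..} \<Longrightarrow> c \<le> (\<integral>\<^sup>+x. ennreal (mgig_dens lam a b x)
      * indicator {x. t^2 / 2 < e \<bullet> (x *v e) \<and> e \<bullet> (x *v e) < 2 * t^2} x \<partial>leb_sym)"
    unfolding e_def
  proof (rule mgig_shell_mass[OF Q, where T = "{1..}" and i = i and lam = lam and a = a and b = b and ?C1.0 = "norm a * N" and ?C2.0 = "C * N"])
    show "t > 0 \<and> t powr (2 * lam) \<ge> 1" if "t \<in> {1..}" for t using that lam by (auto simp: ge_one_powr_ge_zero)
    fix t :: real and k :: "((real, 'n) vec, 'n) vec"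
    assume t: "t \<in> {1..}" and k: "k \<in> pd_mats" "norm k < norm (mat 1 :: ((real, 'n) vec, 'n) vec) + 1"
      "norm (matrix_inv k) < norm (mat 1 :: ((real, 'n) vec, 'n) vec) + 1"
    have "inner_tr a (stretch Q i t ** k ** stretch Q i t) \<le> inner_tr a k"
      using t by (intro inner_tr_stretch_le[OF Q a i _ k(1)]) simp
    also have "\<dots> \<le> norm a * norm k" using inner_tr_abs_le[OF pd_sym[OF k(1)], of a] by linarith
    also have "\<dots> \<le> norm a * N" using k(2) by (intro mult_left_mono) (auto simp: N_def)
    finally have 1: "inner_tr a (stretch Q i t ** k ** stretch Q i t) \<le> norm a * N" .
    have "inner_tr b (stretch Q i (1 / t) ** matrix_inv k ** stretch Q i (1 / t)) \<le> C * norm (matrix_inv k)"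
      using t by (intro C(2)[OF Q]) (auto simp: pd_sym[OF pd_inv[OF k(1)]])
    also have "\<dots> \<le> C * N" using k(3) C(1) by (intro mult_left_mono) (auto simp: N_def)
    finally show "inner_tr a (stretch Q i t ** k ** stretch Q i t) \<le> norm a * N
      \<and> inner_tr b (stretch Q i (1 / t) ** matrix_inv k ** stretch Q i (1 / t)) \<le> C * N" using 1 by blast
  qed blast
  have "continuous_on UNIV (\<lambda>x :: ((real, 'n) vec, 'n) vec. e \<bullet> (x *v e))"
    unfolding inner_matrix_outer by (intro continuous_intros)
  then have hm: "(\<lambda>x :: ((real, 'n) vec, 'n) vec. e \<bullet> (x *v e)) \<in> borel_measurable leb_sym"
    by (simp add: borel_measurable_continuous_onI measurable_cong_sets[OF sets_leb_sym refl])
  have "c = 0"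
  proof (rule tail_mass_zero[OF _ hm fin])
    fix n :: nat
    \<comment> \<open>Since (n + 1)^2 / 2 \<ge> n, the shell lies beyond level n.\<close>
    define t where "t = real n + 1"
    have t: "t \<ge> 1" "real n \<le> t^2 / 2" by (auto simp: t_def power2_eq_square algebra_simps)
    have "c \<le> (\<integral>\<^sup>+x. ennreal (mgig_dens lam a b x)
      * indicator {x. t^2 / 2 < e \<bullet> (x *v e) \<and> e \<bullet> (x *v e) < 2 * t^2} x \<partial>leb_sym)" using c(2) t(1) by simp
    also have "\<dots> \<le> (\<integral>\<^sup>+x. ennreal (mgig_dens lam a b x) * indicator {x. real n < e \<bullet> (x *v e)} x \<partial>leb_sym)"
      using t(2) by (intro nn_integral_mono mult_left_mono) (auto simp: indicator_def)
    finally show "c \<le> (\<integral>\<^sup>+x. ennreal (mgig_dens lam a b x) * indicator {x. real n < e \<bullet> (x *v e)} x \<partial>leb_sym)" .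
  qed measurable
  with c(1) show False by simp
qed

text \<open>The mirror image: t \<le> 1 contracts x and stretches x^-1 along an eigenvector of b.
  For lam \<le> 0 a fixed mass would sit where e . x e is arbitrarily small.\<close>

lemma mgig_second_parameter:
  fixes a b :: "((real, 'n::{finite,linorder}) vec, 'n) vec"
  assumes sym: "transpose b = b" and fin: "(\<integral>\<^sup>+x. ennreal (mgig_dens lam a b x) \<partial>leb_sym) < \<infinity>"
    and npd: "b \<notin> pd_mats"
  shows "lam > 0"
proof (rule ccontr)
  assume "\<not> lam > 0"
  then have lam: "lam \<le> 0" by simp
  define N where "N = norm (mat 1 :: ((real, 'n) vec, 'n) vec) + 1"
  obtain Q \<mu> where Q: "orthogonal_matrix Q" and b: "b = fr Q \<mu>"
    using spectral_decomposition[OF sym] unfolding fr_def by metis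
  obtain i where i: "\<mu> i \<le> 0"
    using npd fr_pd_iff[OF invertible_orthogonal[OF Q], of \<mu>] unfolding b by (metis not_le)
  obtain C where C: "C \<ge> 0" "\<And>Q i s k. orthogonal_matrix Q \<Longrightarrow> 0 < s \<Longrightarrow> s \<le> 1 \<Longrightarrow> transpose k = k \<Longrightarrow>
     inner_tr a (stretch Q i s ** k ** stretch Q i s) \<le> C * norm k" using inner_tr_contract_le by blast
  define e where "e = column i Q"
  obtain c where c: "c > 0" "\<And>t. t \<in> {0<..1} \<Longrightarrow> c \<le> (\<integral>\<^sup>+x. ennreal (mgig_dens lam a b x)
      * indicator {x. t^2 / 2 < e \<bullet> (x *v e) \<and> e \<bullet> (x *v e) < 2 * t^2} x \<partial>leb_sym)"
    unfolding e_def
  proof (rule mgig_shell_mass[OF Q, where T = "{0<..1}" and i = i and lam = lam and a = a and b = b and ?C1.0 = "C * N" and ?C2.0 = "norm b * N"])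
    show "t > 0 \<and> t powr (2 * lam) \<ge> 1" if "t \<in> {0<..1}" for t
      using that lam powr_mono'[of "2 * lam" 0 t] by auto
    fix t :: real and k :: "((real, 'n) vec, 'n) vec"
    assume t: "t \<in> {0<..1}" and k: "k \<in> pd_mats" "norm k < norm (mat 1 :: ((real, 'n) vec, 'n) vec) + 1"
      "norm (matrix_inv k) < norm (mat 1 :: ((real, 'n) vec, 'n) vec) + 1"
    have "inner_tr b (stretch Q i (1 / t) ** matrix_inv k ** stretch Q i (1 / t)) \<le> inner_tr b (matrix_inv k)"
      using t by (intro inner_tr_stretch_le[OF Q b i _ pd_inv[OF k(1)]]) simp
    also have "\<dots> \<le> norm b * norm (matrix_inv k)" using inner_tr_abs_le[OF pd_sym[OF pd_inv[OF k(1)]], of b] by linarith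
    also have "\<dots> \<le> norm b * N" using k(3) by (intro mult_left_mono) (auto simp: N_def)
    finally have 1: "inner_tr b (stretch Q i (1 / t) ** matrix_inv k ** stretch Q i (1 / t)) \<le> norm b * N" .
    have "inner_tr a (stretch Q i t ** k ** stretch Q i t) \<le> C * norm k"
      using t by (intro C(2)[OF Q]) (auto simp: pd_sym[OF k(1)])
    also have "\<dots> \<le> C * N" using k(2) C(1) by (intro mult_left_mono) (auto simp: N_def)
    finally show "inner_tr a (stretch Q i t ** k ** stretch Q i t) \<le> C * N
      \<and> inner_tr b (stretch Q i (1 / t) ** matrix_inv k ** stretch Q i (1 / t)) \<le> norm b * N" using 1 by blast
  qed blast
  have "continuous_on UNIV (\<lambda>x :: ((real, 'n) vec, 'n) vec. e \<bullet> (x *v e))"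
    unfolding inner_matrix_outer by (intro continuous_intros)
  then have hm0: "(\<lambda>x :: ((real, 'n) vec, 'n) vec. e \<bullet> (x *v e)) \<in> borel_measurable leb_sym"
    by (simp add: borel_measurable_continuous_onI measurable_cong_sets[OF sets_leb_sym refl])
  then have hm: "(\<lambda>x :: ((real, 'n) vec, 'n) vec. 1 / (e \<bullet> (x *v e))) \<in> borel_measurable leb_sym" by measurable
  have "c = 0"
  proof (rule tail_mass_zero[OF _ hm fin])
    fix n :: nat
    \<comment> \<open>Chosen so that e . x e < 2 t^2 makes its reciprocal exceed n, by 2 n \<le> (n
      + 1)^2.\<close>
    define t where "t = 1 / (real n + 1)"
    have t: "t \<in> {0<..1}" by (auto simp: t_def)
    have tn: "real n * (2 * t^2) \<le> 1"
    proof -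
      have "real n * 2 \<le> (real n + 1)^2" by (simp add: power2_eq_square algebra_simps)
      then show ?thesis by (simp add: t_def power_divide)
    qed
    have "real n < 1 / z" if "t^2 / 2 < z" "z < 2 * t^2" for z
    proof -
      have "t^2 / 2 \<ge> 0" by simp
      then have z: "z > 0" using that(1) by linarith
      have "real n * z < 1"
      proof (cases "n = 0")
        case False
        then have "real n * z < real n * (2 * t^2)" using that(2) by simp
        then show ?thesis using tn by linarith
      qed simp
      then show ?thesis using z by (simp add: field_simps)
    qed
    then have sub: "{x. t^2 / 2 < e \<bullet> (x *v e) \<and> e \<bullet> (x *v e) < 2 * t^2} \<subseteq> {x. real n < 1 / (e \<bullet> (x *v e))}" by blast
    have "c \<le> (\<integral>\<^sup>+x. ennreal (mgig_dens lam a b x)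
      * indicator {x. t^2 / 2 < e \<bullet> (x *v e) \<and> e \<bullet> (x *v e) < 2 * t^2} x \<partial>leb_sym)" using c(2)[OF t] .
    also have "\<dots> \<le> (\<integral>\<^sup>+x. ennreal (mgig_dens lam a b x) * indicator {x. real n < 1 / (e \<bullet> (x *v e))} x \<partial>leb_sym)"
      using sub by (intro nn_integral_mono mult_left_mono) (auto simp: indicator_def)
    finally show "c \<le> (\<integral>\<^sup>+x. ennreal (mgig_dens lam a b x) * indicator {x. real n < 1 / (e \<bullet> (x *v e))} x \<partial>leb_sym)" .
  qed measurable
  with c(1) show False by simp
qed

lemma scaleR_pd_iff: "\<gamma> > 0 \<Longrightarrow> \<gamma> *\<^sub>R a \<in> pd_mats \<longleftrightarrow> a \<in> pd_mats"
  using pd_scaleR[of a \<gamma>] pd_scaleR[of "\<gamma> *\<^sub>R a" "1 / \<gamma>"] by auto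

text \<open>Each of a and b is, up to the factor \<gamma>, the first parameter of one density and
  the second of the other. Failing to be positive definite would give lam < 0 and lam > 0 at
  once.\<close>

lemma mgig_parameters_pd:
  fixes a b :: "((real, 'n::{finite,linorder}) vec, 'n) vec"
  assumes sym: "transpose a = a" "transpose b = b" and "\<gamma> > 0"
    and f1: "(\<integral>\<^sup>+x. ennreal (mgig_dens lam (\<gamma> *\<^sub>R a) b x) \<partial>leb_sym) < \<infinity>"
    and f2: "(\<integral>\<^sup>+x. ennreal (mgig_dens lam (\<gamma> *\<^sub>R b) a x) \<partial>leb_sym) < \<infinity>"
  shows "a \<in> pd_mats" "b \<in> pd_mats"
proof -
  have s: "transpose (\<gamma> *\<^sub>R a) = \<gamma> *\<^sub>R a" "transpose (\<gamma> *\<^sub>R b) = \<gamma> *\<^sub>R b" using sym by (simp_all add: transpose_scalar)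
  show "a \<in> pd_mats"
    using mgig_first_parameter[OF s(1) f1] mgig_second_parameter[OF sym(1) f2] scaleR_pd_iff[OF \<open>\<gamma> > 0\<close>, of a] by force
  show "b \<in> pd_mats"
    using mgig_first_parameter[OF s(2) f2] mgig_second_parameter[OF sym(2) f1] scaleR_pd_iff[OF \<open>\<gamma> > 0\<close>, of b] by force
qed

section \<open>Proof of the characterization\<close>

text \<open>A linear right inverse of \<open>sym_of_vec\<close> on symmetric matrices. It lifts
  lines of symmetric matrices to lines in the coordinate space where twice differentiability is
  stated.\<close>

definition vecu :: "real^'n^'n \<Rightarrow> real^('n \<times> 'n)" where
  "vecu M = (\<chi> p. M $ fst p $ snd p)"

lemma linear_vecu: "linear vecu"
  by (rule linearI) (auto simp: vecu_def vec_eq_iff)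

lemma sym_of_vec_vecu:
  fixes M :: "((real, 'n::{finite,linorder}) vec, 'n) vec"
  assumes "transpose M = M"
  shows "sym_of_vec (vecu M) = M"
proof -
  have "M $ j $ i = M $ i $ j" for i j
    using assms by (metis transpose_def vec_lambda_beta)
  then show ?thesis by (auto simp: sym_of_vec_def sym_of_fun_def vecu_def vec_eq_iff)
qed

lemma twice_differentiable_imp_twice_along_ln:
  fixes f :: "((real, 'n::{finite,linorder}) vec, 'n) vec \<Rightarrow> real"
  assumes "twice_differentiable_on_pd f" and pos: "\<forall>x\<in>pd_mats. f x > 0"
  shows "twice_along (\<lambda>x. ln (f x))"
  unfolding twice_along_def
proof (intro allI impI)
  fix x h :: "((real, 'n) vec, 'n) vec"
  assume x: "transpose x = x" and h: "transpose h = h"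
  obtain f' :: "(real, 'n \<times> 'n) vec \<Rightarrow> (real, 'n \<times> 'n) vec \<Rightarrow>\<^sub>L real" where
    f1: "\<And>v. sym_of_vec v \<in> pd_mats \<Longrightarrow> ((f \<circ> sym_of_vec) has_derivative blinfun_apply (f' v)) (at v)" and
    f2: "\<And>v. sym_of_vec v \<in> pd_mats \<Longrightarrow> f' differentiable (at v)"
    using assms(1) unfolding twice_differentiable_on_pd_def twice_differentiable_on_def by blast
  define \<gamma> where "\<gamma> t = vecu x + t *\<^sub>R vecu h" for t
  have s: "sym_of_vec (\<gamma> t) = x + t *\<^sub>R h" for t
  proof -
    have "\<gamma> t = vecu (x + t *\<^sub>R h)" by (simp add: \<gamma>_def linear_add[OF linear_vecu] linear_scale[OF linear_vecu])
    then show ?thesis using x h by (simp add: sym_of_vec_vecu transpose_add transpose_scalar)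
  qed
  have dg: "(\<gamma> has_derivative (\<lambda>s. s *\<^sub>R vecu h)) (at t)" for t
    unfolding \<gamma>_def by (auto intro!: derivative_eq_intros)
  define d1 where "d1 t = blinfun_apply (f' (\<gamma> t)) (vecu h)" for t
  have D1: "((\<lambda>s. f (x + s *\<^sub>R h)) has_real_derivative d1 t) (at t)" if "x + t *\<^sub>R h \<in> pd_mats" for t
  proof -
    have "((\<lambda>s. (f \<circ> sym_of_vec) (\<gamma> s)) has_derivative (\<lambda>s. blinfun_apply (f' (\<gamma> t)) (s *\<^sub>R vecu h))) (at t)"
      by (rule has_derivative_compose[OF dg f1]) (simp add: s that)
    then show ?thesis
      by (simp add: s has_field_derivative_def d1_def blinfun.scaleR_right mult_commute_abs)
  qed
  have "\<exists>d. (d1 has_real_derivative d) (at t)" if "x + t *\<^sub>R h \<in> pd_mats" for t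
  proof -
    have "f' differentiable (at (\<gamma> t))" by (rule f2) (simp add: s that)
    then obtain F where F: "(f' has_derivative F) (at (\<gamma> t))" unfolding differentiable_def by blast
    have "((\<lambda>s. f' (\<gamma> s)) has_derivative (\<lambda>s. F (s *\<^sub>R vecu h))) (at t)"
      by (rule has_derivative_compose[OF dg F])
    then have "((\<lambda>s. blinfun_apply (f' (\<gamma> s)) (vecu h)) has_derivative (\<lambda>s. blinfun_apply (F (s *\<^sub>R vecu h)) (vecu h))) (at t)"
      by (rule bounded_linear.has_derivative[OF blinfun.bounded_linear_left])
    then have "((\<lambda>s. d1 s) has_derivative (\<lambda>s. s * blinfun_apply (F (vecu h)) (vecu h))) (at t)"
      using linear_scale[OF has_derivative_linear[OF F]] by (simp add: d1_def blinfun.scaleR_left)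
    then have "(d1 has_real_derivative blinfun_apply (F (vecu h)) (vecu h)) (at t)"
      by (simp add: has_field_derivative_def mult_commute_abs)
    then show ?thesis by blast
  qed
  then obtain d2 where D2: "\<And>t. x + t *\<^sub>R h \<in> pd_mats \<Longrightarrow> (d1 has_real_derivative d2 t) (at t)" by metis
  let ?f = "\<lambda>s. f (x + s *\<^sub>R h)"
  define F1 where "F1 t = d1 t / ?f t" for t
  define F2 where "F2 t = (d2 t * ?f t - d1 t * d1 t) / (?f t * ?f t)" for t
  have "((\<lambda>s. ln (?f s)) has_real_derivative F1 t) (at t) \<and> (F1 has_real_derivative F2 t) (at t)"
    if p: "x + t *\<^sub>R h \<in> pd_mats" for t
  proof
    have fp: "?f t > 0" using pos p by blast
    show "((\<lambda>s. ln (?f s)) has_real_derivative F1 t) (at t)"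
      using DERIV_chain2[OF DERIV_ln_divide[OF fp] D1[OF p]] by (simp add: F1_def)
    show "(F1 has_real_derivative F2 t) (at t)"
      unfolding F1_def[abs_def] F2_def by (rule DERIV_divide[OF D2[OF p] D1[OF p]]) (use fp in simp)
  qed
  note H = this
  show "\<exists>f1 f2. \<forall>t. x + t *\<^sub>R h \<in> pd_mats \<longrightarrow>
     ((\<lambda>s. ln (f (x + s *\<^sub>R h))) has_real_derivative f1 t) (at t) \<and> (f1 has_real_derivative f2 t) (at t)"
    by (rule exI[of _ F1], rule exI[of _ F2], rule allI, rule impI, erule H)
qed

lemma twice_differentiable_imp_differentiable_sympart:
  fixes f :: "((real, 'n::{finite,linorder}) vec, 'n) vec \<Rightarrow> real"
  assumes "twice_differentiable_on_pd f" and x: "x \<in> pd_mats"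
  shows "(\<lambda>M. f (sympart M)) differentiable (at x)"
proof -
  obtain f' :: "(real, 'n \<times> 'n) vec \<Rightarrow> (real, 'n \<times> 'n) vec \<Rightarrow>\<^sub>L real" where
    f1: "\<And>v. sym_of_vec v \<in> pd_mats \<Longrightarrow> ((f \<circ> sym_of_vec) has_derivative blinfun_apply (f' v)) (at v)"
    using assms(1) unfolding twice_differentiable_on_pd_def twice_differentiable_on_def by blast
  have "linear (\<lambda>M :: ((real, 'n) vec, 'n) vec. vecu (sympart M))"
    using linear_compose[OF linear_sympart linear_vecu] by (simp add: o_def)
  then have d: "((\<lambda>M. vecu (sympart M)) has_derivative (\<lambda>M. vecu (sympart M))) (at x)"
    unfolding linear_conv_bounded_linear by (rule bounded_linear_imp_has_derivative)
  have "sym_of_vec (vecu (sympart x)) \<in> pd_mats"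
    using x by (simp add: sympart_id pd_sym sym_of_vec_vecu)
  from has_derivative_compose[OF d f1[OF this]]
  have "((\<lambda>M. (f \<circ> sym_of_vec) (vecu (sympart M))) has_derivative (\<lambda>M. blinfun_apply (f' (vecu (sympart x))) (vecu (sympart M)))) (at x)" .
  moreover have "(\<lambda>M. (f \<circ> sym_of_vec) (vecu (sympart M))) = (\<lambda>M. f (sympart M))"
    by (simp add: sym_of_vec_vecu transpose_sympart)
  ultimately show ?thesis unfolding differentiable_def by auto
qed

lemma twice_differentiable_imp_continuous_on_pd:
  fixes f :: "((real, 'n::{finite,linorder}) vec, 'n) vec \<Rightarrow> real"
  assumes "twice_differentiable_on_pd f"
  shows "continuous_on pd_mats f"
proof -
  have "continuous_on pd_mats (\<lambda>M. f (sympart M))"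
    by (intro continuous_at_imp_continuous_on ballI differentiable_imp_continuous_within
        twice_differentiable_imp_differentiable_sympart[OF assms])
  then show ?thesis by (rule continuous_on_eq) (simp add: sympart_id pd_sym)
qed

lemma ln_differentiable_sympart:
  fixes f :: "((real, 'n::{finite,linorder}) vec, 'n) vec \<Rightarrow> real"
  assumes "twice_differentiable_on_pd f" and pos: "\<forall>x\<in>pd_mats. f x > 0" and x: "x \<in> pd_mats"
  shows "(\<lambda>M. ln (f (sympart M))) differentiable (at x)"
proof -
  obtain D where D: "((\<lambda>M. f (sympart M)) has_derivative D) (at x)"
    using twice_differentiable_imp_differentiable_sympart[OF assms(1) x] unfolding differentiable_def by blast
  have "f (sympart x) > 0" using pos x by (simp add: sympart_id pd_sym)
  then show ?thesis using has_derivative_ln[OF _ D] unfolding differentiable_def by blast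
qed

text \<open>x y need not be symmetric, but 1 + \<alpha> x y = x (x^-1 + \<alpha> y) is a product of
  two positive definite matrices.\<close>

lemma invertible_one_plus_pd_mult:
  fixes x y :: "real^'n^'n"
  assumes "x \<in> pd_mats" "y \<in> pd_mats" "\<alpha> \<ge> 0"
  shows "invertible (mat 1 + \<alpha> *\<^sub>R (x ** y))"
proof -
  have "matrix_inv x + \<alpha> *\<^sub>R y \<in> pd_mats"
    using assms by (cases "\<alpha> = 0") (auto intro!: pd_add pd_inv pd_scaleR)
  then have "invertible (x ** (matrix_inv x + \<alpha> *\<^sub>R y))"
    using assms(1) by (intro invertible_mult pd_invertible)
  moreover have "x ** (matrix_inv x + \<alpha> *\<^sub>R y) = mat 1 + \<alpha> *\<^sub>R (x ** y)"
    by (simp add: matrix_add_ldistrib matrix_scaleR_right matrix_inv_both pd_invertible[OF assms(1)])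
  ultimately show ?thesis by simp
qed

lemma continuous_on_phi:
  assumes "\<alpha> \<ge> 0" "\<beta> \<ge> 0"
  shows "continuous_on (pd_mats \<times> pd_mats) (\<lambda>z. phi \<alpha> \<beta> (fst z) (snd z :: real^'n^'n))"
proof -
  have inv: "continuous_on (pd_mats \<times> pd_mats) (\<lambda>z. matrix_inv (mat 1 + \<gamma> *\<^sub>R (fst z ** (snd z :: real^'n^'n))))"
    "continuous_on (pd_mats \<times> pd_mats) (\<lambda>z. matrix_inv (mat 1 + \<gamma> *\<^sub>R (snd z ** (fst z :: real^'n^'n))))"
    if "\<gamma> \<ge> 0" for \<gamma>
    by (rule continuous_on_compose2[OF continuous_on_matrix_inv];
        auto intro!: continuous_intros invertible_one_plus_pd_mult that simp flip: invertible_det_nz)+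
  show ?thesis unfolding phi_def by (intro continuous_intros inv assms)
qed

lemma phi_swap: "phi \<beta> \<alpha> y x = prod.swap (phi \<alpha> \<beta> x y)"
  by (simp add: phi_def)

text \<open>If \<alpha> = 0 then \<beta> > 0, and by \<open>phi_swap\<close> the equation is
  unchanged when \<alpha>, A, C trade places with \<beta>, B, D. The conclusion has the same
  symmetry, with a and b exchanged.\<close>

lemma matrix_functional_equation:
  fixes A B C D :: "real^'n^'n \<Rightarrow> real"
  assumes ab: "\<alpha> \<ge> 0" "\<beta> \<ge> 0" "\<alpha> \<noteq> \<beta>"
    and tw: "twice_along A" "twice_along B"
    and diff: "\<And>x. x \<in> pd_mats \<Longrightarrow> (\<lambda>M. A (sympart M)) differentiable (at x)"
      "\<And>x. x \<in> pd_mats \<Longrightarrow> (\<lambda>M. B (sympart M)) differentiable (at x)"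
    and eq: "\<And>x y. x \<in> pd_mats \<Longrightarrow> y \<in> pd_mats \<Longrightarrow>
      A x + B y = C (fst (phi \<alpha> \<beta> x y)) + D (snd (phi \<alpha> \<beta> x y))"
  obtains \<kappa> a b cA cB where "transpose a = a" "transpose b = b"
    "\<And>x. x \<in> pd_mats \<Longrightarrow> A x = \<kappa> * ln (det x) - \<alpha> * inner_tr a x - inner_tr b (matrix_inv x) + cA"
    "\<And>y. y \<in> pd_mats \<Longrightarrow> B y = \<kappa> * ln (det y) - \<beta> * inner_tr b y - inner_tr a (matrix_inv y) + cB"
proof (cases "\<alpha> > 0")
  case True
  interpret matrix_equation_diff \<alpha> \<beta> A B C D
    by standard (use True ab tw diff eq in auto)
  show thesis by (rule solution) (rule that)
next
  case False
  then have "\<beta> > 0" using ab by auto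
  interpret matrix_equation_diff \<beta> \<alpha> B A D C
    by standard (use \<open>\<beta> > 0\<close> ab tw diff eq in \<open>auto simp: phi_swap[of \<beta> \<alpha>] add.commute\<close>)
  show thesis by (rule solution) (rule that)
qed

text \<open>Total mass one reads c F G = 1 for the integrals F and G of f and g. Hence both are
  finite and nonzero, and c splits into 1 / F and 1 / G.\<close>

lemma normalized_product_density:
  fixes f g :: "'a \<Rightarrow> real"
  assumes L: "sigma_finite_measure L"
    and f: "f \<in> borel_measurable L" "\<And>x. f x \<ge> 0" and g: "g \<in> borel_measurable L" "\<And>x. g x \<ge> 0" and c: "c > 0"
    and prob: "prob_space (density (L \<Otimes>\<^sub>M L) (\<lambda>z. ennreal (c * (f (fst z) * g (snd z)))))"
  shows "density (L \<Otimes>\<^sub>M L) (\<lambda>z. ennreal (c * (f (fst z) * g (snd z))))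
     = density L (\<lambda>x. ennreal (f x) / (\<integral>\<^sup>+y. ennreal (f y) \<partial>L)) \<Otimes>\<^sub>M density L (\<lambda>x. ennreal (g x) / (\<integral>\<^sup>+y. ennreal (g y) \<partial>L))"
    and "(\<integral>\<^sup>+y. ennreal (f y) \<partial>L) < \<infinity>" "(\<integral>\<^sup>+y. ennreal (g y) \<partial>L) < \<infinity>"
proof -
  interpret L: sigma_finite_measure L by (rule L)
  interpret P: pair_sigma_finite L L ..
  note [measurable] = f(1) g(1)
  let ?F = "\<integral>\<^sup>+y. ennreal (f y) \<partial>L" and ?G = "\<integral>\<^sup>+y. ennreal (g y) \<partial>L"
  have split: "ennreal (c * (f x * g y)) = ennreal c * (ennreal (f x) * ennreal (g y))" for x y
    using c f(2) g(2) by (simp add: ennreal_mult)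
  have "1 = emeasure (density (L \<Otimes>\<^sub>M L) (\<lambda>z. ennreal (c * (f (fst z) * g (snd z))))) (space (L \<Otimes>\<^sub>M L))"
    using prob_space.emeasure_space_1[OF prob] by simp
  also have "\<dots> = (\<integral>\<^sup>+z. ennreal (c * (f (fst z) * g (snd z))) \<partial>(L \<Otimes>\<^sub>M L))"
    by (subst emeasure_density) (auto intro!: nn_integral_cong)
  also have "\<dots> = (\<integral>\<^sup>+x. \<integral>\<^sup>+y. ennreal c * (ennreal (f x) * ennreal (g y)) \<partial>L \<partial>L)"
    by (subst L.nn_integral_fst[symmetric]) (auto simp: split)
  also have "\<dots> = ennreal c * (?F * ?G)"
    by (simp add: nn_integral_cmult nn_integral_multc)
  finally have one: "ennreal c * (?F * ?G) = 1" by simp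
  have F0: "?F \<noteq> 0" and G0: "?G \<noteq> 0" using one by auto
  have cpos: "ennreal c \<noteq> 0" using c by simp
  have FG: "?F \<noteq> \<infinity>" "?G \<noteq> \<infinity>"
    using one F0 G0 cpos by (auto simp: ennreal_mult_eq_top_iff ennreal_top_mult ennreal_mult_top)
  then show "?F < \<infinity>" "?G < \<infinity>" by (auto simp: top.not_eq_extremum)
  obtain F where F: "?F = ennreal F" "F > 0"
    using F0 FG(1) by (cases ?F rule: ennreal_cases) (auto simp: less_le)
  obtain G where G: "?G = ennreal G" "G > 0"
    using G0 FG(2) by (cases ?G rule: ennreal_cases) (auto simp: less_le)
  have cFG: "c * (F * G) = 1"
    using one F G c by (simp add: ennreal_mult[symmetric] flip: ennreal_1)
  have e: "ennreal (f x) / ?F = ennreal (f x / F)" "ennreal (g x) / ?G = ennreal (g x / G)" for x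
    using F G f(2) g(2) by (simp_all add: divide_ennreal)
  have pg: "sigma_finite_measure (density L (\<lambda>x. ennreal (g x / G)))"
    by (subst L.sigma_finite_iff_density_finite) auto
  have "density L (\<lambda>x. ennreal (f x / F)) \<Otimes>\<^sub>M density L (\<lambda>x. ennreal (g x / G))
     = density (L \<Otimes>\<^sub>M L) (\<lambda>(x, y). ennreal (f x / F) * ennreal (g y / G))"
    by (rule pair_measure_density[OF _ _ L pg]) measurable
  also have "\<dots> = density (L \<Otimes>\<^sub>M L) (\<lambda>z. ennreal (c * (f (fst z) * g (snd z))))"
  proof (rule arg_cong[where f = "density (L \<Otimes>\<^sub>M L)"], rule ext)
    fix z :: "'a \<times> 'a"
    have "c = 1 / (F * G)" using cFG F(2) G(2) by (simp add: field_simps)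
    then have "f (fst z) / F * (g (snd z) / G) = c * (f (fst z) * g (snd z))" by simp
    then show "(case z of (x, y) \<Rightarrow> ennreal (f x / F) * ennreal (g y / G)) = ennreal (c * (f (fst z) * g (snd z)))"
      using f(2) g(2) F(2) G(2) by (simp add: case_prod_beta flip: ennreal_mult)
  qed
  finally show "density (L \<Otimes>\<^sub>M L) (\<lambda>z. ennreal (c * (f (fst z) * g (snd z))))
     = density L (\<lambda>x. ennreal (f x) / ?F) \<Otimes>\<^sub>M density L (\<lambda>x. ennreal (g x) / ?G)"
    by (simp add: e)
qed

text \<open>Independence gives a product only almost everywhere, with marginal densities of unknown
  regularity. The cross-ratio form involves h alone, so continuity extends it to all points: first
  in v for almost every u, then in u.\<close>

lemma factorization_from_independence:
  fixes h :: "((real, 'n::{finite,linorder}) vec, 'n) vec \<Rightarrow> ((real, 'n) vec, 'n) vec \<Rightarrow> real"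
  assumes pos: "\<And>u v. u \<in> pd_mats \<Longrightarrow> v \<in> pd_mats \<Longrightarrow> h u v > 0"
    and c1: "\<And>u. u \<in> pd_mats \<Longrightarrow> continuous_on pd_mats (h u)"
    and c2: "\<And>v. v \<in> pd_mats \<Longrightarrow> continuous_on pd_mats (\<lambda>u. h u v)"
    and ae: "AE u in leb_sym. AE v in leb_sym. u \<in> pd_mats \<and> v \<in> pd_mats \<longrightarrow> ennreal (h u v) = fU u * fV v"
  obtains u0 v0 where "u0 \<in> pd_mats" "v0 \<in> pd_mats"
    "\<And>u v. u \<in> pd_mats \<Longrightarrow> v \<in> pd_mats \<Longrightarrow> h u v * h u0 v0 = h u v0 * h u0 v"
proof -
  have ex: "\<exists>x\<in>pd_mats. P x" if P: "AE x in leb_sym. P x" for P :: "((real, 'n) vec, 'n) vec \<Rightarrow> bool"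
  proof (rule ccontr)
    assume n: "\<not> ?thesis"
    have "AE x in (leb_sym :: (((real, 'n) vec, 'n) vec) measure). x \<in> pd_mats \<longrightarrow> (0::real) = 1" using P by (rule eventually_mono) (use n in blast)
    from AE_leb_sym_continuous_eq[OF this _ _ one_pd] show False by auto
  qed
  define good where "good u \<longleftrightarrow> (AE v in leb_sym. u \<in> pd_mats \<and> v \<in> pd_mats \<longrightarrow> ennreal (h u v) = fU u * fV v)" for u
  have ag: "AE u in leb_sym. good u" using ae unfolding good_def .
  have fin: "\<exists>r>0. fU u = ennreal r" if gu: "good u" and up: "u \<in> pd_mats" for u
  proof -
    obtain v where v: "v \<in> pd_mats" "ennreal (h u v) = fU u * fV v"
      using ex[OF gu[unfolded good_def]] up by blast
    have hp: "h u v > 0" by (rule pos[OF up v(1)])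
    then have n0: "fU u * fV v \<noteq> 0" "fU u * fV v \<noteq> \<infinity>" using v(2) by (metis ennreal_eq_0_iff not_le, metis ennreal_neq_top infinity_ennreal_def)
    then have "fU u \<noteq> 0" "fU u \<noteq> \<infinity>" by (auto simp: ennreal_top_mult)
    then show ?thesis by (cases "fU u" rule: ennreal_cases) (auto simp: less_le)
  qed
  obtain u0 where u0: "u0 \<in> pd_mats" "good u0" using ex[OF ag] by blast
  obtain r0 where r0: "r0 > 0" "fU u0 = ennreal r0" using fin[OF u0(2,1)] by blast
  let ?v0 = "mat 1 :: ((real, 'n) vec, 'n) vec"
  have step: "h u v * h u0 ?v0 = h u ?v0 * h u0 v" if u: "good u" "u \<in> pd_mats" and v: "v \<in> pd_mats" for u v
  proof -
    obtain r where r: "r > 0" "fU u = ennreal r" using fin[OF u] by blast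
    have "AE v in leb_sym. v \<in> pd_mats \<longrightarrow> h u v * r0 = h u0 v * r"
      using u(1)[unfolded good_def] u0(2)[unfolded good_def]
    proof eventually_elim
      case (elim v)
      show ?case
      proof
        assume v: "v \<in> pd_mats"
        have "ennreal (h u v) = ennreal r * fV v" "ennreal (h u0 v) = ennreal r0 * fV v"
          using elim v u(2) u0(1) r r0 by auto
        then have "ennreal (h u v) * ennreal r0 = ennreal (h u0 v) * ennreal r" by (simp add: mult_ac)
        then have "ennreal (h u v * r0) = ennreal (h u0 v * r)"
          using r(1) r0(1) pos[OF u(2) v] pos[OF u0(1) v] by (simp add: ennreal_mult less_imp_le)
        then show "h u v * r0 = h u0 v * r"
          using r(1) r0(1) pos[OF u(2) v] pos[OF u0(1) v] by (simp add: less_imp_le)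
      qed
    qed
    note aev = this
    have E: "h u w * r0 = h u0 w * r" if "w \<in> pd_mats" for w
      by (rule AE_leb_sym_continuous_eq[OF aev _ _ that]) (intro continuous_intros c1 u(2) u0(1))+
    have "r0 * (h u v * h u0 ?v0) = (h u v * r0) * h u0 ?v0" by simp
    also have "\<dots> = (h u0 ?v0 * r) * h u0 v" unfolding E[OF v] by simp
    also have "\<dots> = r0 * (h u ?v0 * h u0 v)" unfolding E[OF one_pd, symmetric] by simp
    finally show ?thesis using r0(1) by simp
  qed
  show thesis
  proof (rule that[OF u0(1) one_pd])
    fix u v :: "((real, 'n) vec, 'n) vec" assume u: "u \<in> pd_mats" and v: "v \<in> pd_mats"
    have aeu: "AE u in leb_sym. u \<in> pd_mats \<longrightarrow> h u v * h u0 ?v0 = h u ?v0 * h u0 v"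
      using ag by eventually_elim (use step v in blast)
    show "h u v * h u0 ?v0 = h u ?v0 * h u0 v"
      by (rule AE_leb_sym_continuous_eq[OF aeu _ _ u]) (intro continuous_intros c2 v one_pd)+
  qed
qed

text \<open>As \<open>phi\<close> is an involution, f z equals f (phi w) at w = phi z. The integrand
  thus depends on z through phi z only, and \<open>phi_preserves\<close> applies.\<close>

lemma (in prob_space) distributed_phi:
  fixes X Y :: "'a \<Rightarrow> ((real, 'n::{finite,linorder}) vec, 'n) vec"
  assumes ab: "\<alpha> \<ge> 0" "\<beta> \<ge> 0"
    and pd: "\<And>\<omega>. \<omega> \<in> space M \<Longrightarrow> X \<omega> \<in> pd_mats" "\<And>\<omega>. \<omega> \<in> space M \<Longrightarrow> Y \<omega> \<in> pd_mats"
    and d: "distributed M (leb_sym \<Otimes>\<^sub>M leb_sym) (\<lambda>\<omega>. (X \<omega>, Y \<omega>)) f"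
  shows "distributed M (leb_sym \<Otimes>\<^sub>M leb_sym) (\<lambda>\<omega>. phi \<alpha> \<beta> (X \<omega>) (Y \<omega>))
     (\<lambda>z. f (phi \<alpha> \<beta> (fst z) (snd z)) * indicator (pd_mats \<times> pd_mats) z)"
proof -
  let ?N = "leb_sym \<Otimes>\<^sub>M leb_sym :: (((real, 'n) vec, 'n) vec \<times> ((real, 'n) vec, 'n) vec) measure"
  let ?p = "\<lambda>z. phi \<alpha> \<beta> (fst z) (snd z)" and ?S = "pd_mats \<times> pd_mats"
  have sN: "sets ?N = sets (borel \<Otimes>\<^sub>M borel)" by (rule sets_pair_measure_cong) simp_all
  have f[measurable]: "f \<in> borel_measurable ?N" using d by (rule distributed_borel_measurable)
  have f'[measurable]: "f \<in> borel_measurable (borel \<Otimes>\<^sub>M borel)" using f by (simp cong: measurable_cong_sets add: measurable_cong_sets[OF sN refl])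
  have XY[measurable]: "(\<lambda>\<omega>. (X \<omega>, Y \<omega>)) \<in> measurable M ?N" using d by (rule distributed_measurable)
  have pm: "?p \<in> measurable ?N ?N" using measurable_phi by (simp add: measurable_cong_sets[OF sN sN])
  have UV: "(\<lambda>\<omega>. phi \<alpha> \<beta> (X \<omega>) (Y \<omega>)) \<in> measurable M ?N"
    using measurable_compose[OF XY pm] by simp
  have Sm: "?S \<in> sets (borel \<Otimes>\<^sub>M borel)" by (intro pair_measureI pd_borel)
  have Sm'[measurable]: "?S \<in> sets ?N" using Sm sN by simp
  have gm: "(\<lambda>z. f (?p z) * indicator ?S z) \<in> borel_measurable ?N"
    using measurable_compose[OF pm f] by measurable
  have "distr M ?N (\<lambda>\<omega>. phi \<alpha> \<beta> (X \<omega>) (Y \<omega>)) = density ?N (\<lambda>z. f (?p z) * indicator ?S z)"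
  proof (rule measure_eqI)
    fix B assume "B \<in> sets (distr M ?N (\<lambda>\<omega>. phi \<alpha> \<beta> (X \<omega>) (Y \<omega>)))"
    then have B[measurable]: "B \<in> sets ?N" by simp
    then have B'[measurable]: "B \<in> sets (borel \<Otimes>\<^sub>M borel)" using sN by simp
    have im: "(\<lambda>z. indicator B (?p z) * indicator ?S z :: ennreal) \<in> borel_measurable ?N"
      using measurable_compose[OF pm borel_measurable_indicator[OF B]] by measurable
    have "emeasure (distr M ?N (\<lambda>\<omega>. phi \<alpha> \<beta> (X \<omega>) (Y \<omega>))) B
        = (\<integral>\<^sup>+\<omega>. indicator B (phi \<alpha> \<beta> (X \<omega>) (Y \<omega>)) \<partial>M)"
    proof -
      have "emeasure (distr M ?N (\<lambda>\<omega>. phi \<alpha> \<beta> (X \<omega>) (Y \<omega>))) B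
          = (\<integral>\<^sup>+z. indicator B z \<partial>distr M ?N (\<lambda>\<omega>. phi \<alpha> \<beta> (X \<omega>) (Y \<omega>)))"
        by (rule nn_integral_indicator[symmetric]) simp
      also have "\<dots> = (\<integral>\<^sup>+\<omega>. indicator B (phi \<alpha> \<beta> (X \<omega>) (Y \<omega>)) \<partial>M)"
        by (rule nn_integral_distr[OF UV]) simp
      finally show ?thesis .
    qed
    also have "\<dots> = (\<integral>\<^sup>+\<omega>. (\<lambda>z. indicator B (?p z) * indicator ?S z) (X \<omega>, Y \<omega>) \<partial>M)"
      using pd by (intro nn_integral_cong) simp
    also have "\<dots> = (\<integral>\<^sup>+z. f z * (indicator B (?p z) * indicator ?S z) \<partial>?N)"
      by (rule distributed_nn_integral[OF d im, symmetric])
    also have "\<dots> = (\<integral>\<^sup>+z. (\<lambda>w. f (?p w) * indicator B w) (?p z) * indicator ?S z \<partial>?N)"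
      by (intro nn_integral_cong) (auto simp: indicator_def phi_invol[OF _ _ ab])
    also have "\<dots> = (\<integral>\<^sup>+z. (f (?p z) * indicator B z) * indicator ?S z \<partial>?N)"
      by (rule phi_preserves[OF _ ab]) (use measurable_compose[OF measurable_phi f'] in measurable)
    also have "\<dots> = emeasure (density ?N (\<lambda>z. f (?p z) * indicator ?S z)) B"
      using gm by (subst emeasure_density) (auto intro!: nn_integral_cong simp: mult_ac)
    finally show "emeasure (distr M ?N (\<lambda>\<omega>. phi \<alpha> \<beta> (X \<omega>) (Y \<omega>))) B
      = emeasure (density ?N (\<lambda>z. f (?p z) * indicator ?S z)) B" .
  qed simp
  then show ?thesis unfolding distributed_def using gm UV by blast
qed

text \<open>The given densities of X and Y may be nonzero off the cone, while MGIG densities vanish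
  there; since the values lie in S, cutting off outside S does not change the law.\<close>

lemma distributed_restrict:
  assumes d: "distributed M N Z f" and Z: "\<And>\<omega>. \<omega> \<in> space M \<Longrightarrow> Z \<omega> \<in> S" and S: "S \<in> sets N"
  shows "distr M N Z = density N (\<lambda>z. f z * indicator S z)"
proof (rule measure_eqI)
  have [measurable]: "f \<in> borel_measurable N" "Z \<in> measurable M N"
    using d by (auto simp: distributed_def)
  fix B assume "B \<in> sets (distr M N Z)"
  then have B: "B \<in> sets N" by simp
  have "emeasure (distr M N Z) B = emeasure M (Z -` (B \<inter> S) \<inter> space M)"
    using B Z by (subst emeasure_distr) (auto intro!: arg_cong[where f = "emeasure M"])
  also have "\<dots> = (\<integral>\<^sup>+z. f z * indicator (B \<inter> S) z \<partial>N)"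
    using B S by (intro distributed_emeasure[OF d]) auto
  also have "\<dots> = emeasure (density N (\<lambda>z. f z * indicator S z)) B"
    using B S by (subst emeasure_density) (auto intro!: nn_integral_cong simp: indicator_def)
  finally show "emeasure (distr M N Z) B = emeasure (density N (\<lambda>z. f z * indicator S z)) B" .
qed simp

section \<open>MGIG densities under \<open>phi\<close> and the conclusion\<close>

lemma mgig_dens_exp:
  fixes x :: "((real, 'n::{finite,linorder}) vec, 'n) vec"
  assumes "x \<in> pd_mats"
  shows "mgig_dens (\<kappa> + (real CARD('n) + 1) / 2) a b x = exp (\<kappa> * ln (det x) - inner_tr a x - inner_tr b (matrix_inv x))"
  using assms det_pd_pos[OF assms] by (simp add: mgig_dens_def powr_def exp_add[symmetric] exp_diff[symmetric] algebra_simps)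

lemma inner_tr_scaleR_left: "inner_tr (c *\<^sub>R a) x = c * inner_tr a x"
  by (simp add: inner_tr_def matrix_scaleR_left trace_def sum_distrib_left)

lemma inner_tr_add_right: "inner_tr a (x + y) = inner_tr a x + inner_tr a y"
  by (simp add: inner_tr_def matrix_add_ldistrib trace_add)

lemma inner_tr_scaleR_right: "inner_tr a (c *\<^sub>R x) = c * inner_tr a x"
  by (simp add: inner_tr_def matrix_scaleR_right trace_def sum_distrib_left)

text \<open>In the exponent a is paired with y^-1 + \<alpha> x and b with x^-1 + \<beta> y. The
  conserved quantities rewrite these as u^-1 + \<beta> v and v^-1 + \<alpha> u, so a and b exchange
  places.\<close>

lemma mgig_dens_phi:
  fixes u v :: "((real, 'n::{finite,linorder}) vec, 'n) vec"
  assumes "u \<in> pd_mats" "v \<in> pd_mats" "\<alpha> \<ge> 0" "\<beta> \<ge> 0"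
  defines "x \<equiv> fst (phi \<alpha> \<beta> u v)" and "y \<equiv> snd (phi \<alpha> \<beta> u v)"
  shows "mgig_dens lam (\<alpha> *\<^sub>R a) b x * mgig_dens lam (\<beta> *\<^sub>R b) a y
    = mgig_dens lam (\<alpha> *\<^sub>R b) a u * mgig_dens lam (\<beta> *\<^sub>R a) b v"
proof -
  have xy: "x \<in> pd_mats" "y \<in> pd_mats" unfolding x_def y_def using phi_pd[OF assms(1-4)] by auto
  have inv: "det x * det y = det u * det v" "matrix_inv x + \<beta> *\<^sub>R y = matrix_inv v + \<alpha> *\<^sub>R u"
    "matrix_inv y + \<alpha> *\<^sub>R x = matrix_inv u + \<beta> *\<^sub>R v"
    unfolding x_def y_def using phi_invariants[OF assms(1-4)] by auto
  define \<kappa> where "\<kappa> = lam - (real CARD('n) + 1) / 2"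
  have lam: "lam = \<kappa> + (real CARD('n) + 1) / 2" by (simp add: \<kappa>_def)
  have "ln (det x) + ln (det y) = ln (det u) + ln (det v)"
    using inv(1) det_pd_pos xy assms(1,2) by (metis ln_mult_pos)
  then have k: "\<kappa> * ln (det x) + \<kappa> * ln (det y) = \<kappa> * ln (det u) + \<kappa> * ln (det v)" by (metis distrib_left)
  have A: "inner_tr a (matrix_inv y) + \<alpha> * inner_tr a x = inner_tr a (matrix_inv u) + \<beta> * inner_tr a v"
    using arg_cong[OF inv(3), of "inner_tr a"] by (simp add: inner_tr_add_right inner_tr_scaleR_right)
  have B: "inner_tr b (matrix_inv x) + \<beta> * inner_tr b y = inner_tr b (matrix_inv v) + \<alpha> * inner_tr b u"
    using arg_cong[OF inv(2), of "inner_tr b"] by (simp add: inner_tr_add_right inner_tr_scaleR_right)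
  show ?thesis
    unfolding lam mgig_dens_exp[OF xy(1)] mgig_dens_exp[OF xy(2)] mgig_dens_exp[OF assms(1)] mgig_dens_exp[OF assms(2)]
      inner_tr_scaleR_left exp_add[symmetric]
    using k A B by simp
qed

theorem theorem2:
  fixes M :: "'s measure"
    and X Y :: "'s \<Rightarrow> ((real, 'n::{finite,linorder}) vec, 'n) vec"
    and fX fY :: "((real, 'n) vec, 'n) vec \<Rightarrow> real"
    and \<alpha> \<beta> :: real
  assumes "prob_space M"
    and "\<alpha> \<ge> 0" and "\<beta> \<ge> 0" and "\<alpha> \<noteq> \<beta>"
    and "\<forall>\<omega>\<in>space M. X \<omega> \<in> pd_mats" and "\<forall>\<omega>\<in>space M. Y \<omega> \<in> pd_mats"
    and "prob_space.indep_var M borel X borel Y"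
    and "\<forall>x. fX x \<ge> 0" and "\<forall>x. fY x \<ge> 0"
    and "distributed M leb_sym X (\<lambda>x. ennreal (fX x))"
    and "distributed M leb_sym Y (\<lambda>x. ennreal (fY x))"
    and "\<forall>x\<in>pd_mats. fX x > 0" and "\<forall>x\<in>pd_mats. fY x > 0"
    and "twice_differentiable_on_pd fX" and "twice_differentiable_on_pd fY"
    and "prob_space.indep_var M borel (\<lambda>\<omega>. fst (phi \<alpha> \<beta> (X \<omega>) (Y \<omega>)))
                                borel (\<lambda>\<omega>. snd (phi \<alpha> \<beta> (X \<omega>) (Y \<omega>)))"
  shows "\<exists>lam::real. \<exists>a\<in>pd_mats. \<exists>b\<in>pd_mats.
           distr M (leb_sym \<Otimes>\<^sub>M leb_sym) (\<lambda>\<omega>. (X \<omega>, Y \<omega>))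
             = MGIG lam (\<alpha> *\<^sub>R a) b \<Otimes>\<^sub>M MGIG lam (\<beta> *\<^sub>R b) a
         \<and> distr M (leb_sym \<Otimes>\<^sub>M leb_sym) (\<lambda>\<omega>. phi \<alpha> \<beta> (X \<omega>) (Y \<omega>))
             = MGIG lam (\<alpha> *\<^sub>R b) a \<Otimes>\<^sub>M MGIG lam (\<beta> *\<^sub>R a) b"
proof -
  interpret prob_space M by (rule assms(1))
  note ab = assms(2-4)
  let ?L = "leb_sym :: (((real, 'n) vec, 'n) vec) measure"
  let ?N = "?L \<Otimes>\<^sub>M ?L"
  let ?p = "\<lambda>z. phi \<alpha> \<beta> (fst z) (snd z)" and ?S = "pd_mats \<times> pd_mats :: (((real, 'n) vec, 'n) vec \<times> ((real, 'n) vec, 'n) vec) set"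
  have sL: "sigma_finite_measure ?L" by (rule sigma_finite_leb_sym)
  interpret L: sigma_finite_measure ?L by (rule sL)
  interpret P: pair_sigma_finite ?L ?L ..
  have sN: "sets ?N = sets (borel \<Otimes>\<^sub>M borel)" by (rule sets_pair_measure_cong) simp_all
  have dL: "distr M ?L Z = distr M borel Z" for Z by (rule distr_cong) simp_all
  have dN: "distr M ?N Z = distr M (borel \<Otimes>\<^sub>M borel) Z" for Z by (rule distr_cong) (simp_all add: sN)
  have indL: "distr M ?L Z \<Otimes>\<^sub>M distr M ?L W = distr M ?N (\<lambda>\<omega>. (Z \<omega>, W \<omega>))" if "indep_var borel Z borel W" for Z W
    using that unfolding indep_var_distribution_eq dL dN by blast
  have pdX: "\<And>\<omega>. \<omega> \<in> space M \<Longrightarrow> X \<omega> \<in> pd_mats" and pdY: "\<And>\<omega>. \<omega> \<in> space M \<Longrightarrow> Y \<omega> \<in> pd_mats"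
    using assms(5,6) by auto
  have dXY: "distributed M ?N (\<lambda>\<omega>. (X \<omega>, Y \<omega>)) (\<lambda>(x, y). ennreal (fX x) * ennreal (fY y))"
    by (rule distributed_joint_indep'[OF sL sL assms(10,11) indL[OF assms(7)]])
  have Sm: "?S \<in> sets ?N" unfolding sN by (intro pair_measureI pd_borel)
  define K where "K z = (case ?p z of (x, y) \<Rightarrow> ennreal (fX x) * ennreal (fY y)) * indicator ?S z" for z
  have dUV: "distributed M ?N (\<lambda>\<omega>. phi \<alpha> \<beta> (X \<omega>) (Y \<omega>)) K"
    unfolding K_def by (rule distributed_phi[OF ab(1,2) pdX pdY dXY])
  define U where "U \<omega> = fst (phi \<alpha> \<beta> (X \<omega>) (Y \<omega>))" for \<omega>
  define V where "V \<omega> = snd (phi \<alpha> \<beta> (X \<omega>) (Y \<omega>))" for \<omega>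
  have dUV': "distributed M ?N (\<lambda>\<omega>. (U \<omega>, V \<omega>)) K" using dUV by (simp add: U_def V_def)
  define fU where "fU u = (\<integral>\<^sup>+v. K (u, v) \<partial>?L)" for u
  define fV where "fV v = (\<integral>\<^sup>+u. K (u, v) \<partial>?L)" for v
  have dU: "distributed M ?L U fU" unfolding fU_def by (rule distr_marginal1[OF sL sL dUV'])
  have dV: "distributed M ?L V fV" unfolding fV_def by (rule distr_marginal2[OF sL sL dUV'])
  have "distributed M ?N (\<lambda>\<omega>. (U \<omega>, V \<omega>)) (\<lambda>(u, v). fU u * fV v)"
    by (rule distributed_joint_indep'[OF sL sL dU dV indL]) (unfold U_def[abs_def] V_def[abs_def], rule assms(16))
  from P.AE_pair[OF distributed_unique[OF dUV' this]]
  have ae0: "AE u in ?L. AE v in ?L. K (u, v) = fU u * fV v" by simp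
  \<comment> \<open>The density of (U, V) on the cone as a pointwise defined continuous function, in
    contrast to \<open>fU\<close> and \<open>fV\<close>.\<close>
  define h where "h u v = fX (fst (phi \<alpha> \<beta> u v)) * fY (snd (phi \<alpha> \<beta> u v))" for u v
  have Kh: "K (u, v) = ennreal (h u v)" if "u \<in> pd_mats" "v \<in> pd_mats" for u v
    using that assms(8,9) by (simp add: K_def h_def case_prod_beta ennreal_mult)
  have ae: "AE u in ?L. AE v in ?L. u \<in> pd_mats \<and> v \<in> pd_mats \<longrightarrow> ennreal (h u v) = fU u * fV v"
    using ae0 by (auto simp: Kh elim!: eventually_mono)
  have hpos: "h u v > 0" if "u \<in> pd_mats" "v \<in> pd_mats" for u v
    unfolding h_def using phi_pd[OF that ab(1,2)] assms(12,13) by (intro mult_pos_pos) blast+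
  have cX: "continuous_on pd_mats fX" and cY: "continuous_on pd_mats fY"
    using assms(14,15) by (auto intro: twice_differentiable_imp_continuous_on_pd)
  have cp: "continuous_on ?S (\<lambda>z. h (fst z) (snd z))"
    unfolding h_def
    by (intro continuous_on_mult continuous_on_compose2[OF cX] continuous_on_compose2[OF cY]
        continuous_on_fst continuous_on_snd continuous_on_phi ab)
       (auto intro: phi_pd ab)
  have hc1: "continuous_on pd_mats (h u)" if "u \<in> pd_mats" for u
  proof -
    have c: "continuous_on pd_mats (\<lambda>v. (u, v))" by (intro continuous_intros)
    have im: "(\<lambda>v. (u, v)) ` pd_mats \<subseteq> ?S" using that by auto
    from continuous_on_compose2[OF cp c im] show ?thesis by simp
  qed
  have hc2: "continuous_on pd_mats (\<lambda>u. h u v)" if "v \<in> pd_mats" for v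
  proof -
    have c: "continuous_on pd_mats (\<lambda>u. (u, v))" by (intro continuous_intros)
    have im: "(\<lambda>u. (u, v)) ` pd_mats \<subseteq> ?S" using that by auto
    from continuous_on_compose2[OF cp c im] show ?thesis by simp
  qed
  obtain u0 v0 where uv0: "u0 \<in> pd_mats" "v0 \<in> pd_mats" and
    fact: "\<And>u v. u \<in> pd_mats \<Longrightarrow> v \<in> pd_mats \<Longrightarrow> h u v * h u0 v0 = h u v0 * h u0 v"
    using factorization_from_independence[OF hpos hc1 hc2 ae] by metis
  define A where "A x = ln (fX x)" for x
  define B where "B y = ln (fY y)" for y
  \<comment> \<open>Logarithms of the cross-ratio identity, with the constant ln (h u0 v0) put into
    D.\<close>
  define C where "C u = ln (h u v0)" for u
  define D where "D v = ln (h u0 v) - ln (h u0 v0)" for v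
  have fe: "A x + B y = C (fst (phi \<alpha> \<beta> x y)) + D (snd (phi \<alpha> \<beta> x y))" if x: "x \<in> pd_mats" and y: "y \<in> pd_mats" for x y
  proof -
    let ?u = "fst (phi \<alpha> \<beta> x y)" and ?v = "snd (phi \<alpha> \<beta> x y)"
    have uv: "?u \<in> pd_mats" "?v \<in> pd_mats" using phi_pd[OF x y ab(1,2)] by auto
    have "h ?u ?v = fX x * fY y" unfolding h_def phi_invol[OF x y ab(1,2)] by simp
    then have "ln (h ?u ?v) = A x + B y"
      using assms(12,13) x y by (simp add: A_def B_def ln_mult_pos)
    moreover have "ln (h ?u ?v) + ln (h u0 v0) = ln (h ?u v0) + ln (h u0 ?v)"
      using fact[OF uv] hpos[OF uv] hpos[OF uv0] hpos[OF uv(1) uv0(2)] hpos[OF uv0(1) uv(2)]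
      by (metis ln_mult_pos)
    ultimately show ?thesis by (simp add: C_def D_def)
  qed
  obtain \<kappa> a b cA cB where sym: "transpose a = a" "transpose b = b"
    and Af: "\<And>x. x \<in> pd_mats \<Longrightarrow> A x = \<kappa> * ln (det x) - \<alpha> * inner_tr a x - inner_tr b (matrix_inv x) + cA"
    and Bf: "\<And>y. y \<in> pd_mats \<Longrightarrow> B y = \<kappa> * ln (det y) - \<beta> * inner_tr b y - inner_tr a (matrix_inv y) + cB"
  proof (rule matrix_functional_equation[of \<alpha> \<beta> A B C D])
    show "\<alpha> \<ge> 0" "\<beta> \<ge> 0" "\<alpha> \<noteq> \<beta>" using ab by auto
    show "A x + B y = C (fst (phi \<alpha> \<beta> x y)) + D (snd (phi \<alpha> \<beta> x y))" if "x \<in> pd_mats" "y \<in> pd_mats" for x y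
      using that by (rule fe)
    show "twice_along A" "twice_along B"
      unfolding A_def B_def using assms(12-15) by (auto intro: twice_differentiable_imp_twice_along_ln)
    show "(\<lambda>M. A (sympart M)) differentiable (at x)" "(\<lambda>M. B (sympart M)) differentiable (at x)" if "x \<in> pd_mats" for x
      unfolding A_def B_def using assms(12-15) that by (auto intro: ln_differentiable_sympart)
  qed (rule that)
  \<comment> \<open>Undoes the shift by (r + 1) / 2 in the exponent of the determinant.\<close>
  define lam where "lam = \<kappa> + (real CARD('n) + 1) / 2"
  have fXm: "fX x = exp cA * mgig_dens lam (\<alpha> *\<^sub>R a) b x" if "x \<in> pd_mats" for x
  proof -
    have "fX x = exp (A x)" using assms(12) that by (simp add: A_def)
    then show ?thesis
      using that by (simp add: Af lam_def mgig_dens_exp inner_tr_scaleR_left exp_add mult.commute)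
  qed
  have fYm: "fY y = exp cB * mgig_dens lam (\<beta> *\<^sub>R b) a y" if "y \<in> pd_mats" for y
  proof -
    have "fY y = exp (B y)" using assms(13) that by (simp add: B_def)
    then show ?thesis
      using that by (simp add: Bf lam_def mgig_dens_exp inner_tr_scaleR_left exp_add mult.commute)
  qed
  define c where "c = exp cA * exp cB"
  have c: "c > 0" by (simp add: c_def)
  have md0: "mgig_dens l a' b' x \<ge> 0" for l a' b' and x :: "((real, 'n) vec, 'n) vec"
    by (simp add: mgig_dens_def)
  have mdm: "mgig_dens l a' b' \<in> borel_measurable ?L" for l and a' b' :: "((real, 'n) vec, 'n) vec"
    using measurable_mgig_dens by (simp add: measurable_cong_sets[OF sets_leb_sym refl])
  have mout: "mgig_dens l a' b' x = 0" if "x \<notin> pd_mats" for l a' b' and x :: "((real, 'n) vec, 'n) vec"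
    using that by (simp add: mgig_dens_def)
  have eqXY: "distr M ?N (\<lambda>\<omega>. (X \<omega>, Y \<omega>))
     = density ?N (\<lambda>z. ennreal (c * (mgig_dens lam (\<alpha> *\<^sub>R a) b (fst z) * mgig_dens lam (\<beta> *\<^sub>R b) a (snd z))))"
  proof -
    have "distr M ?N (\<lambda>\<omega>. (X \<omega>, Y \<omega>)) = density ?N (\<lambda>z. (case z of (x, y) \<Rightarrow> ennreal (fX x) * ennreal (fY y)) * indicator ?S z)"
      by (rule distributed_restrict[OF dXY]) (use pdX pdY Sm in auto)
    also have "\<dots> = density ?N (\<lambda>z. ennreal (c * (mgig_dens lam (\<alpha> *\<^sub>R a) b (fst z) * mgig_dens lam (\<beta> *\<^sub>R b) a (snd z))))"
    proof (rule arg_cong[where f = "density ?N"], rule ext)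
      fix z :: "((real, 'n) vec, 'n) vec \<times> ((real, 'n) vec, 'n) vec"
      show "(case z of (x, y) \<Rightarrow> ennreal (fX x) * ennreal (fY y)) * indicator ?S z
        = ennreal (c * (mgig_dens lam (\<alpha> *\<^sub>R a) b (fst z) * mgig_dens lam (\<beta> *\<^sub>R b) a (snd z)))"
      proof (cases "z \<in> ?S")
        case True
        then have "fst z \<in> pd_mats" "snd z \<in> pd_mats" by auto
        then have "fX (fst z) * fY (snd z) = c * (mgig_dens lam (\<alpha> *\<^sub>R a) b (fst z) * mgig_dens lam (\<beta> *\<^sub>R b) a (snd z))"
          by (simp add: fXm fYm c_def)
        then show ?thesis using True assms(8,9) by (simp add: case_prod_beta flip: ennreal_mult)
      next
        case False
        then have "fst z \<notin> pd_mats \<or> snd z \<notin> pd_mats" by (auto simp: mem_Times_iff)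
        then show ?thesis using False mout by auto
      qed
    qed
    finally show ?thesis .
  qed
  have eqUV: "distr M ?N (\<lambda>\<omega>. phi \<alpha> \<beta> (X \<omega>) (Y \<omega>))
     = density ?N (\<lambda>z. ennreal (c * (mgig_dens lam (\<alpha> *\<^sub>R b) a (fst z) * mgig_dens lam (\<beta> *\<^sub>R a) b (snd z))))"
  proof -
    have "distr M ?N (\<lambda>\<omega>. phi \<alpha> \<beta> (X \<omega>) (Y \<omega>)) = density ?N K" using dUV by (rule distributed_distr_eq_density)
    also have "K = (\<lambda>z. ennreal (c * (mgig_dens lam (\<alpha> *\<^sub>R b) a (fst z) * mgig_dens lam (\<beta> *\<^sub>R a) b (snd z))))"
    proof (rule ext)
      fix z :: "((real, 'n) vec, 'n) vec \<times> ((real, 'n) vec, 'n) vec"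
      show "K z = ennreal (c * (mgig_dens lam (\<alpha> *\<^sub>R b) a (fst z) * mgig_dens lam (\<beta> *\<^sub>R a) b (snd z)))"
      proof (cases "z \<in> ?S")
        case True
        then have uv: "fst z \<in> pd_mats" "snd z \<in> pd_mats" by auto
        have "h (fst z) (snd z) = c * (mgig_dens lam (\<alpha> *\<^sub>R a) b (fst (?p z)) * mgig_dens lam (\<beta> *\<^sub>R b) a (snd (?p z)))"
          using phi_pd[OF uv ab(1,2)] by (simp add: h_def fXm fYm c_def)
        then show ?thesis using Kh[OF uv] by (simp add: mgig_dens_phi[OF uv ab(1,2)])
      next
        case False
        then have "fst z \<notin> pd_mats \<or> snd z \<notin> pd_mats" by (auto simp: mem_Times_iff)
        then show ?thesis using False mout by (auto simp: K_def)
      qed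
    qed
    finally show ?thesis .
  qed
  have pXY: "prob_space (distr M ?N (\<lambda>\<omega>. (X \<omega>, Y \<omega>)))"
    by (rule prob_space_distr) (rule distributed_measurable[OF dXY])
  have pUV: "prob_space (distr M ?N (\<lambda>\<omega>. phi \<alpha> \<beta> (X \<omega>) (Y \<omega>)))"
    by (rule prob_space_distr) (rule distributed_measurable[OF dUV])
  note nXY = normalized_product_density[OF sL mdm md0 mdm md0 c pXY[unfolded eqXY]]
  note nUV = normalized_product_density[OF sL mdm md0 mdm md0 c pUV[unfolded eqUV]]
  \<comment> \<open>Normalization of both laws makes four integrals finite. Those of X and U are
    used when \<alpha> > 0, and those of Y and V when \<alpha> = 0.\<close>
  have "a \<in> pd_mats \<and> b \<in> pd_mats"
  proof (cases "\<alpha> > 0")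
    case True
    then show ?thesis using mgig_parameters_pd[OF sym True nXY(2) nUV(2)] by blast
  next
    case False
    then have "\<beta> > 0" using ab by simp
    from mgig_parameters_pd[OF sym(2,1) this nXY(3) nUV(3)] show ?thesis by blast
  qed
  moreover have "distr M ?N (\<lambda>\<omega>. (X \<omega>, Y \<omega>)) = MGIG lam (\<alpha> *\<^sub>R a) b \<Otimes>\<^sub>M MGIG lam (\<beta> *\<^sub>R b) a"
    unfolding eqXY MGIG_def by (rule nXY(1))
  moreover have "distr M ?N (\<lambda>\<omega>. phi \<alpha> \<beta> (X \<omega>) (Y \<omega>)) = MGIG lam (\<alpha> *\<^sub>R b) a \<Otimes>\<^sub>M MGIG lam (\<beta> *\<^sub>R a) b"
    unfolding eqUV MGIG_def by (rule nUV(1))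
  ultimately show ?thesis by blast
qed

end
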